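(* Let $A$ be a stably finite infinite dimensional simple unital C*-algebra, and let $B \subset A$ be a large subalgebra. Then $B$ is stably large in $A$.
   Context: Subalgebras are C*-subalgebras; a unital subalgebra of $A$ contains the identity of $A$. For a C*-algebra $D$ and $a, b \in D_{+}$ (positive elements), $a \precsim_D b$ (Cuntz subequivalence) means there is a sequence $(v_n)$ in $D$ with $\lim_{n \to \infty} v_n b v_n^* = a$. Large subalgebra: let $A$ be an infinite dimensional simple unital C*-algebra. A unital subalgebra $B \subset A$ is large in $A$ if for every integer $m \geq 1$, $a_1, \ldots, a_m \in A$, $\varepsilon > 0$, $x \in A_{+}$ with $\|x\| = 1$, and $y \in B_{+} \setminus \{0\}$, there are $c_1, \ldots, c_m \in A$ and $g \in B$ such that: (1) $0 \leq g \leq 1$; (2) $\|c_j - a_j\| < \varepsilon$ for $j = 1, \ldots, m$; (3) $(1-g) c_j \in B$ for $j = 1, \ldots, m$; (4) $g \precsim_B y$ and $g \precsim_A x$; (5) $\|(1-g) x (1-g)\| > 1 - \varepsilon$. $B$ is stably large in $A$ if $M_n(B)$ is large in $M_n(A)$ for all integers $n \geq 1$. A unital C*-algebra $A$ is finite if $s^* s = 1$ implies $s s^* = 1$, and stably finite if $M_n(A)$ is finite for all $n \geq 1$. *)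

theory Defs
  imports
    "HOL-Algebra.Module"
    "HOL-Algebra.Subrings"
    "HOL-Analysis.Abstract_Metric_Spaces"
    "Jordan_Normal_Form.Matrix"
begin

section \<open>Unital C*-algebras with explicit carriers\<close>

text \<open>
  The library locale for algebras over a ring demands a commutative multiplication, so the scalar
  action is taken from \<open>Module.module\<close> over the ring record of the complex numbers and
  multiplication from \<open>ring\<close>. A subalgebra \<open>B\<close> of \<open>A\<close> is a subset of the carrier; as
  usual in HOL-Algebra, it becomes an algebra of its own as \<open>A\<lparr>carrier := B\<rparr>\<close>.
\<close>

definition complex_ring :: "complex ring" where
  "complex_ring = \<lparr>carrier = UNIV, monoid.mult = (*), one = 1, ring.zero = 0, ring.add = (+)\<rparr>"

record 'a star_alg = "(complex, 'a) module" +
  star :: "'a \<Rightarrow> 'a"  (\<open>(_\<^sup>\<star>\<index>)\<close> [1000] 999)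
  nrm :: "'a \<Rightarrow> real"  (\<open>(\<parallel>_\<parallel>\<index>)\<close>)

text \<open>
  The conditional only makes the function symmetric and nonnegative everywhere, which the library
  locale \<open>Metric_space\<close> requires also outside the carrier.
\<close>

definition norm_dist :: "'a star_alg \<Rightarrow> 'a \<Rightarrow> 'a \<Rightarrow> real" where
  "norm_dist A x y =
     (if x \<in> carrier A \<and> y \<in> carrier A then nrm A (x \<ominus>\<^bsub>A\<^esub> y) else 0)"

abbreviation norm_topology :: "'a star_alg \<Rightarrow> 'a topology" where
  "norm_topology A \<equiv> Metric_space.mtopology (carrier A) (norm_dist A)"

locale unital_cstar_algebra = ring A for A :: "'a star_alg" (structure) +
  assumes complex_module: "Module.module complex_ring A"
    and smult_mult_left:
      "\<lbrakk>x \<in> carrier A; y \<in> carrier A\<rbrakk> \<Longrightarrow> (c \<odot> x) \<otimes> y = c \<odot> (x \<otimes> y)"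
    and smult_mult_right:
      "\<lbrakk>x \<in> carrier A; y \<in> carrier A\<rbrakk> \<Longrightarrow> x \<otimes> (c \<odot> y) = c \<odot> (x \<otimes> y)"
    and star_closed: "x \<in> carrier A \<Longrightarrow> x\<^sup>\<star> \<in> carrier A"
    and star_star: "x \<in> carrier A \<Longrightarrow> (x\<^sup>\<star>)\<^sup>\<star> = x"
    and star_add:
      "\<lbrakk>x \<in> carrier A; y \<in> carrier A\<rbrakk> \<Longrightarrow> (x \<oplus> y)\<^sup>\<star> = x\<^sup>\<star> \<oplus> y\<^sup>\<star>"
    and star_smult: "x \<in> carrier A \<Longrightarrow> (c \<odot> x)\<^sup>\<star> = cnj c \<odot> x\<^sup>\<star>"
    and star_mult:
      "\<lbrakk>x \<in> carrier A; y \<in> carrier A\<rbrakk> \<Longrightarrow> (x \<otimes> y)\<^sup>\<star> = y\<^sup>\<star> \<otimes> x\<^sup>\<star>"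
    and nrm_eq_0: "x \<in> carrier A \<Longrightarrow> \<parallel>x\<parallel> = 0 \<longleftrightarrow> x = \<zero>"
    and nrm_triangle:
      "\<lbrakk>x \<in> carrier A; y \<in> carrier A\<rbrakk> \<Longrightarrow> \<parallel>x \<oplus> y\<parallel> \<le> \<parallel>x\<parallel> + \<parallel>y\<parallel>"
    and nrm_smult: "x \<in> carrier A \<Longrightarrow> \<parallel>c \<odot> x\<parallel> = cmod c * \<parallel>x\<parallel>"
    and nrm_mult:
      "\<lbrakk>x \<in> carrier A; y \<in> carrier A\<rbrakk> \<Longrightarrow> \<parallel>x \<otimes> y\<parallel> \<le> \<parallel>x\<parallel> * \<parallel>y\<parallel>"
    and cstar_identity: "x \<in> carrier A \<Longrightarrow> \<parallel>x\<^sup>\<star> \<otimes> x\<parallel> = \<parallel>x\<parallel>\<^sup>2"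
    and complete: "Metric_space.mcomplete (carrier A) (norm_dist A)"

definition unital_cstar_subalgebra :: "'a set \<Rightarrow> 'a star_alg \<Rightarrow> bool" where
  "unital_cstar_subalgebra B A \<longleftrightarrow>
     subring B A \<and>
     (\<forall>c. \<forall>x\<in>B. c \<odot>\<^bsub>A\<^esub> x \<in> B) \<and>
     (\<forall>x\<in>B. star A x \<in> B) \<and>
     closedin (norm_topology A) B"

definition simple_cstar :: "'a star_alg \<Rightarrow> bool" where
  "simple_cstar A \<longleftrightarrow>
     carrier A \<noteq> {\<zero>\<^bsub>A\<^esub>} \<and>
     (\<forall>I. ideal I A \<and> closedin (norm_topology A) I \<longrightarrow> I = {\<zero>\<^bsub>A\<^esub>} \<or> I = carrier A)"

definition infinite_dimensional :: "'a star_alg \<Rightarrow> bool" where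
  "infinite_dimensional A \<longleftrightarrow>
     \<not> (\<exists>S. finite S \<and> S \<subseteq> carrier A \<and>
          (\<forall>x\<in>carrier A. \<exists>c. x = (\<Oplus>\<^bsub>A\<^esub>s\<in>S. c s \<odot>\<^bsub>A\<^esub> s)))"


section \<open>Positivity and Cuntz subequivalence\<close>

definition spectrum :: "'a star_alg \<Rightarrow> 'a \<Rightarrow> complex set" where
  "spectrum A a = {z. (z \<odot>\<^bsub>A\<^esub> \<one>\<^bsub>A\<^esub>) \<ominus>\<^bsub>A\<^esub> a \<notin> Units A}"

definition positives :: "'a star_alg \<Rightarrow> 'a set" where
  "positives A =
     {a \<in> carrier A. star A a = a \<and> (\<forall>z\<in>spectrum A a. Im z = 0 \<and> Re z \<ge> 0)}"

definition cuntz_subeq :: "'a star_alg \<Rightarrow> 'a \<Rightarrow> 'a \<Rightarrow> bool" where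
  "cuntz_subeq D a b \<longleftrightarrow>
     (\<exists>v :: nat \<Rightarrow> 'a. (\<forall>n. v n \<in> carrier D) \<and>
        limitin (norm_topology D) (\<lambda>n. v n \<otimes>\<^bsub>D\<^esub> b \<otimes>\<^bsub>D\<^esub> star D (v n)) a sequentially)"


section \<open>Large subalgebras\<close>

definition large_subalgebra :: "'a set \<Rightarrow> 'a star_alg \<Rightarrow> bool" where
  "large_subalgebra B A \<longleftrightarrow>
     unital_cstar_algebra A \<and> infinite_dimensional A \<and> simple_cstar A \<and>
     unital_cstar_subalgebra B A \<and>
     (\<forall>m::nat. \<forall>a :: nat \<Rightarrow> 'a. \<forall>\<epsilon>::real. \<forall>x y.
        m \<ge> 1 \<and> (\<forall>j\<in>{1..m}. a j \<in> carrier A) \<and> \<epsilon> > 0 \<and>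
        x \<in> positives A \<and> nrm A x = 1 \<and>
        y \<in> positives (A\<lparr>carrier := B\<rparr>) - {\<zero>\<^bsub>A\<^esub>} \<longrightarrow>
        (\<exists>c :: nat \<Rightarrow> 'a. \<exists>g\<in>B.
           (\<forall>j\<in>{1..m}. c j \<in> carrier A) \<and>
           g \<in> positives (A\<lparr>carrier := B\<rparr>) \<and> \<one>\<^bsub>A\<^esub> \<ominus>\<^bsub>A\<^esub> g \<in> positives (A\<lparr>carrier := B\<rparr>) \<and>
           (\<forall>j\<in>{1..m}. nrm A (c j \<ominus>\<^bsub>A\<^esub> a j) < \<epsilon>) \<and>
           (\<forall>j\<in>{1..m}. (\<one>\<^bsub>A\<^esub> \<ominus>\<^bsub>A\<^esub> g) \<otimes>\<^bsub>A\<^esub> c j \<in> B) \<and>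
           cuntz_subeq (A\<lparr>carrier := B\<rparr>) g y \<and> cuntz_subeq A g x \<and>
           nrm A ((\<one>\<^bsub>A\<^esub> \<ominus>\<^bsub>A\<^esub> g) \<otimes>\<^bsub>A\<^esub> x \<otimes>\<^bsub>A\<^esub> (\<one>\<^bsub>A\<^esub> \<ominus>\<^bsub>A\<^esub> g)) > 1 - \<epsilon>))"


section \<open>Matrix algebras\<close>

definition mats_over :: "nat \<Rightarrow> nat \<Rightarrow> 'a set \<Rightarrow> 'a mat set" where
  "mats_over n k S = {X \<in> carrier_mat n k. elements_mat X \<subseteq> S}"

definition mat_times :: "'a star_alg \<Rightarrow> 'a mat \<Rightarrow> 'a mat \<Rightarrow> 'a mat" where
  "mat_times A X Y =
     mat (dim_row X) (dim_col Y)
       (\<lambda>(i, j). \<Oplus>\<^bsub>A\<^esub>k\<in>{..<dim_col X}. X $$ (i, k) \<otimes>\<^bsub>A\<^esub> Y $$ (k, j))"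

definition mat_star :: "'a star_alg \<Rightarrow> 'a mat \<Rightarrow> 'a mat" where
  "mat_star A X = mat (dim_col X) (dim_row X) (\<lambda>(i, j). star A (X $$ (j, i)))"

text \<open>
  Columns \<open>v\<close> over \<open>A\<close> form the Hilbert \<open>A\<close>-module \<open>A\<^sup>n\<close>, where the norm of \<open>v\<close> is the
  square root of the norm of the single entry of \<open>v* v\<close>. The C*-norm of \<open>M\<^sub>n(A)\<close> is the operator
  norm of its action on \<open>A\<^sup>n\<close> (a C*-norm on a C*-algebra is unique, and \<open>large_subalgebra\<close>
  requires \<open>M\<^sub>n(A)\<close> to be a C*-algebra).
\<close>

definition column_norm :: "'a star_alg \<Rightarrow> 'a mat \<Rightarrow> real" where
  "column_norm A v = sqrt (nrm A (mat_times A (mat_star A v) v $$ (0, 0)))"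

definition mat_norm :: "'a star_alg \<Rightarrow> nat \<Rightarrow> 'a mat \<Rightarrow> real" where
  "mat_norm A n X =
     Sup {column_norm A (mat_times A X v) | v.
            v \<in> mats_over n 1 (carrier A) \<and> column_norm A v \<le> 1}"

definition matrix_algebra :: "nat \<Rightarrow> 'a star_alg \<Rightarrow> 'a mat star_alg" where
  "matrix_algebra n A =
     \<lparr>carrier = mats_over n n (carrier A),
      monoid.mult = mat_times A,
      one = mat n n (\<lambda>(i, j). if i = j then \<one>\<^bsub>A\<^esub> else \<zero>\<^bsub>A\<^esub>),
      ring.zero = mat n n (\<lambda>_. \<zero>\<^bsub>A\<^esub>),
      ring.add = (\<lambda>X Y. mat n n (\<lambda>(i, j). X $$ (i, j) \<oplus>\<^bsub>A\<^esub> Y $$ (i, j))),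
      smult = (\<lambda>c X. mat n n (\<lambda>(i, j). c \<odot>\<^bsub>A\<^esub> X $$ (i, j))),
      star = mat_star A,
      nrm = mat_norm A n\<rparr>"

definition stably_large :: "'a set \<Rightarrow> 'a star_alg \<Rightarrow> bool" where
  "stably_large B A \<longleftrightarrow>
     (\<forall>n\<ge>1. large_subalgebra (mats_over n n B) (matrix_algebra n A))"

definition finite_cstar :: "'a star_alg \<Rightarrow> bool" where
  "finite_cstar A \<longleftrightarrow>
     (\<forall>s\<in>carrier A. star A s \<otimes>\<^bsub>A\<^esub> s = \<one>\<^bsub>A\<^esub> \<longrightarrow> s \<otimes>\<^bsub>A\<^esub> star A s = \<one>\<^bsub>A\<^esub>)"

definition stably_finite :: "'a star_alg \<Rightarrow> bool" where
  "stably_finite A \<longleftrightarrow> (\<forall>n\<ge>1. finite_cstar (matrix_algebra n A))"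

end

theory Submission
  imports Defs "HOL-Analysis.Analysis" "HOL-Computational_Algebra.Fundamental_Theorem_Algebra"
begin

text \<open>
  Given a finite family in \<open>M\<^sub>n(A)\<close>, apply largeness of \<open>B\<close> to all matrix entries at once and put the
  resulting \<open>g\<close> on the diagonal. The approximation and the membership in \<open>M\<^sub>n(B)\<close> are then entrywise.
  For the Cuntz subequivalences, a nonzero positive \<open>x\<close> in \<open>M\<^sub>n(A)\<close> has a nonzero diagonal entry, and
  since \<open>A\<close> is simple without minimal projections, there are a positive \<open>e\<close> and \<open>V\<^sub>1, \<dots>, V\<^sub>N\<close> with
  \<open>V\<^sub>i x\<^sub>l\<^sub>l V\<^sub>j* = \<delta>\<^sub>i\<^sub>j e\<close>; hence \<open>g \<precsim> e\<close> gives \<open>diag g \<precsim> x\<close>. The same works in \<open>B\<close>, which inherits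
  simplicity and the absence of minimal projections from \<open>A\<close> by largeness. The lower norm bound costs
  nothing: if \<open>M\<^sub>n(A)\<close> is finite and \<open>g\<close> lies below an element with sufficiently many orthogonal copies,
  cutting down by \<open>1 - g\<close> cannot lose norm.

  Operator-theoretic arguments take place in a type class; the algebras with carrier sets are
  embedded as corners of one algebra of that class, their bounded product.
\<close>

section \<open>C*-algebras as a type class\<close>

text \<open>The obstacle is condition (5): largeness in \<open>A\<close> bounds the compression of
  one element of \<open>A\<close>, and this says nothing about an \<open>x\<close> in
  \<open>M_n(A)\<close>. Counting replaces it. A spectral cut-down of \<open>x\<close> near its top
  value yields the unit as a sum of \<open>k\<close> conjugates, and \<open>k\<close> depends on
  \<open>x\<close> and the tolerance alone, so it is known before \<open>g\<close> has to be found.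
  Now take \<open>max n (k + 1)\<close> orthogonal copies of \<open>e\<close> under a diagonal entry
  of \<open>x\<close>: \<open>n\<close> of them fill the diagonal in
  \<open>diag g \<precsim> x\<close>, and \<open>k + 1\<close> of them drive the norm bound, moved
  into \<open>M_n(A)\<close> as \<open>diag (s * adj (U r))\<close> where the entry is
  \<open>adj s * s\<close>. The algebras \<open>A\<close> and \<open>A\<close> with carrier
  \<open>B\<close> are different factors of the product, so no equation holds between their images.
  Facts travel between them only through what both see alike: norms of differences and the form
  \<open>adj s * s\<close> of positive elements.\<close>

text \<open>
  The complex scalars enter through the central embedding \<open>ofc\<close>; the scalar multiple \<open>z x\<close> is
  \<open>ofc z * x\<close>.
\<close>

class cstar = real_normed_algebra_1 + banach +
  fixes ofc :: "complex \<Rightarrow> 'a"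
    and adj :: "'a \<Rightarrow> 'a"
  assumes ofc_add: "ofc (u + v) = ofc u + ofc v"
    and ofc_mult: "ofc (u * v) = ofc u * ofc v"
    and ofc_scaleR: "ofc (complex_of_real r) = r *\<^sub>R 1"
    and ofc_commute: "ofc u * x = x * ofc u"
    and adj_adj [simp]: "adj (adj x) = x"
    and adj_add: "adj (x + y) = adj x + adj y"
    and adj_mult: "adj (x * y) = adj y * adj x"
    and adj_ofc: "adj (ofc u) = ofc (cnj u)"
    and norm_adj_mult: "norm (adj x * x) = (norm x)\<^sup>2"

lemma ofc_of_real: "ofc (complex_of_real r) = of_real r"
  by (subst ofc_scaleR) (simp only: of_real_def)

lemma ofc_0 [simp]: "ofc 0 = 0"
  using ofc_of_real[of 0] by simp

lemma ofc_1 [simp]: "ofc 1 = 1"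
  using ofc_of_real[of 1] by simp

lemma ofc_minus: "ofc (- u) = - ofc u"
proof -
  have "ofc (- u) + ofc u = 0"
    unfolding ofc_add[symmetric] by simp
  then show ?thesis by (simp add: eq_neg_iff_add_eq_0)
qed

lemma ofc_diff: "ofc (u - v) = ofc u - ofc v"
  using ofc_add[of u "- v"] by (simp add: ofc_minus)

lemma ofc_left_commute: "x * (ofc u * y) = ofc u * (x * y)"
  by (metis mult.assoc ofc_commute)

lemma ofc_mult_inverse: "u \<noteq> 0 \<Longrightarrow> ofc u * ofc (inverse u) = 1"
  by (simp flip: ofc_mult)

lemma adj_0 [simp]: "adj 0 = 0"
  using adj_add[of 0 0] by simp

lemma adj_1 [simp]: "adj 1 = 1"
  using adj_ofc[of 1] by simp

lemma adj_minus: "adj (- x) = - adj x"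
proof -
  have "adj (- x) + adj x = 0"
    unfolding adj_add[symmetric] by simp
  then show ?thesis by (simp add: eq_neg_iff_add_eq_0)
qed

lemma adj_diff: "adj (x - y) = adj x - adj y"
  using adj_add[of x "- y"] by (simp add: adj_minus)

lemma adj_of_real [simp]: "adj (of_real r) = of_real r"
  by (metis adj_ofc complex_cnj_complex_of_real ofc_of_real)

lemma adj_scaleR: "adj (r *\<^sub>R x) = r *\<^sub>R adj x"
  by (metis adj_mult adj_of_real scaleR_conv_of_real mult.commute ofc_commute ofc_of_real)

lemma adj_sum: "adj (sum f S) = (\<Sum>i\<in>S. adj (f i))"
  by (induction S rule: infinite_finite_induct) (simp_all add: adj_add)

lemma adj_power: "adj (x ^ n) = adj x ^ n"
  by (induction n) (simp_all add: adj_mult power_commutes)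

lemma adj_eq_0_iff [simp]: "adj x = 0 \<longleftrightarrow> x = 0"
  by (metis adj_0 adj_adj)

lemma norm_adj [simp]: "norm (adj x) = norm x"
proof -
  have le: "norm y \<le> norm (adj y)" for y
  proof (cases "norm y = 0")
    case False
    have "norm y * norm y \<le> norm (adj y) * norm y"
      using norm_adj_mult[of y] norm_mult_ineq[of "adj y" y] by (simp add: power2_eq_square)
    with False show ?thesis
      by (simp add: mult_right_le_imp_le)
  qed (metis norm_ge_zero)
  show ?thesis
    using le[of x] le[of "adj x"] by simp
qed

lemma norm_mult_adj: "norm (x * adj x) = (norm x)\<^sup>2"
  using norm_adj_mult[of "adj x"] by simp

lemma adj_mult_eq_0_iff [simp]: "adj x * x = 0 \<longleftrightarrow> x = 0"
  by (metis norm_adj_mult norm_eq_zero zero_eq_power2)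

lemma mult_adj_eq_0_iff [simp]: "x * adj x = 0 \<longleftrightarrow> x = 0"
  using adj_mult_eq_0_iff[of "adj x"] by simp

text \<open>The class fixes the norm of real multiples only. For complex ones the C*-identity
  decides, because \<open>adj (ofc u * x) * (ofc u * x)\<close> is \<open>adj x * x\<close> times
  the real number \<open>(cmod u)\<^sup>2\<close>.\<close>

lemma norm_ofc_mult: "norm (ofc u * x) = cmod u * norm x"
proof -
  have "adj (ofc u * x) * (ofc u * x) = adj x * (ofc (cnj u * u) * x)"
    by (simp add: adj_mult adj_ofc ofc_mult mult.assoc)
  also have "\<dots> = ofc (complex_of_real ((cmod u)\<^sup>2)) * (adj x * x)"
    by (subst ofc_left_commute) (simp only: complex_norm_square mult.commute)
  finally have "(norm (ofc u * x))\<^sup>2 = norm (((cmod u)\<^sup>2) *\<^sub>R (adj x * x))"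
    by (metis norm_adj_mult ofc_of_real scaleR_conv_of_real)
  also have "\<dots> = (cmod u * norm x)\<^sup>2"
    by (simp add: norm_adj_mult power_mult_distrib)
  finally show ?thesis by simp
qed

lemma norm_ofc [simp]: "norm (ofc u) = cmod u"
  using norm_ofc_mult[of u 1] by simp

lemma bounded_linear_ofc: "bounded_linear (ofc :: complex \<Rightarrow> 'a::cstar)"
proof (rule bounded_linear_intro[where K = 1])
  show "ofc (r *\<^sub>R u) = r *\<^sub>R (ofc u :: 'a)" for r u
    by (simp add: scaleR_conv_of_real ofc_mult ofc_of_real)
qed (auto simp: ofc_add)

lemma bounded_linear_adj: "bounded_linear (adj :: 'a::cstar \<Rightarrow> 'a)"
  by (rule bounded_linear_intro[of _ 1]) (auto simp: adj_add adj_scaleR)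

lemmas tendsto_ofc [tendsto_intros] = bounded_linear.tendsto[OF bounded_linear_ofc]
lemmas tendsto_adj [tendsto_intros] = bounded_linear.tendsto[OF bounded_linear_adj]

subsection \<open>Invertibility\<close>

definition invertible_elt :: "'a::monoid_mult \<Rightarrow> bool" where
  "invertible_elt x \<longleftrightarrow> (\<exists>y. x * y = 1 \<and> y * x = 1)"

definition minv :: "'a::monoid_mult \<Rightarrow> 'a" where
  "minv x = (SOME y. x * y = 1 \<and> y * x = 1)"

lemma invertible_eltI: "x * y = 1 \<Longrightarrow> y * x = 1 \<Longrightarrow> invertible_elt x"
  unfolding invertible_elt_def by blast

lemma minv:
  assumes "invertible_elt x"
  shows "x * minv x = 1" "minv x * x = 1"
  using someI_ex[OF assms[unfolded invertible_elt_def]] unfolding minv_def by blast+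

lemma minv_unique:
  assumes "x * y = 1" "y * x = 1"
  shows "minv x = y"
  by (metis assms invertible_eltI minv(1) mult.assoc mult_1_left mult_1_right)

lemma invertible_mult:
  assumes "invertible_elt x" "invertible_elt y"
  shows "invertible_elt (x * y)"
proof (rule invertible_eltI)
  show "x * y * (minv y * minv x) = 1"
    by (metis assms minv(1) mult.assoc mult_1_right)
  show "minv y * minv x * (x * y) = 1"
    by (metis assms minv(2) mult.assoc mult_1_right)
qed

lemma invertible_left_right:
  assumes "x * y = 1" "z * x = 1"
  shows "invertible_elt (x :: 'a::monoid_mult)"
  by (metis assms invertible_eltI mult.assoc mult_1_left mult_1_right)

lemma invertible_1_minus:
  fixes x :: "'a::{real_normed_algebra_1,banach}"
  assumes "norm x < 1"
  shows "invertible_elt (1 - x)"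
proof (rule invertible_eltI)
  let ?S = "\<Sum>n. x ^ n"
  have s: "summable (\<lambda>n. x ^ n)"
    by (rule complete_algebra_summable_geometric[OF assms])
  have lim: "(\<lambda>n. x ^ n) \<longlonglongrightarrow> 0"
    by (rule summable_LIMSEQ_zero[OF s])
  have eq1: "(1 - x) * (\<Sum>i<n. x ^ i) = 1 - x ^ n" for n
    by (induction n) (simp_all add: distrib_left left_diff_distrib)
  have eq2: "(\<Sum>i<n. x ^ i) * (1 - x) = 1 - x ^ n" for n
    by (induction n) (simp_all add: distrib_right right_diff_distrib power_commutes flip: diff_add_eq)
  have "(\<lambda>n. (1 - x) * (\<Sum>i<n. x ^ i)) \<longlonglongrightarrow> (1 - x) * ?S"
    by (intro tendsto_intros summable_LIMSEQ s)
  moreover have "(\<lambda>n. (1 - x) * (\<Sum>i<n. x ^ i)) \<longlonglongrightarrow> 1 - 0"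
    unfolding eq1 by (intro tendsto_intros lim)
  ultimately show "(1 - x) * ?S = 1"
    using LIMSEQ_unique by force
  have "(\<lambda>n. (\<Sum>i<n. x ^ i) * (1 - x)) \<longlonglongrightarrow> ?S * (1 - x)"
    by (intro tendsto_intros summable_LIMSEQ s)
  moreover have "(\<lambda>n. (\<Sum>i<n. x ^ i) * (1 - x)) \<longlonglongrightarrow> 1 - 0"
    unfolding eq2 by (intro tendsto_intros lim)
  ultimately show "?S * (1 - x) = 1"
    using LIMSEQ_unique by force
qed

lemma invertible_ofc_mult:
  fixes x :: "'a::cstar"
  assumes "u \<noteq> 0"
  shows "invertible_elt (ofc u * x) \<longleftrightarrow> invertible_elt x"
proof -
  have inv: "invertible_elt (ofc u :: 'a)" if "u \<noteq> 0" for u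
    using that by (intro invertible_eltI[where y = "ofc (inverse u)"]) (auto simp flip: ofc_mult)
  have "ofc (inverse u) * (ofc u * x) = x"
    using assms by (simp add: mult.assoc[symmetric] flip: ofc_mult)
  then show ?thesis
    using invertible_mult[OF inv[of u], of x] invertible_mult[OF inv[of "inverse u"], of "ofc u * x"] assms
    by auto
qed

subsection \<open>The spectrum\<close>

definition spec :: "'a::cstar \<Rightarrow> complex set" where
  "spec x = {z. \<not> invertible_elt (ofc z - x)}"

lemma spec_norm_le:
  assumes "z \<in> spec x"
  shows "cmod z \<le> norm x"
proof (rule ccontr)
  assume *: "\<not> cmod z \<le> norm x"
  then have z: "z \<noteq> 0" by auto
  have "norm (ofc (inverse z) * x) < 1"
    using * z by (simp add: norm_ofc_mult norm_divide divide_less_eq inverse_eq_divide)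
  then have "invertible_elt (ofc z * (1 - ofc (inverse z) * x))"
    using invertible_ofc_mult[OF z] invertible_1_minus by blast
  moreover have "ofc z * (1 - ofc (inverse z) * x) = ofc z - x"
    using z by (simp add: right_diff_distrib mult.assoc[symmetric] flip: ofc_mult)
  ultimately show False
    using assms by (simp add: spec_def)
qed

text \<open>Near a point \<open>z\<close> outside the spectrum, \<open>ofc w - x\<close> is
  \<open>ofc z - x\<close> times \<open>1 - ofc (z - w) * ?y\<close>, and the Neumann series applies
  within distance \<open>1 / norm ?y\<close>.\<close>

lemma closed_spec: "closed (spec x)"
proof -
  have "open (- spec x)"
    unfolding open_contains_ball
  proof
    fix z assume "z \<in> - spec x"
    then have inv: "invertible_elt (ofc z - x)" by (simp add: spec_def)
    let ?y = "minv (ofc z - x)"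
    have y: "?y \<noteq> 0"
      using minv(1)[OF inv] by auto
    have "ball z (1 / norm ?y) \<subseteq> - spec x"
    proof
      fix w assume "w \<in> ball z (1 / norm ?y)"
      then have "norm (ofc (z - w) * ?y) < 1"
        using y by (simp add: norm_ofc_mult dist_norm field_simps)
      then have "invertible_elt ((1 - ofc (z - w) * ?y) * (ofc z - x))"
        using inv invertible_mult invertible_1_minus by blast
      moreover have "(1 - ofc (z - w) * ?y) * (ofc z - x) = ofc w - x"
        using minv(2)[OF inv] by (simp add: left_diff_distrib mult.assoc ofc_diff)
      ultimately show "w \<in> - spec x"
        by (simp add: spec_def)
    qed
    then show "\<exists>e>0. ball z e \<subseteq> - spec x"
      using y by (intro exI[of _ "1 / norm ?y"]) auto
  qed
  then show ?thesis by (simp add: closed_def)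
qed

text \<open>
  If the resolvent existed on the whole unit circle, then averaging \<open>(1 - z b)\<inverse>\<close> over the roots
  of unity of order \<open>N = 2^k\<close> (two at a time) would give \<open>(1 - b^N)\<inverse> \<rightarrow> 1\<close>, against \<open>norm (b^N) = 1\<close>.
\<close>

lemma spectral_radius_attained_unit:
  fixes b :: "'a::cstar"
  assumes b: "\<And>k. norm (b ^ (2 ^ k)) = 1"
  shows "\<exists>z. cmod z = 1 \<and> \<not> invertible_elt (1 - ofc z * b)"
proof (rule ccontr)
  assume "\<not> ?thesis"
  then have inv1: "invertible_elt (1 - ofc z * b)" if "cmod z = 1" for z
    using that by blast
  have nb: "norm b = 1"
    using b[of 0] by simp
  have inv: "invertible_elt (1 - ofc z * b)" if "cmod z \<le> 1" for z
  proof (cases "cmod z = 1")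
    case False
    with that nb show ?thesis
      by (intro invertible_1_minus) (simp add: norm_ofc_mult)
  qed (rule inv1)
  define f where "f z = minv (1 - ofc z * b)" for z
  have f: "f z * (1 - ofc z * b) = 1" "(1 - ofc z * b) * f z = 1" if "cmod z \<le> 1" for z
    using minv[OF inv[OF that]] by (auto simp: f_def)
  have diff: "f z - f w = ofc (z - w) * (f z * b * f w)" if "cmod z \<le> 1" "cmod w \<le> 1" for z w
  proof -
    have "f z - f w = f z * ((1 - ofc w * b) * f w) - (f z * (1 - ofc z * b)) * f w"
      using f[OF that(1)] f[OF that(2)] by simp
    also have "\<dots> = f z * (ofc (z - w) * b) * f w"
      by (simp add: algebra_simps ofc_diff)
    finally show ?thesis
      by (simp add: ofc_left_commute mult.assoc)
  qed
  have cont: "continuous_on (cball 0 1) f"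
    unfolding continuous_on_iff
  proof (intro ballI allI impI)
    fix w :: complex and e :: real
    assume w: "w \<in> cball 0 1" and e: "0 < e"
    define M where "M = norm (f w)"
    have M: "M > 0"
      using f[of w] w by (auto simp: M_def)
    \<comment> \<open>The first bound makes \<open>cmod (z - w) * M\<close> at most 1/2, hence
      \<open>norm (f z) \<le> 2 * M\<close>; with that, the second one brings the resolvent identity
      below \<open>e / 2\<close>.\<close>
    define d where "d = min (1 / (2 * M)) (e / (4 * M\<^sup>2))"
    have d: "d > 0" using M e by (simp add: d_def)
    show "\<exists>d>0. \<forall>z\<in>cball 0 1. dist z w < d \<longrightarrow> dist (f z) (f w) < e"
    proof (intro exI[of _ d] conjI d ballI impI)
      fix z :: complex assume z: "z \<in> cball 0 1" and zw: "dist z w < d"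
      have "norm (f z * b * f w) \<le> norm (f z * b) * M"
        unfolding M_def by (rule norm_mult_ineq)
      also have "\<dots> \<le> norm (f z) * M"
        using norm_mult_ineq[of "f z" b] M nb by (intro mult_right_mono) auto
      finally have le: "norm (f z - f w) \<le> cmod (z - w) * (norm (f z) * M)"
        using diff[of z w] z w by (simp add: norm_ofc_mult mult_left_mono)
      have "cmod (z - w) * M \<le> 1/2"
        using zw M by (simp add: d_def dist_norm field_simps)
      then have "cmod (z - w) * M * norm (f z) \<le> 1/2 * norm (f z)"
        by (intro mult_right_mono) auto
      then have "norm (f z) \<le> 2 * M"
        using le norm_triangle_ineq2[of "f z" "f w"] by (simp add: M_def mult_ac)
      then have "cmod (z - w) * (norm (f z) * M) \<le> cmod (z - w) * (2 * M * M)"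
        using M by (intro mult_left_mono mult_right_mono) auto
      with le have "norm (f z - f w) \<le> cmod (z - w) * (2 * M * M)"
        by (rule order_trans)
      also have "\<dots> < e"
      proof -
        have "cmod (z - w) * (4 * M\<^sup>2) < e"
          using zw M by (simp add: d_def dist_norm field_simps)
        moreover have "0 \<le> cmod (z - w) * (2 * M * M)"
          using M by simp
        ultimately show ?thesis by (simp add: power2_eq_square algebra_simps)
      qed
      finally show "dist (f z) (f w) < e" by (simp add: dist_norm)
    qed
  qed
  have "uniformly_continuous_on (cball 0 1) f"
    by (rule compact_uniformly_continuous[OF cont]) simp
  then have "\<exists>d>0. \<forall>x\<in>cball 0 1. \<forall>y\<in>cball 0 1. dist y x < d \<longrightarrow> dist (f y) (f x) < 1/8"
    unfolding uniformly_continuous_on_def by (rule allE[of _ "1/8"]) simp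
  then obtain d where d: "d > 0"
    and fd: "\<And>z w. z \<in> cball 0 1 \<Longrightarrow> w \<in> cball 0 1 \<Longrightarrow> dist z w < d \<Longrightarrow> dist (f z) (f w) < 1/8"
    by blast
  define r :: real where "r = max (1/2) (1 - d/2)"
  have r: "0 < r" "r < 1" "1 - r < d"
    using d by (auto simp: r_def)
  define F where "F k z = minv (1 - ofc (z ^ (2 ^ k)) * b ^ (2 ^ k))" for k :: nat and z
  \<comment> \<open>With \<open>N = 2^k\<close>, \<open>F k z\<close> is the inverse of
    \<open>1 - z^N b^N\<close> and also the mean of \<open>f\<close> over the \<open>N\<close>
    rotations of \<open>z\<close>. A mean of differences is no larger than the largest of them, so
    1/8 serves for every \<open>k\<close>.\<close>
  have main: "(\<forall>z. cmod z \<le> 1 \<longrightarrow> invertible_elt (1 - ofc (z ^ (2 ^ k)) * b ^ (2 ^ k))) \<and>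
      (\<forall>z. cmod z = 1 \<longrightarrow> norm (F k (of_real r * z) - F k z) \<le> 1/8)" for k
  proof (induction k)
    case 0
    have "norm (f (of_real r * z) - f z) \<le> 1/8" if "cmod z = 1" for z
    proof -
      have "of_real r * z - z = of_real (r - 1) * z" by (simp add: algebra_simps)
      then have "dist (of_real r * z) z < d"
        using r that by (simp add: dist_norm norm_mult del: of_real_diff)
      then have "dist (f (of_real r * z)) (f z) < 1/8"
        using r that by (intro fd) (auto simp: norm_mult)
      then show ?thesis by (simp add: dist_norm)
    qed
    then show ?case
      using inv by (auto simp: F_def f_def)
  next
    case (Suc k)
    \<comment> \<open>A root of -1 of order \<open>2 ^ k\<close>: replacing \<open>z\<close> by
      \<open>z * \<zeta>\<close> turns \<open>?c z\<close> into its negative, and the inverse of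
      \<open>(1 - ?c z) * (1 + ?c z)\<close> is the mean of the inverses of the two factors.\<close>
    define \<zeta> where "\<zeta> = cis (pi / 2 ^ k)"
    have \<zeta>: "cmod \<zeta> = 1" "\<zeta> ^ (2 ^ k) = -1"
      by (simp_all add: \<zeta>_def Complex.DeMoivre)
    let ?c = "\<lambda>z. ofc (z ^ (2 ^ k)) * b ^ (2 ^ k)"
    have c\<zeta>: "?c (z * \<zeta>) = - ?c z" for z
      using \<zeta> by (simp add: power_mult_distrib ofc_minus)
    have csq: "ofc (z ^ (2 ^ Suc k)) * b ^ (2 ^ Suc k) = ?c z * ?c z" for z
    proof -
      have "?c z * ?c z = ofc (z ^ (2 ^ k)) * (ofc (z ^ (2 ^ k)) * (b ^ (2 ^ k) * b ^ (2 ^ k)))"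
        by (metis mult.assoc ofc_left_commute)
      then show ?thesis
        by (simp add: mult.assoc[symmetric] mult_2 flip: power_add ofc_mult)
    qed
    have invk: "invertible_elt (1 - ?c z)" "invertible_elt (1 + ?c z)" if "cmod z \<le> 1" for z
      using Suc.IH that c\<zeta>[of z] \<zeta> by (auto simp: norm_mult dest: spec[of _ "z * \<zeta>"])
    have sq: "1 - ?c z * ?c z = (1 - ?c z) * (1 + ?c z)" for z
      by (simp add: algebra_simps)
    have Fk: "F k (z * \<zeta>) = minv (1 + ?c z)" for z
      unfolding F_def c\<zeta> by simp
    have half: "F (Suc k) z = (1/2) *\<^sub>R (F k z + F k (z * \<zeta>))" if "cmod z \<le> 1" for z
    proof -
      let ?C = "?c z" and ?u = "F k z" and ?v = "F k (z * \<zeta>)"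
      have u: "(1 - ?C) * ?u = 1" "?u * (1 - ?C) = 1"
        using minv[OF invk(1)[OF that]] by (simp_all add: F_def)
      have v: "(1 + ?C) * ?v = 1" "?v * (1 + ?C) = 1"
        using minv[OF invk(2)[OF that]] by (simp_all add: Fk)
      have com: "(1 - ?C) * (1 + ?C) = (1 + ?C) * (1 - ?C)"
        by (simp add: algebra_simps)
      have e1: "(1 - ?C) * (1 + ?C) * ?u = 1 + ?C"
        unfolding com using u by (simp add: mult.assoc)
      have e2: "(1 - ?C) * (1 + ?C) * ?v = 1 - ?C"
        using v by (simp add: mult.assoc)
      have e3: "?u * ((1 - ?C) * (1 + ?C)) = 1 + ?C"
        using u by (simp add: mult.assoc[symmetric])
      have e4: "?v * ((1 - ?C) * (1 + ?C)) = 1 - ?C"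
        unfolding com using v by (simp add: mult.assoc[symmetric])
      have two: "(1/2) *\<^sub>R ((1 + ?C) + (1 - ?C)) = (1::'a)"
        by (simp add: scaleR_2[symmetric] del: scaleR_2)
      have "(1 - ?C) * (1 + ?C) * ((1/2) *\<^sub>R (?u + ?v)) = 1"
        using two e1 e2 by (simp add: distrib_left)
      moreover have "((1/2) *\<^sub>R (?u + ?v)) * ((1 - ?C) * (1 + ?C)) = 1"
        using two e3 e4 by (simp add: distrib_right)
      ultimately show ?thesis
        unfolding F_def[of "Suc k"] csq sq by (rule minv_unique)
    qed
    show ?case
    proof (intro conjI allI impI)
      fix z :: complex assume "cmod z \<le> 1"
      then show "invertible_elt (1 - ofc (z ^ (2 ^ Suc k)) * b ^ (2 ^ Suc k))"
        unfolding csq sq by (intro invertible_mult invk)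
    next
      fix z :: complex assume z: "cmod z = 1"
      have 1: "norm (F k (of_real r * z) - F k z) \<le> 1/8"
        using Suc.IH z by blast
      have 2: "norm (F k (of_real r * (z * \<zeta>)) - F k (z * \<zeta>)) \<le> 1/8"
        using Suc.IH z \<zeta> by (simp add: norm_mult)
      have "F (Suc k) (of_real r * z) - F (Suc k) z =
          (1/2) *\<^sub>R ((F k (of_real r * z) - F k z) + (F k (of_real r * (z * \<zeta>)) - F k (z * \<zeta>)))"
        using z r by (simp add: half norm_mult algebra_simps)
      also have "norm \<dots> \<le> (1/2) * (1/8 + 1/8)"
        using norm_triangle_mono[OF 1 2] by simp
      finally show "norm (F (Suc k) (of_real r * z) - F (Suc k) z) \<le> 1/8" by simp
    qed
  qed
  have "(\<lambda>k::nat. r ^ k) \<longlonglongrightarrow> 0"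
    using r by (intro LIMSEQ_realpow_zero) auto
  then have "\<forall>\<^sub>F k in sequentially. r ^ k < 1/16"
    by (rule order_tendstoD) simp
  then obtain K where K: "\<And>k. k \<ge> K \<Longrightarrow> r ^ k < 1/16"
    unfolding eventually_sequentially by blast
  have "K \<le> 2 ^ K" by (simp add: less_imp_le)
  then have rK: "r ^ (2 ^ K) < 1/16" by (rule K)
  \<comment> \<open>At radius \<open>r\<close> the power is so small that its resolvent
    \<open>u\<close> is within 1/8 of 1; moving out to the circle costs another 1/8.\<close>
  define c where "c = ofc (of_real r ^ (2 ^ K)) * b ^ (2 ^ K)"
  have nc: "norm c < 1/16"
    using rK r b[of K] by (simp add: c_def norm_ofc_mult norm_power)
  have invc: "(1 - c) * F K (of_real r) = 1"
    using minv[OF invertible_1_minus[of c]] nc by (simp add: F_def c_def)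
  define u where "u = F K (of_real r)"
  have "u - 1 = c * u" using invc by (simp add: u_def algebra_simps)
  then have "norm (u - 1) \<le> norm c * norm u"
    by (metis norm_mult_ineq)
  also have "\<dots> \<le> (1/16) * norm u"
    using nc by (intro mult_right_mono) auto
  finally have u1: "norm (u - 1) \<le> (1/16) * norm u" .
  have "norm u \<le> norm (u - 1) + 1"
    using norm_triangle_ineq[of "u - 1" 1] by simp
  with u1 have u2: "norm (u - 1) \<le> 1/8" by linarith
  define y where "y = F K 1"
  have "norm (u - y) \<le> 1/8"
    using main[of K] by (auto simp: u_def y_def dest: spec[of _ 1])
  then have y1: "norm (y - 1) \<le> 1/4"
    using u2 norm_triangle_ineq[of "y - u" "u - 1"] by (simp add: norm_minus_commute)
  have "(1 - b ^ (2 ^ K)) * y = 1"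
    using minv[of "1 - b ^ (2 ^ K)"] main[of K] by (auto simp: y_def F_def dest: spec[of _ 1])
  \<comment> \<open>The right-hand side has norm at most twice 1/4, the left-hand side has norm
    1.\<close>
  then have "b ^ (2 ^ K) = (y - 1) - b ^ (2 ^ K) * (y - 1)"
    by (simp add: algebra_simps)
  then have "1 \<le> norm (y - 1) + norm (b ^ (2 ^ K)) * norm (y - 1)"
    using b[of K] norm_triangle_ineq4[of "y - 1" "b ^ (2 ^ K) * (y - 1)"] norm_mult_ineq[of "b ^ (2 ^ K)" "y - 1"]
    by simp
  then show False
    using y1 b[of K] by simp
qed

subsection \<open>Self-adjoint elements\<close>

text \<open>Squaring a self-adjoint element squares its norm by the C*-identity. Exponents that are
  powers of two are all that the averaging argument asks for.\<close>

lemma norm_selfadjoint_power: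
  assumes "adj (h::'a::cstar) = h"
  shows "norm (h ^ (2 ^ k)) = norm h ^ (2 ^ k)"
proof (induction k)
  case (Suc k)
  have "norm (h ^ (2 ^ k) * h ^ (2 ^ k)) = (norm (h ^ (2 ^ k)))\<^sup>2"
    using norm_adj_mult[of "h ^ (2 ^ k)"] assms by (simp add: adj_power)
  then show ?case
    using Suc by (simp add: power_mult[symmetric] power2_eq_square mult_2 flip: power_add)
qed simp

text \<open>Scaling \<open>h\<close> to norm one makes all the powers \<open>b ^ (2 ^ k)\<close>
  have norm one, so the averaging argument yields a spectral value of full modulus. In particular
  the spectrum is nonempty.\<close>

lemma spec_selfadjoint_attained:
  assumes "adj (h::'a::cstar) = h"
  shows "\<exists>z\<in>spec h. cmod z = norm h"
proof (cases "h = 0")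
  case True
  then show ?thesis
    by (intro bexI[of _ 0]) (auto simp: spec_def invertible_elt_def)
next
  case False
  define b where "b = (1 / norm h) *\<^sub>R h"
  have "norm (b ^ (2 ^ k)) = 1" for k
    using False norm_selfadjoint_power[OF assms, of k]
    by (simp add: b_def power_one_over scaleR_power)
  then obtain z where z: "cmod z = 1" "\<not> invertible_elt (1 - ofc z * b)"
    using spectral_radius_attained_unit[of b] by blast
  define w where "w = complex_of_real (norm h) / z"
  have w: "w \<noteq> 0" "cmod w = norm h" using z False by (auto simp: w_def norm_divide)
  have "ofc z * b = ofc (inverse w) * h"
  proof -
    have "b = ofc (complex_of_real (1 / norm h)) * h"
      by (simp only: b_def ofc_of_real scaleR_conv_of_real)
    moreover have "z * complex_of_real (1 / norm h) = inverse w"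
      using False by (simp add: w_def)
    ultimately show ?thesis
      by (metis mult.assoc ofc_mult)
  qed
  then have "ofc w * (1 - ofc z * b) = ofc w - h"
    using ofc_mult_inverse[OF w(1), where ?'a = 'a] by (simp add: right_diff_distrib mult.assoc[symmetric])
  then show ?thesis
    using z(2) w invertible_ofc_mult[OF w(1), of "1 - ofc z * b"] by (intro bexI[of _ w]) (auto simp: spec_def)
qed

text \<open>Shifting by an imaginary scalar: \<open>z + \<i> * n\<close> is in the spectrum of
  \<open>h + \<i> * n\<close>, whose squared norm is at most
  \<open>(norm h)\<^sup>2 + n\<^sup>2\<close>, while the squared modulus gains the cross term
  \<open>2 * Im z * n\<close>. The choice of \<open>n\<close> makes this term exceed
  \<open>(norm h)\<^sup>2\<close>.\<close>

lemma spec_selfadjoint_real: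
  assumes "adj (h::'a::cstar) = h" "z \<in> spec h"
  shows "Im z = 0"
proof (rule ccontr)
  assume "Im z \<noteq> 0"
  define n where "n = ((norm h)\<^sup>2 + 1) / (2 * Im z)"
  have n: "2 * Im z * n = (norm h)\<^sup>2 + 1"
    using \<open>Im z \<noteq> 0\<close> by (simp add: n_def)
  let ?k = "h + ofc (\<i> * of_real n)"
  have "z + \<i> * of_real n \<in> spec ?k"
    using assms by (simp add: spec_def ofc_add)
  then have "(cmod (z + \<i> * of_real n))\<^sup>2 \<le> (norm ?k)\<^sup>2"
    by (intro power_mono spec_norm_le) auto
  also have "(norm ?k)\<^sup>2 = norm (adj ?k * ?k)"
    by (simp only: norm_adj_mult)
  also have "adj ?k * ?k = h * h + of_real (n\<^sup>2)"
  proof -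
    have "adj ?k = h - ofc (\<i> * of_real n)"
      by (simp add: adj_add adj_ofc assms ofc_minus)
    moreover have "(h - c) * (h + c) = h * h - c * c" if "c * h = h * c" for c
      using that by (simp add: algebra_simps)
    ultimately have "adj ?k * ?k = h * h - ofc ((\<i> * of_real n) * (\<i> * of_real n))"
      using ofc_commute[of "\<i> * of_real n" h] ofc_mult[of "\<i> * of_real n" "\<i> * of_real n", where ?'a = 'a]
      by presburger
    also have "(\<i> * of_real n) * (\<i> * of_real n) = complex_of_real (- (n\<^sup>2))"
      by (simp add: complex_eq_iff power2_eq_square)
    finally show ?thesis by (simp only: ofc_of_real) simp
  qed
  also have "norm (h * h + of_real (n\<^sup>2)) \<le> (norm h)\<^sup>2 + n\<^sup>2"
    using norm_triangle_ineq[of "h * h" "of_real (n\<^sup>2)"] norm_mult_ineq[of h h]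
    by (simp add: power2_eq_square norm_of_real abs_mult del: of_real_mult)
  finally have "(Re z)\<^sup>2 + (Im z + n)\<^sup>2 \<le> (norm h)\<^sup>2 + n\<^sup>2"
    by (simp add: cmod_power2)
  then have "(Im z)\<^sup>2 + 2 * Im z * n \<le> (norm h)\<^sup>2"
    by (simp add: power2_sum) (smt (verit) zero_le_power2)
  with n show False
    by (smt (verit) zero_le_power2)
qed

definition rspec :: "'a::cstar \<Rightarrow> real set" where
  "rspec h = {t. complex_of_real t \<in> spec h}"

lemma rspec_abs_le: "t \<in> rspec h \<Longrightarrow> \<bar>t\<bar> \<le> norm h"
  using spec_norm_le[of "complex_of_real t" h] by (simp add: rspec_def)

lemma compact_rspec: "compact (rspec h)"
proof -
  have "closed (complex_of_real -` spec h)"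
    by (intro closed_vimage closed_spec continuous_intros)
  moreover have "bounded (rspec h)"
    using rspec_abs_le[of _ h] by (auto simp: bounded_real)
  ultimately show ?thesis
    by (simp add: compact_eq_bounded_closed rspec_def vimage_def)
qed

lemma spec_eq_of_real_rspec:
  assumes "adj h = h" "z \<in> spec h"
  obtains t where "t \<in> rspec h" "z = complex_of_real t"
proof (rule that)
  show "z = complex_of_real (Re z)"
    using spec_selfadjoint_real[OF assms] by (simp add: complex_eq_iff)
  with assms(2) show "Re z \<in> rspec h"
    by (simp add: rspec_def)
qed

lemma rspec_attained:
  assumes "adj h = h"
  obtains t where "t \<in> rspec h" "\<bar>t\<bar> = norm h"
  by (metis assms norm_of_real spec_eq_of_real_rspec spec_selfadjoint_attained)

lemma rspec_alt: "t \<in> rspec h \<longleftrightarrow> \<not> invertible_elt (of_real t - h)"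
  by (simp add: rspec_def spec_def ofc_of_real)

subsection \<open>Functional calculus\<close>

text \<open>Evaluation of a polynomial at \<open>h\<close> by Horner's scheme. Complex coefficients
  are needed to split into linear factors; the functional calculus itself runs on the real version
  \<open>rpe\<close>.\<close>

definition cpe :: "'a::cstar \<Rightarrow> complex poly \<Rightarrow> 'a" where
  "cpe h p = fold_coeffs (\<lambda>a y. ofc a + h * y) p 0"

lemma cpe_0 [simp]: "cpe h 0 = 0"
  by (simp add: cpe_def)

lemma cpe_pCons [simp]: "cpe h (pCons a p) = ofc a + h * cpe h p"
  by (cases "a = 0 \<and> p = 0") (auto simp: cpe_def)

lemma cpe_add: "cpe h (p + q) = cpe h p + cpe h q"
proof (induction p arbitrary: q)
  case (pCons a p)
  then show ?case
    by (cases q) (auto simp: ofc_add distrib_left)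
qed simp

lemma cpe_smult: "cpe h (smult c p) = ofc c * cpe h p"
  by (induction p) (auto simp: ofc_mult distrib_left ofc_left_commute)

lemma cpe_mult: "cpe h (p * q) = cpe h p * cpe h q"
  by (induction p) (auto simp: cpe_add cpe_smult distrib_right mult.assoc)

lemma cpe_diff: "cpe h (p - q) = cpe h p - cpe h q"
  using cpe_add[of h "p - q" q] by simp

text \<open>A root \<open>z\<close> of \<open>P\<close> is not a spectral value, so the linear
  factor \<open>h - ofc z\<close> is invertible; splitting it off lowers the degree.\<close>

lemma invertible_cpe:
  fixes h :: "'a::cstar"
  assumes "P \<noteq> 0" "\<And>s. s \<in> spec h \<Longrightarrow> poly P s \<noteq> 0"
  shows "invertible_elt (cpe h P)"
  using assms
proof (induction "degree P" arbitrary: P)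
  case 0
  then have "degree P = 0"
    by simp
  then obtain c where P: "P = [:c:]"
    by (rule degree_eq_zeroE)
  then have "c \<noteq> 0"
    using 0 by auto
  then show ?case
    using ofc_mult_inverse[of c, where ?'a = 'a] ofc_commute[of "inverse c" "ofc c :: 'a"]
    unfolding P by (intro invertible_eltI[of _ "ofc (inverse c)"]) simp_all
next
  case (Suc n)
  then obtain z where z: "poly P z = 0"
    using fundamental_theorem_of_algebra[of P] by (auto simp: constant_degree)
  then obtain Q where Q: "P = [:- z, 1:] * Q"
    by (auto simp: poly_eq_0_iff_dvd)
  have "Q \<noteq> 0" using Q Suc.prems by auto
  then have "degree P = Suc (degree Q)"
    unfolding Q by (subst degree_mult_eq) auto
  then have "invertible_elt (cpe h Q)"
    using Suc Q \<open>Q \<noteq> 0\<close> by (intro Suc.hyps) auto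
  moreover have "invertible_elt (h - ofc z)"
  proof -
    have "z \<notin> spec h" using z Suc.prems by blast
    then have "invertible_elt (ofc (- 1) * (ofc z - h))"
      by (subst invertible_ofc_mult) (auto simp: spec_def)
    then show ?thesis by (simp add: ofc_minus)
  qed
  moreover have "cpe h P = (h - ofc z) * cpe h Q"
    unfolding Q cpe_mult by (simp add: ofc_minus)
  ultimately show ?case
    by (simp add: invertible_mult)
qed

text \<open>If \<open>p\<close> never takes the value \<open>t\<close> on the spectrum, then
  \<open>t - p\<close> has no zero there and is invertible at \<open>h\<close>. Nonemptiness of the
  spectrum rules out that \<open>p\<close> is the constant \<open>t\<close>.\<close>

lemma spec_cpe:
  assumes "t \<in> spec (cpe h p)" "spec h \<noteq> {}"
  shows "\<exists>s\<in>spec h. poly p s = t"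
proof (rule ccontr)
  assume *: "\<not> ?thesis"
  have "cpe h ([:t:] - p) = ofc t - cpe h p"
    by (simp add: cpe_diff)
  moreover have "invertible_elt (cpe h ([:t:] - p))"
  proof (rule invertible_cpe)
    show "[:t:] - p \<noteq> 0"
      using * assms(2) by (metis all_not_in_conv diff_0_right diff_eq_eq eq_iff_diff_eq_0 poly_const_conv)
  qed (use * in auto)
  ultimately show False
    using assms by (simp add: spec_def)
qed

text \<open>The polynomial \<open>poly p s - p\<close> is divisible by the linear factor at
  \<open>s\<close>, on either side since polynomials in \<open>h\<close> commute. An inverse of the
  product therefore gives \<open>h - ofc s\<close> a right and a left inverse.\<close>

lemma poly_spec_cpe:
  assumes "s \<in> spec h"
  shows "poly p s \<in> spec (cpe h p)"
proof (rule ccontr)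
  assume "poly p s \<notin> spec (cpe h p)"
  then have inv: "invertible_elt (ofc (poly p s) - cpe h p)"
    by (simp add: spec_def)
  have "poly ([:poly p s:] - p) s = 0" by simp
  then obtain Q where Q: "[:poly p s:] - p = [:- s, 1:] * Q"
    using poly_eq_0_iff_dvd by blast
  have "cpe h ([:poly p s:] - p) = ofc (poly p s) - cpe h p"
    by (simp add: cpe_diff)
  then have eq: "ofc (poly p s) - cpe h p = (h - ofc s) * cpe h Q" "ofc (poly p s) - cpe h p = cpe h Q * (h - ofc s)"
    using cpe_mult[of h "[:- s, 1:]" Q] cpe_mult[of h Q "[:- s, 1:]"] unfolding Q
    by (auto simp: ofc_minus mult.commute[of Q])
  obtain y where y: "((h - ofc s) * cpe h Q) * y = 1" "y * (cpe h Q * (h - ofc s)) = 1"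
    using inv eq unfolding invertible_elt_def by metis
  have "invertible_elt (h - ofc s)"
    by (rule invertible_left_right[of _ "cpe h Q * y" "y * cpe h Q"]) (use y in \<open>auto simp: mult.assoc\<close>)
  then have "invertible_elt (ofc (- 1) * (h - ofc s))"
    by (subst invertible_ofc_mult) auto
  then show False
    using assms by (simp add: ofc_minus spec_def)
qed

section \<open>Real polynomials of a self-adjoint element and their norms\<close>

definition rpe :: "'a::cstar \<Rightarrow> real poly \<Rightarrow> 'a" where
  "rpe h p = cpe h (map_poly complex_of_real p)"

lemma rpe_0 [simp]: "rpe h 0 = 0"
  by (simp add: rpe_def)

lemma rpe_pCons [simp]: "rpe h (pCons a p) = of_real a + h * rpe h p"
  by (simp add: rpe_def map_poly_pCons ofc_of_real)

lemma rpe_add: "rpe h (p + q) = rpe h p + rpe h q"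
proof (induction p arbitrary: q)
  case (pCons a p)
  then show ?case
    by (cases q) (auto simp: distrib_left)
qed simp

lemma rpe_smult: "rpe h (smult c p) = of_real c * rpe h p"
  by (induction p) (auto simp: distrib_left scaleR_conv_of_real[symmetric])

lemma rpe_mult: "rpe h (p * q) = rpe h p * rpe h q"
  by (induction p) (auto simp: rpe_add rpe_smult distrib_right mult.assoc)

lemma rpe_diff: "rpe h (p - q) = rpe h p - rpe h q"
  using rpe_add[of h "p - q" q] by simp

lemma rpe_commute: "rpe h p * h = h * rpe h p"
  by (induction p) (auto simp: algebra_simps scaleR_conv_of_real[symmetric] of_real_def)

lemma adj_rpe: "adj h = h \<Longrightarrow> adj (rpe h p) = rpe h p"
  by (induction p) (auto simp: adj_add adj_mult rpe_commute)

lemma poly_map_of_real: "poly (map_poly complex_of_real p) (of_real s) = of_real (poly p s)"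
  by (induction p) (auto simp: map_poly_pCons)

text \<open>The norm of the self-adjoint element \<open>rpe h p\<close> is the modulus of one of its
  spectral values, and by spectral mapping that value is \<open>p\<close> at a point of
  \<open>rspec h\<close>.\<close>

lemma norm_rpe_le:
  assumes h: "adj h = h" and le: "\<And>s. s \<in> rspec h \<Longrightarrow> \<bar>poly p s\<bar> \<le> e"
  shows "norm (rpe h p) \<le> e"
proof -
  obtain t where t: "t \<in> spec (rpe h p)" "cmod t = norm (rpe h p)"
    using spec_selfadjoint_attained[OF adj_rpe[OF h]] by blast
  have "spec h \<noteq> {}"
    using spec_selfadjoint_attained[OF h] by blast
  then obtain s where s: "s \<in> spec h" "poly (map_poly complex_of_real p) s = t"
    using spec_cpe t(1) unfolding rpe_def by blast
  then show ?thesis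
    using le spec_eq_of_real_rspec[OF h s(1)] t(2) by (metis norm_of_real poly_map_of_real)
qed

lemma abs_poly_le_norm_rpe:
  assumes "s \<in> rspec h"
  shows "\<bar>poly p s\<bar> \<le> norm (rpe h p)"
  using spec_norm_le[OF poly_spec_cpe[of "complex_of_real s" h "map_poly complex_of_real p"]] assms
  by (simp add: rspec_def rpe_def poly_map_of_real)

section \<open>Continuous functions of a self-adjoint element, by polynomial approximation\<close>

lemma Weierstrass_uniform_limit:
  fixes f :: "real \<Rightarrow> real"
  assumes "compact S" "continuous_on S f"
  obtains P where "uniform_limit S (\<lambda>n. poly (P n)) f sequentially"
proof -
  have "\<exists>p. \<forall>x\<in>S. \<bar>f x - poly p x\<bar> < 1 / Suc n" for n
  proof -
    obtain g where g: "real_polynomial_function g" "\<And>x. x \<in> S \<Longrightarrow> \<bar>f x - g x\<bar> < 1 / Suc n"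
      using Stone_Weierstrass_real_polynomial_function[OF assms, of "1 / Suc n"] by auto
    then obtain a k where "g = (\<lambda>x. \<Sum>i\<le>k. a i * x ^ i)"
      using real_polynomial_function_iff_sum by auto
    then have "g = poly (\<Sum>i\<le>k. monom (a i) i)"
      by (auto simp: poly_sum poly_monom)
    with g show ?thesis by blast
  qed
  then obtain P where P: "\<And>n x. x \<in> S \<Longrightarrow> \<bar>f x - poly (P n) x\<bar> < 1 / Suc n"
    by metis
  have "uniform_limit S (\<lambda>n. poly (P n)) f sequentially"
  proof (rule uniform_limitI)
    fix e :: real assume "0 < e"
    then obtain N where N: "inverse (Suc N) < e"
      using reals_Archimedean by blast
    show "\<forall>\<^sub>F n in sequentially. \<forall>x\<in>S. dist (poly (P n) x) (f x) < e"
      unfolding eventually_sequentially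
    proof (intro exI[of _ N] allI impI ballI)
      fix n x assume "N \<le> n" "x \<in> S"
      then have "inverse (Suc n) \<le> inverse (Suc N)" by (intro le_imp_inverse_le) auto
      with P[OF \<open>x \<in> S\<close>, of n] N show "dist (poly (P n) x) (f x) < e"
        by (simp add: dist_real_def abs_minus_commute inverse_eq_divide)
    qed
  qed
  then show ?thesis by (rule that)
qed

text \<open>For self-adjoint \<open>h\<close> and \<open>f\<close> continuous on
  \<open>rspec h\<close> the limit exists and is the same for every approximating sequence, because
  \<open>norm_rpe_le\<close> bounds differences by values on the spectrum. Only these values of
  \<open>f\<close> enter.\<close>

definition cfc :: "'a::cstar \<Rightarrow> (real \<Rightarrow> real) \<Rightarrow> 'a" where
  "cfc h f = (THE l. \<exists>P. uniform_limit (rspec h) (\<lambda>n. poly (P n)) f sequentially \<and>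
                       (\<lambda>n. rpe h (P n)) \<longlonglongrightarrow> l)"

context
  fixes h :: "'a::cstar"
  assumes h: "adj h = h"
begin

lemma rpe_difference_tendsto_0:
  assumes "uniform_limit (rspec h) (\<lambda>n. poly (P n)) f sequentially"
      and "uniform_limit (rspec h) (\<lambda>n. poly (Q n)) f sequentially"
    shows "(\<lambda>n. rpe h (P n) - rpe h (Q n)) \<longlonglongrightarrow> 0"
proof (rule LIMSEQ_I)
  fix e :: real assume e: "0 < e"
  have "\<forall>\<^sub>F n in sequentially. (\<forall>x\<in>rspec h. dist (poly (P n) x) (f x) < e / 4) \<and>
      (\<forall>x\<in>rspec h. dist (poly (Q n) x) (f x) < e / 4)"
    using uniform_limitD[OF assms(1), of "e/4"] uniform_limitD[OF assms(2), of "e/4"] e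
    by (intro eventually_conj) auto
  then obtain N where N: "\<And>n x. n \<ge> N \<Longrightarrow> x \<in> rspec h \<Longrightarrow> dist (poly (P n) x) (f x) < e / 4"
     "\<And>n x. n \<ge> N \<Longrightarrow> x \<in> rspec h \<Longrightarrow> dist (poly (Q n) x) (f x) < e / 4"
    by (auto simp: eventually_sequentially)
  have "norm (rpe h (P n - Q n)) \<le> e / 2" if "n \<ge> N" for n
  proof (rule norm_rpe_le[OF h])
    fix s assume "s \<in> rspec h"
    then show "\<bar>poly (P n - Q n) s\<bar> \<le> e / 2"
      using N(1)[OF that, of s] N(2)[OF that, of s] dist_triangle2[of "poly (P n) s" "poly (Q n) s" "f s"]
      by (simp add: dist_real_def)
  qed
  then show "\<exists>no. \<forall>n\<ge>no. norm (rpe h (P n) - rpe h (Q n) - 0) < e"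
    using e by (intro exI[of _ N]) (force simp: rpe_diff)
qed

lemma convergent_rpe:
  assumes "uniform_limit (rspec h) (\<lambda>n. poly (P n)) f sequentially"
  shows "convergent (\<lambda>n. rpe h (P n))"
proof (rule Cauchy_convergent, rule CauchyI)
  fix e :: real assume e: "0 < e"
  then obtain N where N: "\<And>n x. n \<ge> N \<Longrightarrow> x \<in> rspec h \<Longrightarrow> dist (poly (P n) x) (f x) < e / 4"
    using uniform_limitD[OF assms(1), of "e/4"] by (auto simp: eventually_sequentially)
  have "norm (rpe h (P m - P n)) \<le> e / 2" if "m \<ge> N" "n \<ge> N" for m n
  proof (rule norm_rpe_le[OF h])
    fix s assume "s \<in> rspec h"
    then show "\<bar>poly (P m - P n) s\<bar> \<le> e / 2"
      using N[OF that(1), of s] N[OF that(2), of s] dist_triangle2[of "poly (P m) s" "poly (P n) s" "f s"]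
      by (simp add: dist_real_def)
  qed
  then show "\<exists>M. \<forall>m\<ge>M. \<forall>n\<ge>M. norm (rpe h (P m) - rpe h (P n)) < e"
    using e by (intro exI[of _ N]) (force simp: rpe_diff)
qed

lemma cfc_tendsto:
  assumes P: "uniform_limit (rspec h) (\<lambda>n. poly (P n)) f sequentially"
  shows "(\<lambda>n. rpe h (P n)) \<longlonglongrightarrow> cfc h f"
proof -
  obtain l where l: "(\<lambda>n. rpe h (P n)) \<longlonglongrightarrow> l"
    using convergent_rpe[OF P] by (auto simp: convergent_def)
  have "cfc h f = l"
    unfolding cfc_def
  proof (rule the_equality)
    fix l' assume "\<exists>P. uniform_limit (rspec h) (\<lambda>n. poly (P n)) f sequentially \<and> (\<lambda>n. rpe h (P n)) \<longlonglongrightarrow> l'"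
    then obtain Q where Q: "uniform_limit (rspec h) (\<lambda>n. poly (Q n)) f sequentially" "(\<lambda>n. rpe h (Q n)) \<longlonglongrightarrow> l'"
      by blast
    have "(\<lambda>n. rpe h (Q n) - rpe h (P n)) \<longlonglongrightarrow> l' - l"
      by (intro tendsto_intros l Q)
    from LIMSEQ_unique[OF this rpe_difference_tendsto_0[OF Q(1) P]] show "l' = l"
      by simp
  qed (use P l in blast)
  with l show ?thesis by simp
qed

lemma cfc_approx:
  assumes "continuous_on (rspec h) f"
  obtains P where "uniform_limit (rspec h) (\<lambda>n. poly (P n)) f sequentially"
    "(\<lambda>n. rpe h (P n)) \<longlonglongrightarrow> cfc h f"
proof -
  obtain P where "uniform_limit (rspec h) (\<lambda>n. poly (P n)) f sequentially"
    using Weierstrass_uniform_limit[OF compact_rspec assms] .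
  with that cfc_tendsto[OF this] show ?thesis by blast
qed

lemma cfc_add:
  assumes f: "continuous_on (rspec h) f" and g: "continuous_on (rspec h) g"
  shows "cfc h (\<lambda>t. f t + g t) = cfc h f + cfc h g"
proof -
  obtain P where P: "uniform_limit (rspec h) (\<lambda>n. poly (P n)) f sequentially" "(\<lambda>n. rpe h (P n)) \<longlonglongrightarrow> cfc h f"
    by (rule cfc_approx[OF f])
  obtain Q where Q: "uniform_limit (rspec h) (\<lambda>n. poly (Q n)) g sequentially" "(\<lambda>n. rpe h (Q n)) \<longlonglongrightarrow> cfc h g"
    by (rule cfc_approx[OF g])
  have "uniform_limit (rspec h) (\<lambda>n. poly (P n + Q n)) (\<lambda>t. f t + g t) sequentially"
    using uniform_limit_add[OF P(1) Q(1)] by (simp add: poly_add[abs_def])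
  from cfc_tendsto[OF this] have "(\<lambda>n. rpe h (P n) + rpe h (Q n)) \<longlonglongrightarrow> cfc h (\<lambda>t. f t + g t)"
    by (simp add: rpe_add)
  from LIMSEQ_unique[OF this tendsto_add[OF P(2) Q(2)]] show ?thesis .
qed

lemma cfc_mult:
  assumes f: "continuous_on (rspec h) f" and g: "continuous_on (rspec h) g"
  shows "cfc h (\<lambda>t. f t * g t) = cfc h f * cfc h g"
proof -
  obtain P where P: "uniform_limit (rspec h) (\<lambda>n. poly (P n)) f sequentially" "(\<lambda>n. rpe h (P n)) \<longlonglongrightarrow> cfc h f"
    by (rule cfc_approx[OF f])
  obtain Q where Q: "uniform_limit (rspec h) (\<lambda>n. poly (Q n)) g sequentially" "(\<lambda>n. rpe h (Q n)) \<longlonglongrightarrow> cfc h g"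
    by (rule cfc_approx[OF g])
  have "bounded (f ` rspec h)" "bounded (g ` rspec h)"
    by (intro compact_imp_bounded compact_continuous_image compact_rspec f g)+
  then have "uniform_limit (rspec h) (\<lambda>n. poly (P n * Q n)) (\<lambda>t. f t * g t) sequentially"
    using uniform_lim_mult[OF P(1) Q(1)] by (simp add: poly_mult[abs_def])
  from cfc_tendsto[OF this] have "(\<lambda>n. rpe h (P n) * rpe h (Q n)) \<longlonglongrightarrow> cfc h (\<lambda>t. f t * g t)"
    by (simp add: rpe_mult)
  from LIMSEQ_unique[OF this tendsto_mult[OF P(2) Q(2)]] show ?thesis .
qed

lemma cfc_poly: "cfc h (poly p) = rpe h p"
proof -
  have "uniform_limit (rspec h) (\<lambda>n. poly p) (poly p) sequentially"
    by (intro uniform_limit_const)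
  from cfc_tendsto[OF this] show ?thesis
    by (simp add: LIMSEQ_const_iff)
qed

lemma cfc_cong:
  assumes "\<And>t. t \<in> rspec h \<Longrightarrow> f t = g t"
  shows "cfc h f = cfc h g"
proof -
  have "uniform_limit (rspec h) P f sequentially \<longleftrightarrow> uniform_limit (rspec h) P g sequentially" for P :: "nat \<Rightarrow> real \<Rightarrow> real"
    using assms by (intro uniform_limit_cong') auto
  then show ?thesis
    by (simp add: cfc_def)
qed

lemma cfc_const: "cfc h (\<lambda>_. c) = of_real c"
  using cfc_poly[of "[:c:]"] cfc_cong[of "poly [:c:]" "\<lambda>_. c"] by simp

lemma cfc_id: "cfc h (\<lambda>t. t) = h"
  using cfc_poly[of "[:0, 1:]"] cfc_cong[of "poly [:0, 1:]" "\<lambda>t. t"] by simp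

lemma cfc_cmult:
  assumes f: "continuous_on (rspec h) f"
  shows "cfc h (\<lambda>t. c * f t) = c *\<^sub>R cfc h f"
  using cfc_mult[OF _ f, of "\<lambda>_. c"] by (simp add: cfc_const scaleR_conv_of_real)

lemma cfc_diff:
  assumes f: "continuous_on (rspec h) f" and g: "continuous_on (rspec h) g"
  shows "cfc h (\<lambda>t. f t - g t) = cfc h f - cfc h g"
proof -
  have "continuous_on (rspec h) (\<lambda>t. f t - g t)"
    by (intro continuous_intros f g)
  from cfc_add[OF this g] show ?thesis by simp
qed

lemma adj_cfc:
  assumes f: "continuous_on (rspec h) f"
  shows "adj (cfc h f) = cfc h f"
proof -
  obtain P where P: "(\<lambda>n. rpe h (P n)) \<longlonglongrightarrow> cfc h f"
    by (rule cfc_approx[OF f])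
  show ?thesis
    using LIMSEQ_unique[OF tendsto_adj[OF P]] P by (simp add: adj_rpe h)
qed

lemma norm_cfc_le:
  assumes f: "continuous_on (rspec h) f" and le: "\<And>t. t \<in> rspec h \<Longrightarrow> \<bar>f t\<bar> \<le> e"
  shows "norm (cfc h f) \<le> e"
proof (rule field_le_epsilon)
  fix d :: real assume d: "0 < d"
  obtain P where P: "uniform_limit (rspec h) (\<lambda>n. poly (P n)) f sequentially" "(\<lambda>n. rpe h (P n)) \<longlonglongrightarrow> cfc h f"
    by (rule cfc_approx[OF f])
  have "\<forall>\<^sub>F n in sequentially. norm (rpe h (P n)) \<le> e + d"
    using uniform_limitD[OF P(1) d]
  proof eventually_elim
    case (elim n)
    show ?case
    proof (rule norm_rpe_le[OF h])
      fix s assume "s \<in> rspec h"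
      then show "\<bar>poly (P n) s\<bar> \<le> e + d"
        using elim le[of s] by (force simp: dist_real_def)
    qed
  qed
  then show "norm (cfc h f) \<le> e + d"
    by (intro tendsto_upperbound[OF tendsto_norm[OF P(2)]]) auto
qed

lemma abs_le_norm_cfc:
  assumes f: "continuous_on (rspec h) f" and s: "s \<in> rspec h"
  shows "\<bar>f s\<bar> \<le> norm (cfc h f)"
proof -
  obtain P where P: "uniform_limit (rspec h) (\<lambda>n. poly (P n)) f sequentially" "(\<lambda>n. rpe h (P n)) \<longlonglongrightarrow> cfc h f"
    by (rule cfc_approx[OF f])
  have "(\<lambda>n. poly (P n) s) \<longlonglongrightarrow> f s"
    by (rule tendsto_uniform_limitI[OF P(1) s])
  then show ?thesis
    by (intro LIMSEQ_le[OF tendsto_rabs tendsto_norm[OF P(2)]]) (auto intro: abs_poly_le_norm_rpe[OF s])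
qed

lemma cfc_zero:
  assumes "continuous_on (rspec h) f" "\<And>t. t \<in> rspec h \<Longrightarrow> f t = 0"
  shows "cfc h f = 0"
  using norm_cfc_le[OF assms(1), of 0] assms(2) by simp

lemma cfc_nonzero:
  assumes "continuous_on (rspec h) f" "t \<in> rspec h" "f t \<noteq> 0"
  shows "cfc h f \<noteq> 0"
  using abs_le_norm_cfc[OF assms(1,2)] assms(3) by auto

end

subsection \<open>Positive elements\<close>

definition cpos :: "'a::cstar \<Rightarrow> bool" where
  "cpos x \<longleftrightarrow> adj x = x \<and> (\<forall>t\<in>rspec x. 0 \<le> t)"

lemma cpos_adj: "cpos x \<Longrightarrow> adj x = x"
  by (simp add: cpos_def)

lemma cfc_of_real_minus: "adj x = x \<Longrightarrow> cfc x (\<lambda>t. r - t) = of_real r - x"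
  by (subst cfc_diff) (auto simp: cfc_const cfc_id intro: continuous_intros)

text \<open>Together with \<open>cposI_norm\<close>, a criterion for positivity by norms: a
  self-adjoint \<open>x\<close> with \<open>norm x \<le> r\<close> is positive iff
  \<open>norm (of_real r - x) \<le> r\<close>. The triangle inequality then gives closure under
  sums, which spectra do not show.\<close>

lemma cpos_norm_diff_le:
  assumes "cpos x" "norm x \<le> r"
  shows "norm (of_real r - x) \<le> r"
proof -
  have "norm (cfc x (\<lambda>t. r - t)) \<le> r"
  proof (rule norm_cfc_le)
    fix t assume t: "t \<in> rspec x"
    then show "\<bar>r - t\<bar> \<le> r"
      using assms rspec_abs_le[OF t] by (force simp: cpos_def)
  qed (use assms in \<open>auto simp: cpos_def intro: continuous_intros\<close>)
  then show ?thesis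
    using assms by (simp add: cfc_of_real_minus cpos_def)
qed

lemma cposI_norm:
  assumes "adj x = x" "norm (of_real r - x) \<le> r"
  shows "cpos x"
  unfolding cpos_def
proof (intro conjI ballI)
  fix t assume t: "t \<in> rspec x"
  have "\<bar>r - t\<bar> \<le> norm (cfc x (\<lambda>t. r - t))"
    by (rule abs_le_norm_cfc) (use assms t in \<open>auto intro: continuous_intros\<close>)
  then show "0 \<le> t"
    using assms by (simp add: cfc_of_real_minus)
qed (rule assms)

lemma cpos_add:
  assumes "cpos x" "cpos y"
  shows "cpos (x + y)"
proof (rule cposI_norm)
  have "norm ((of_real (norm x) - x) + (of_real (norm y) - y)) \<le> norm x + norm y"
    using assms by (intro norm_triangle_mono cpos_norm_diff_le) auto
  then show "norm (of_real (norm x + norm y) - (x + y)) \<le> norm x + norm y"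
    by (simp add: algebra_simps)
qed (use assms in \<open>simp add: cpos_def adj_add\<close>)

lemma cpos_scaleR:
  assumes "cpos x" "0 \<le> c"
  shows "cpos (c *\<^sub>R x)"
proof (rule cposI_norm)
  have "norm (c *\<^sub>R (of_real (norm x) - x)) \<le> c * norm x"
    using assms cpos_norm_diff_le[OF assms(1) order_refl] by (simp add: mult_left_mono)
  then show "norm (of_real (c * norm x) - c *\<^sub>R x) \<le> c * norm x"
    by (simp add: scaleR_conv_of_real right_diff_distrib)
qed (use assms in \<open>simp add: cpos_def adj_scaleR\<close>)

lemma cpos_of_real [simp]: "0 \<le> r \<Longrightarrow> cpos (of_real r)"
  by (rule cposI_norm[of _ r]) auto

lemma cpos_0 [simp]: "cpos 0" and cpos_1 [simp]: "cpos 1"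
  using cpos_of_real[of 0] cpos_of_real[of 1] by auto

lemma cpos_sum: "(\<And>i. i \<in> S \<Longrightarrow> cpos (f i)) \<Longrightarrow> cpos (sum f S)"
  by (induction S rule: infinite_finite_induct) (auto intro: cpos_add)

lemma cpos_cfc:
  assumes h: "adj h = h" and f: "continuous_on (rspec h) f" "\<And>t. t \<in> rspec h \<Longrightarrow> 0 \<le> f t"
  shows "cpos (cfc h f)"
proof (rule cposI_norm)
  let ?r = "norm (cfc h f)"
  have "norm (cfc h (\<lambda>t. ?r - f t)) \<le> ?r"
  proof (rule norm_cfc_le[OF h])
    fix t assume "t \<in> rspec h"
    then show "\<bar>?r - f t\<bar> \<le> ?r"
      using abs_le_norm_cfc[OF h f(1)] f(2) by force
  qed (intro continuous_intros f)
  then show "norm (of_real ?r - cfc h f) \<le> ?r"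
    by (simp add: cfc_diff[OF h] f cfc_const[OF h])
qed (rule adj_cfc[OF h f(1)])

text \<open>At a spectral value \<open>t\<close> with \<open>\<bar>t\<bar> = norm x\<close>,
  positivity of \<open>- x\<close> gives \<open>norm x + t \<le> norm x\<close>, so \<open>t\<close>
  is both nonnegative and nonpositive.\<close>

lemma cpos_antisym:
  assumes "cpos x" "cpos (- x)"
  shows "x = 0"
proof -
  have x: "adj x = x" using assms by (simp add: cpos_def)
  obtain t where t: "t \<in> rspec x" "\<bar>t\<bar> = norm x"
    using rspec_attained[OF x] .
  have "\<bar>norm x + t\<bar> \<le> norm (cfc x (\<lambda>t. norm x + t))"
    by (rule abs_le_norm_cfc[OF x]) (use t in \<open>auto intro: continuous_intros\<close>)
  also have "\<dots> = norm (of_real (norm x) - (- x))"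
    by (subst cfc_add[OF x]) (auto simp: cfc_const[OF x] cfc_id[OF x] intro: continuous_intros)
  also have "\<dots> \<le> norm x"
    using cpos_norm_diff_le[OF assms(2)] by simp
  finally have "t \<le> 0" by simp
  moreover have "0 \<le> t"
    using assms t by (auto simp: cpos_def)
  ultimately show ?thesis using t by simp
qed

lemma cpos_square:
  assumes "adj h = h"
  shows "cpos (h * h)"
proof -
  have "cfc h (\<lambda>t. t * t) = h * h"
    using cfc_mult[OF assms, of "\<lambda>t. t" "\<lambda>t. t"] by (simp add: cfc_id[OF assms] continuous_on_id)
  moreover have "cpos (cfc h (\<lambda>t. t * t))"
    by (intro cpos_cfc assms continuous_intros) auto
  ultimately show ?thesis by simp
qed

text \<open>If \<open>w\<close> inverts \<open>t - y * x\<close>, then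
  \<open>(1 + x * w * y) / t\<close> inverts \<open>t - x * y\<close>.\<close>

lemma rspec_mult_commute:
  assumes "t \<in> rspec (x * y)" "t \<noteq> 0"
  shows "t \<in> rspec (y * x)"
proof (rule ccontr)
  assume "t \<notin> rspec (y * x)"
  then have inv: "invertible_elt (of_real t - y * x)"
    by (simp add: rspec_alt)
  define w where "w = minv (of_real t - y * x)"
  have w: "t *\<^sub>R w - y * x * w = 1" "t *\<^sub>R w - w * y * x = 1"
    using minv[OF inv, folded w_def] by (simp_all add: algebra_simps of_real_def)
  have w': "y * (x * w) = t *\<^sub>R w - 1" "w * (y * x) = t *\<^sub>R w - 1"
    using w by (auto simp: algebra_simps)
  have "(of_real t - x * y) * (1 + x * w * y) = of_real t + t *\<^sub>R (x * w * y) - x * y - x * (y * (x * w)) * y"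
    by (simp add: algebra_simps of_real_def)
  also have "\<dots> = of_real t"
    unfolding w' by (simp add: algebra_simps)
  finally have 1: "(of_real t - x * y) * (1 + x * w * y) = of_real t" .
  have "(1 + x * w * y) * (of_real t - x * y) = of_real t + t *\<^sub>R (x * w * y) - x * y - x * (w * (y * x)) * y"
    by (simp add: algebra_simps of_real_def)
  also have "\<dots> = of_real t"
    unfolding w' by (simp add: algebra_simps)
  finally have 2: "(1 + x * w * y) * (of_real t - x * y) = of_real t" .
  have "invertible_elt (of_real t - x * y)"
    by (rule invertible_eltI[of _ "(1/t) *\<^sub>R (1 + x * w * y)"]) (use 1 2 assms in \<open>auto simp: of_real_def\<close>)
  then show False
    using assms by (simp add: rspec_alt)
qed

text \<open>Let \<open>v\<close> be the negative part of \<open>adj x * x\<close> and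
  \<open>z = x * v\<close>; then \<open>adj z * z\<close> is negative. Twice the sum
  \<open>adj z * z + z * adj z\<close> is a sum of two squares of self-adjoint elements, so
  \<open>z * adj z\<close> is positive. The two products share their nonzero spectrum, hence
  \<open>adj z * z\<close> is positive as well, thus 0, and a negative spectral value of
  \<open>adj x * x\<close> would contradict this.\<close>

lemma cpos_adj_mult: "cpos (adj x * x)"
proof -
  let ?h = "adj x * x"
  let ?n = "\<lambda>t::real. max 0 (- t)"
  have h: "adj ?h = ?h" by (simp add: adj_mult)
  have n: "continuous_on S ?n" for S by (intro continuous_intros)
  define v where "v = cfc ?h ?n"
  have v: "adj v = v"
    unfolding v_def by (rule adj_cfc[OF h n])
  define z where "z = x * v"
  have "cfc ?h (\<lambda>t. ?n t * t * ?n t) = v * ?h * v"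
    unfolding v_def using n
    by (simp add: cfc_mult[OF h] cfc_id[OF h] continuous_on_mult continuous_on_id)
  then have zz: "adj z * z = cfc ?h (\<lambda>t. ?n t * t * ?n t)"
    by (simp add: z_def adj_mult v mult.assoc)
  have "cpos (cfc ?h (\<lambda>t. - 1 * (?n t * t * ?n t)))"
  proof (rule cpos_cfc[OF h])
    show "0 \<le> - 1 * (?n t * t * ?n t)" for t
      by (cases "t \<le> 0") (simp_all add: max_def mult_le_0_iff zero_le_mult_iff)
  qed (intro continuous_intros)
  moreover have "cfc ?h (\<lambda>t. - 1 * (?n t * t * ?n t)) = - 1 *\<^sub>R (adj z * z)"
    unfolding zz by (rule cfc_cmult[OF h]) (intro continuous_intros)
  ultimately have neg: "cpos (- (adj z * z))" by simp
  let ?p = "z + adj z" and ?q = "ofc \<i> * (adj z - z)"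
  have i2: "ofc \<i> * ofc \<i> = (- 1 :: 'a)"
    by (simp add: ofc_minus flip: ofc_mult)
  have sq: "(ofc \<i> * w) * (ofc \<i> * w) = - (w * w)" for w :: 'a
  proof -
    have "(ofc \<i> * w) * (ofc \<i> * w) = ofc \<i> * (w * (ofc \<i> * w))"
      by (simp only: mult.assoc)
    also have "\<dots> = (ofc \<i> * ofc \<i>) * (w * w)"
      by (simp only: ofc_left_commute[of w] mult.assoc)
    finally show ?thesis by (simp add: i2)
  qed
  have q: "?q * ?q = - ((adj z - z) * (adj z - z))"
    by (rule sq)
  have "adj (ofc \<i> * w) = - (ofc \<i> * adj w)" for w :: 'a
    by (simp add: adj_mult adj_ofc ofc_minus ofc_commute[of \<i> "adj w"])
  then have "adj ?q = ?q"
    by (simp add: adj_diff right_diff_distrib)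
  then have "cpos (?p * ?p + ?q * ?q)"
    by (intro cpos_add cpos_square) (auto simp: adj_add add.commute)
  also have "?p * ?p + ?q * ?q = 2 *\<^sub>R (adj z * z + z * adj z)"
    unfolding q by (simp add: algebra_simps scaleR_2)
  finally have "cpos (2 *\<^sub>R (adj z * z + z * adj z))" .
  from cpos_scaleR[OF this, of "1/2"] have "cpos (adj z * z + z * adj z)"
    by simp
  from cpos_add[OF this neg] have zz': "cpos (z * adj z)"
    by simp
  have "0 \<le> t" if "t \<in> rspec (adj z * z)" for t
    using rspec_mult_commute[OF that] zz' by (cases "t = 0") (auto simp: cpos_def)
  then have "cpos (adj z * z)"
    by (simp add: cpos_def adj_mult)
  then have z0: "cfc ?h (\<lambda>t. ?n t * t * ?n t) = 0"
    using cpos_antisym[OF _ neg] zz by simp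
  show ?thesis
    unfolding cpos_def
  proof (intro conjI ballI h)
    fix t assume t: "t \<in> rspec ?h"
    show "0 \<le> t"
    proof (rule ccontr)
      assume "\<not> 0 \<le> t"
      then have "cfc ?h (\<lambda>t. ?n t * t * ?n t) \<noteq> 0"
        by (intro cfc_nonzero[OF h _ t]) (auto intro!: continuous_intros)
      then show False using z0 by simp
    qed
  qed
qed

lemma cpos_mult_adj: "cpos (x * adj x)"
  using cpos_adj_mult[of "adj x"] by simp

section \<open>Square roots of positive elements and conjugation\<close>

definition psqrt :: "'a::cstar \<Rightarrow> 'a" where
  "psqrt x = cfc x sqrt"

lemma cpos_psqrt: "cpos x \<Longrightarrow> cpos (psqrt x)"
  unfolding psqrt_def by (intro cpos_cfc continuous_intros) (auto simp: cpos_def)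

lemma psqrt_mult:
  assumes "cpos x"
  shows "psqrt x * psqrt x = x"
proof -
  have "psqrt x * psqrt x = cfc x (\<lambda>t. sqrt t * sqrt t)"
    unfolding psqrt_def using assms by (subst cfc_mult) (auto simp: cpos_def intro!: continuous_intros)
  also have "\<dots> = cfc x (\<lambda>t. t)"
    using assms by (intro cfc_cong) (auto simp: cpos_def)
  finally show ?thesis
    using assms by (simp add: cfc_id cpos_def)
qed

lemma adj_psqrt: "cpos x \<Longrightarrow> adj (psqrt x) = psqrt x"
  using cpos_psqrt cpos_adj by blast

lemma cpos_conj:
  assumes "cpos a"
  shows "cpos (adj z * a * z)" "cpos (z * a * adj z)"
proof -
  have eq: "adj w * a * w = adj (psqrt a * w) * (psqrt a * w)" for w
    using psqrt_mult[OF assms] by (metis adj_mult adj_psqrt assms mult.assoc)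
  then show "cpos (adj z * a * z)"
    by (simp add: cpos_adj_mult)
  show "cpos (z * a * adj z)"
    using eq[of "adj z"] cpos_adj_mult by (metis adj_adj)
qed

lemma cpos_sandwich: "cpos a \<Longrightarrow> adj z = z \<Longrightarrow> cpos (z * a * z)"
  using cpos_conj(1)[of a z] by simp

subsection \<open>The order\<close>

definition cle :: "'a::cstar \<Rightarrow> 'a \<Rightarrow> bool"  (infix \<open>\<preceq>\<close> 50) where
  "x \<preceq> y \<longleftrightarrow> cpos (y - x)"

lemma cle_refl [simp]: "x \<preceq> x"
  by (simp add: cle_def)

lemma cle_trans [trans]: "x \<preceq> y \<Longrightarrow> y \<preceq> z \<Longrightarrow> x \<preceq> z"
  unfolding cle_def using cpos_add[of "y - x" "z - y"] by simp

lemma cle_eq_trans [trans]: "x \<preceq> y \<Longrightarrow> y = z \<Longrightarrow> x \<preceq> z" "x = y \<Longrightarrow> y \<preceq> z \<Longrightarrow> x \<preceq> z"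
  by auto

lemma cle_add_mono: "x \<preceq> y \<Longrightarrow> x' \<preceq> y' \<Longrightarrow> x + x' \<preceq> y + y'"
  unfolding cle_def using cpos_add[of "y - x" "y' - x'"] by (simp add: algebra_simps)

lemma cle_sum_mono: "(\<And>i. i \<in> S \<Longrightarrow> f i \<preceq> g i) \<Longrightarrow> sum f S \<preceq> sum g S"
  unfolding cle_def by (simp add: cpos_sum flip: sum_subtractf)

lemma cle_scaleR_mono: "x \<preceq> y \<Longrightarrow> 0 \<le> c \<Longrightarrow> c *\<^sub>R x \<preceq> c *\<^sub>R y"
  unfolding cle_def by (metis cpos_scaleR scaleR_diff_right)

lemma cle_conj_mono:
  assumes "x \<preceq> y"
  shows "adj z * x * z \<preceq> adj z * y * z" "z * x * adj z \<preceq> z * y * adj z"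
  using cpos_conj[of "y - x" z] assms by (auto simp: cle_def algebra_simps)

lemma cpos_trans: "cpos x \<Longrightarrow> x \<preceq> y \<Longrightarrow> cpos y"
  using cpos_add[of x "y - x"] by (simp add: cle_def)

lemma cle_of_real_norm:
  assumes "adj x = x" "norm x \<le> r"
  shows "x \<preceq> of_real r"
proof -
  have "cpos (cfc x (\<lambda>t. r - t))"
    using assms rspec_abs_le[of _ x] by (intro cpos_cfc continuous_intros) force+
  then show ?thesis
    using assms by (simp add: cfc_of_real_minus cle_def)
qed

lemma rspec_shift: "t \<in> rspec x \<Longrightarrow> t - r \<in> rspec (x - of_real r)"
  by (simp add: rspec_alt algebra_simps)

text \<open>Positivity of \<open>of_real r - x\<close> concerns the spectrum of another element. It
  is brought back to a point \<open>t\<close> of \<open>rspec x\<close> through the norm criterion: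
  with \<open>s\<close> the norm of that element, \<open>\<bar>s - (r - t)\<bar> \<le> s\<close>, so
  \<open>r - t\<close> is nonnegative.\<close>

lemma rspec_le:
  assumes "x \<preceq> of_real r" "t \<in> rspec x" "adj x = x"
  shows "t \<le> r"
proof -
  have "cpos (cfc x (\<lambda>t. r - t))"
    using assms by (simp add: cle_def cfc_of_real_minus)
  then have "norm (of_real s - cfc x (\<lambda>t. r - t)) \<le> s" if "norm (cfc x (\<lambda>t. r - t)) \<le> s" for s
    using that by (rule cpos_norm_diff_le)
  then have "norm (cfc x (\<lambda>t. s - (r - t))) \<le> s" if "norm (cfc x (\<lambda>t. r - t)) \<le> s" for s
    using that assms by (subst cfc_diff) (auto simp: cfc_const intro!: continuous_intros)
  then have "norm (cfc x (\<lambda>t. norm (cfc x (\<lambda>t. r - t)) - (r - t))) \<le> norm (cfc x (\<lambda>t. r - t))"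
    by simp
  moreover have "\<bar>norm (cfc x (\<lambda>t. r - t)) - (r - t)\<bar> \<le> norm (cfc x (\<lambda>t. norm (cfc x (\<lambda>t. r - t)) - (r - t)))"
    by (rule abs_le_norm_cfc) (use assms in \<open>auto intro!: continuous_intros\<close>)
  ultimately show ?thesis by linarith
qed

lemma rspec_ge:
  assumes "of_real r \<preceq> x" "t \<in> rspec x"
  shows "r \<le> t"
  using rspec_shift[OF assms(2), of r] assms(1) by (auto simp: cle_def cpos_def)

lemma norm_le_of_real:
  assumes "cpos x" "x \<preceq> of_real r"
  shows "norm x \<le> r"
  by (metis assms abs_of_nonneg cpos_def rspec_attained rspec_le)

lemma norm_mono:
  assumes "cpos x" "x \<preceq> y"
  shows "norm x \<le> norm y"
proof -
  have "cpos y" by (rule cpos_trans[OF assms])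
  then have "x \<preceq> of_real (norm y)"
    by (intro cle_trans[OF assms(2)] cle_of_real_norm) (auto simp: cpos_def)
  then show ?thesis by (rule norm_le_of_real[OF assms(1)])
qed

lemma square_cle:
  assumes "cpos g" "g \<preceq> 1"
  shows "g * g \<preceq> g"
proof -
  have g: "adj g = g" using assms by (simp add: cpos_def)
  have "cpos (cfc g (\<lambda>t. t - t * t))"
  proof (rule cpos_cfc[OF g])
    fix t assume t: "t \<in> rspec g"
    have "t \<le> 1" "0 \<le> t"
      using rspec_le[of g 1 t] assms t g by (auto simp: cpos_def)
    then show "0 \<le> t - t * t"
      by (simp add: mult_left_le)
  qed (intro continuous_intros)
  also have "cfc g (\<lambda>t. t - t * t) = g - g * g"
    by (subst cfc_diff[OF g]) (auto simp: cfc_mult[OF g] cfc_id[OF g] continuous_on_id intro!: continuous_intros)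
  finally show ?thesis by (simp add: cle_def)
qed

text \<open>The witness is \<open>x\<close> to the power -1/2. It normalizes an element bounded
  below: conjugates summing to \<open>x\<close> become conjugates summing to 1, and a factorization
  of \<open>x\<close> becomes an isometry.\<close>

lemma inverse_sqrt_ex:
  assumes "adj x = x" "of_real r \<preceq> x" "r > 0"
  obtains y where "adj y = y" "y * x * y = 1" "y * y * x = 1" "x * y * y = 1"
proof
  have pos: "t > 0" if "t \<in> rspec x" for t
    using rspec_ge[OF assms(2) that] assms(3) by simp
  let ?f = "\<lambda>t. 1 / sqrt t"
  define y where "y = cfc x ?f"
  have f: "continuous_on (rspec x) ?f"
    using pos by (intro continuous_intros) force
  have cid: "continuous_on (rspec x) (\<lambda>t. t)" by (rule continuous_on_id)
  have one: "cfc x g = 1" if "\<And>t. t > 0 \<Longrightarrow> g t = 1" for g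
    using cfc_const[OF assms(1), of 1] cfc_cong[OF assms(1), of g "\<lambda>_. 1"] that pos by simp
  show "adj y = y"
    unfolding y_def by (rule adj_cfc[OF assms(1) f])
  have yx: "y * x = cfc x (\<lambda>t. ?f t * t)"
    using cfc_mult[OF assms(1) f cid] by (simp add: y_def cfc_id[OF assms(1)])
  have xy: "x * y = cfc x (\<lambda>t. t * ?f t)"
    using cfc_mult[OF assms(1) cid f] by (simp add: y_def cfc_id[OF assms(1)])
  have yxy: "y * x * y = cfc x (\<lambda>t. ?f t * t * ?f t)"
    unfolding yx unfolding y_def by (rule cfc_mult[OF assms(1) continuous_on_mult[OF f cid] f, symmetric])
  then show "y * x * y = 1" by (simp add: one)
  have "x * y * y = cfc x (\<lambda>t. t * ?f t * ?f t)"
    unfolding xy unfolding y_def by (rule cfc_mult[OF assms(1) continuous_on_mult[OF cid f] f, symmetric])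
  then show "x * y * y = 1" by (simp add: one)
  have "y * (y * x) = cfc x (\<lambda>t. ?f t * (?f t * t))"
    unfolding yx unfolding y_def by (rule cfc_mult[OF assms(1) f continuous_on_mult[OF f cid], symmetric])
  then show "y * y * x = 1" by (simp add: one mult.assoc)
qed

section \<open>The product of all C*-algebras over a type\<close>

context unital_cstar_algebra
begin

lemma smult_closed [simp, intro]: "x \<in> carrier A \<Longrightarrow> c \<odot> x \<in> carrier A"
  using module.smult_closed[OF complex_module] by (simp add: complex_ring_def)

lemma smult_add_left: "x \<in> carrier A \<Longrightarrow> (c + d) \<odot> x = c \<odot> x \<oplus> d \<odot> x"
  using module.smult_l_distr[OF complex_module] by (simp add: complex_ring_def)

lemma smult_add_right:
  "x \<in> carrier A \<Longrightarrow> y \<in> carrier A \<Longrightarrow> c \<odot> (x \<oplus> y) = c \<odot> x \<oplus> c \<odot> y"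
  using module.smult_r_distr[OF complex_module] by (simp add: complex_ring_def)

lemma smult_smult: "x \<in> carrier A \<Longrightarrow> c \<odot> (d \<odot> x) = (c * d) \<odot> x"
  using module.smult_assoc1[OF complex_module] by (simp add: complex_ring_def)

lemma smult_1 [simp]: "x \<in> carrier A \<Longrightarrow> 1 \<odot> x = x"
  using module.smult_one[OF complex_module] by (simp add: complex_ring_def)

lemma smult_0_left [simp]: "x \<in> carrier A \<Longrightarrow> 0 \<odot> x = \<zero>"
  using module.smult_l_null[OF complex_module] by (simp add: complex_ring_def)

lemma smult_0_right [simp]: "c \<odot> \<zero> = \<zero>"
  using module.smult_r_null[OF complex_module] by (simp add: complex_ring_def)

lemma a_inv_eq_smult: "x \<in> carrier A \<Longrightarrow> \<ominus> x = (- 1) \<odot> x"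
  using smult_add_left[of x "- 1" 1] by (intro minus_equality) auto

lemma nrm_zero [simp]: "\<parallel>\<zero>\<parallel> = 0"
  using nrm_eq_0[of \<zero>] by simp

lemma nrm_minus [simp]: "x \<in> carrier A \<Longrightarrow> \<parallel>\<ominus> x\<parallel> = \<parallel>x\<parallel>"
  by (simp add: a_inv_eq_smult nrm_smult)

lemma nrm_ge_0 [simp]: "x \<in> carrier A \<Longrightarrow> 0 \<le> \<parallel>x\<parallel>"
  using nrm_triangle[of x "\<ominus> x"] by (simp add: r_neg)

lemma star_zero [simp]: "\<zero>\<^sup>\<star> = \<zero>"
  using star_smult[of \<zero> 0] star_closed[of \<zero>] by simp

lemma star_one [simp]: "\<one>\<^sup>\<star> = \<one>"
  by (metis l_one one_closed r_one star_closed star_mult star_star)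

lemma nrm_one_le: "\<parallel>\<one>\<parallel> \<le> 1"
proof -
  have "\<parallel>\<one>\<parallel> = \<parallel>\<one>\<parallel>\<^sup>2"
    using cstar_identity[of \<one>] by simp
  then show ?thesis by (auto simp: power2_eq_square)
qed

lemma nrm_smult_one_le: "\<parallel>c \<odot> \<one>\<parallel> \<le> cmod c"
  using nrm_one_le by (simp add: nrm_smult mult_left_le)

lemma nrm_star_le: "x \<in> carrier A \<Longrightarrow> \<parallel>x\<^sup>\<star>\<parallel> \<le> \<parallel>x\<parallel>"
proof -
  assume x: "x \<in> carrier A"
  let ?y = "x\<^sup>\<star>"
  have "\<parallel>?y\<parallel>\<^sup>2 \<le> \<parallel>x\<parallel> * \<parallel>?y\<parallel>"
    using cstar_identity[of ?y] nrm_mult[of x ?y] x star_closed[OF x] by (simp add: star_star)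
  moreover have "0 < \<parallel>?y\<parallel>" if "\<parallel>?y\<parallel> \<noteq> 0"
    using that nrm_ge_0[OF star_closed[OF x]] by linarith
  ultimately show ?thesis
    using x by (cases "\<parallel>?y\<parallel> = 0") (auto simp: power2_eq_square mult_le_cancel_right)
qed

lemma nrm_le_add_diff:
  assumes "x \<in> carrier A" "y \<in> carrier A"
  shows "\<parallel>y\<parallel> \<le> \<parallel>x\<parallel> + \<parallel>x \<ominus> y\<parallel>"
proof -
  have "y = x \<oplus> \<ominus> (x \<ominus> y)"
    using assms by (simp add: minus_eq minus_add r_neg1 a_assoc[symmetric] r_neg)
  then show ?thesis
    using nrm_triangle[of x "\<ominus> (x \<ominus> y)"] nrm_minus[of "x \<ominus> y"] assms by simp
qed

lemma norm_dist_eq: "x \<in> carrier A \<Longrightarrow> y \<in> carrier A \<Longrightarrow> norm_dist A x y = \<parallel>x \<ominus> y\<parallel>"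
  by (simp add: norm_dist_def)

lemma nrm_diff_commute:
  "x \<in> carrier A \<Longrightarrow> y \<in> carrier A \<Longrightarrow> \<parallel>x \<ominus> y\<parallel> = \<parallel>y \<ominus> x\<parallel>"
  using nrm_minus[of "x \<ominus> y"] by (simp add: minus_eq minus_add a_comm)

sublocale Metric_space "carrier A" "norm_dist A"
proof
  fix x y z assume xyz: "x \<in> carrier A" "y \<in> carrier A" "z \<in> carrier A"
  have "x \<ominus> z = (x \<ominus> y) \<oplus> (y \<ominus> z)"
    using xyz by (simp add: minus_eq a_assoc r_neg1 r_neg2)
  then show "norm_dist A x z \<le> norm_dist A x y + norm_dist A y z"
    using xyz nrm_triangle[of "x \<ominus> y" "y \<ominus> z"] by (simp add: norm_dist_eq)
  show "norm_dist A x y = 0 \<longleftrightarrow> x = y"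
    using xyz by (simp add: norm_dist_eq nrm_eq_0)
next
  show "0 \<le> norm_dist A x y" for x y by (simp add: norm_dist_def)
  show "norm_dist A x y = norm_dist A y x" for x y
    by (simp add: norm_dist_def nrm_diff_commute)
qed

end

text \<open>
  All unital C*-algebras with carrier in \<^typ>\<open>'a\<close>, the zero algebra included, form the bounded
  product; the extra factor \<open>\<complex>\<close> provides the norm-one unit demanded by the type class.
\<close>

typedef 'a cprod =
  "{(z :: complex, f :: 'a star_alg \<Rightarrow> 'a).
     (\<forall>A. if unital_cstar_algebra A then f A \<in> carrier A else f A = undefined) \<and>
     (\<exists>K. \<forall>A. unital_cstar_algebra A \<longrightarrow> nrm A (f A) \<le> K)}"
proof -
  have "(0, \<lambda>A. if unital_cstar_algebra A then \<zero>\<^bsub>A\<^esub> else undefined) \<in>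
    {(z :: complex, f :: 'a star_alg \<Rightarrow> 'a).
     (\<forall>A. if unital_cstar_algebra A then f A \<in> carrier A else f A = undefined) \<and>
     (\<exists>K. \<forall>A. unital_cstar_algebra A \<longrightarrow> nrm A (f A) \<le> K)}"
    by (auto intro!: exI[of _ 0] simp: unital_cstar_algebra.nrm_zero)
       (auto intro: ring.ring_simprules(2) unital_cstar_algebra.axioms)
  then show ?thesis by (rule exI)
qed

definition zpart :: "'a cprod \<Rightarrow> complex" where
  "zpart x = fst (Rep_cprod x)"

definition ev :: "'a star_alg \<Rightarrow> 'a cprod \<Rightarrow> 'a" where
  "ev A x = snd (Rep_cprod x) A"

definition build :: "complex \<Rightarrow> ('a star_alg \<Rightarrow> 'a) \<Rightarrow> 'a cprod" where
  "build z F = Abs_cprod (z, \<lambda>A. if unital_cstar_algebra A then F A else undefined)"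

lemma ev_closed [simp, intro]: "unital_cstar_algebra A \<Longrightarrow> ev A x \<in> carrier A"
  using Rep_cprod[of x] by (auto simp: ev_def split: if_splits dest!: spec[of _ A])

lemma ev_bounded: "\<exists>K. \<forall>A. unital_cstar_algebra A \<longrightarrow> nrm A (ev A x) \<le> K"
proof -
  have "\<exists>K. \<forall>A. unital_cstar_algebra A \<longrightarrow> nrm A (snd (Rep_cprod x) A) \<le> K"
    using Rep_cprod[of x] by (simp add: case_prod_unfold)
  then show ?thesis by (simp only: ev_def)
qed

lemma cprod_eqI:
  assumes "zpart x = zpart y" "\<And>A. unital_cstar_algebra A \<Longrightarrow> ev A x = ev A y"
  shows "x = y"
proof -
  have "snd (Rep_cprod x) A = snd (Rep_cprod y) A" for A
    using assms(2)[of A] Rep_cprod[of x] Rep_cprod[of y]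
    by (cases "unital_cstar_algebra A") (auto simp: ev_def split: if_splits dest!: spec[of _ A])
  then have "Rep_cprod x = Rep_cprod y"
    using assms(1) by (auto simp: zpart_def prod_eq_iff)
  then show ?thesis by (simp add: Rep_cprod_inject)
qed

lemma build:
  fixes F :: "'a star_alg \<Rightarrow> 'a"
  assumes "\<And>A. unital_cstar_algebra A \<Longrightarrow> F A \<in> carrier A"
    and "\<And>A. unital_cstar_algebra A \<Longrightarrow> nrm A (F A) \<le> K"
  shows "zpart (build z F) = z" "unital_cstar_algebra A \<Longrightarrow> ev A (build z F) = F A"
proof -
  have mem: "(z, \<lambda>A. if unital_cstar_algebra A then F A else undefined) \<in>
    {(z :: complex, f :: 'a star_alg \<Rightarrow> 'a).
     (\<forall>A. if unital_cstar_algebra A then f A \<in> carrier A else f A = undefined) \<and>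
     (\<exists>K. \<forall>A. unital_cstar_algebra A \<longrightarrow> nrm A (f A) \<le> K)}"
    using assms by auto
  show "zpart (build z F) = z" "unital_cstar_algebra A \<Longrightarrow> ev A (build z F) = F A"
    by (simp_all add: zpart_def ev_def build_def Abs_cprod_inverse[OF mem])
qed

instantiation cprod :: (type) ring_1
begin

definition "0 = build 0 (\<lambda>A. \<zero>\<^bsub>A\<^esub>)"
definition "1 = build 1 (\<lambda>A. \<one>\<^bsub>A\<^esub>)"
definition "x + y = build (zpart x + zpart y) (\<lambda>A. ev A x \<oplus>\<^bsub>A\<^esub> ev A y)"
definition "x - y = build (zpart x - zpart y) (\<lambda>A. ev A x \<ominus>\<^bsub>A\<^esub> ev A y)"
definition "- x = build (- zpart x) (\<lambda>A. \<ominus>\<^bsub>A\<^esub> ev A x)"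
definition "x * y = build (zpart x * zpart y) (\<lambda>A. ev A x \<otimes>\<^bsub>A\<^esub> ev A y)"

lemma cprod_0: "zpart 0 = 0" "unital_cstar_algebra A \<Longrightarrow> ev A 0 = \<zero>\<^bsub>A\<^esub>"
  unfolding zero_cprod_def
  by (subst build[where K = 0]; simp add: unital_cstar_algebra.nrm_zero ring.ring_simprules(2) unital_cstar_algebra.axioms)+

lemma cprod_1: "zpart 1 = 1" "unital_cstar_algebra A \<Longrightarrow> ev A 1 = \<one>\<^bsub>A\<^esub>"
  unfolding one_cprod_def
  by (subst build[where K = 1]; simp add: unital_cstar_algebra.nrm_one_le ring.ring_simprules(6) unital_cstar_algebra.axioms)+

lemma cprod_add: "zpart (x + y) = zpart x + zpart y"
    "unital_cstar_algebra A \<Longrightarrow> ev A (x + y) = ev A x \<oplus>\<^bsub>A\<^esub> ev A y"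
proof -
  obtain K L where KL: "\<And>A. unital_cstar_algebra A \<Longrightarrow> nrm A (ev A x) \<le> K" "\<And>A. unital_cstar_algebra A \<Longrightarrow> nrm A (ev A y) \<le> L"
    using ev_bounded[of x] ev_bounded[of y] by metis
  have 1: "ev A x \<oplus>\<^bsub>A\<^esub> ev A y \<in> carrier A" if "unital_cstar_algebra A" for A
    using that by (intro ring.ring_simprules(1) ev_closed) (auto intro: unital_cstar_algebra.axioms)
  have 2: "nrm A (ev A x \<oplus>\<^bsub>A\<^esub> ev A y) \<le> K + L" if "unital_cstar_algebra A" for A
    using that KL unital_cstar_algebra.nrm_triangle[OF that, of "ev A x" "ev A y"]
    by (smt (verit) ev_closed)
  show "zpart (x + y) = zpart x + zpart y"
    "unital_cstar_algebra A \<Longrightarrow> ev A (x + y) = ev A x \<oplus>\<^bsub>A\<^esub> ev A y"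
    unfolding plus_cprod_def using build[OF 1 2] by auto
qed

lemma cprod_uminus: "zpart (- x) = - zpart x"
    "unital_cstar_algebra A \<Longrightarrow> ev A (- x) = \<ominus>\<^bsub>A\<^esub> ev A x"
proof -
  obtain K where K: "\<And>A. unital_cstar_algebra A \<Longrightarrow> nrm A (ev A x) \<le> K"
    using ev_bounded[of x] by metis
  have 1: "\<ominus>\<^bsub>A\<^esub> ev A x \<in> carrier A" if "unital_cstar_algebra A" for A
    using that by (intro ring.ring_simprules(3) ev_closed) (auto intro: unital_cstar_algebra.axioms)
  have 2: "nrm A (\<ominus>\<^bsub>A\<^esub> ev A x) \<le> K" if "unital_cstar_algebra A" for A
    using that K by (simp add: unital_cstar_algebra.nrm_minus)
  show "zpart (- x) = - zpart x"
    "unital_cstar_algebra A \<Longrightarrow> ev A (- x) = \<ominus>\<^bsub>A\<^esub> ev A x"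
    unfolding uminus_cprod_def using build[OF 1 2] by auto
qed

lemma cprod_diff: "zpart (x - y) = zpart x - zpart y"
    "unital_cstar_algebra A \<Longrightarrow> ev A (x - y) = ev A x \<ominus>\<^bsub>A\<^esub> ev A y"
proof -
  obtain K where K: "\<And>A. unital_cstar_algebra A \<Longrightarrow> nrm A (ev A (x + - y)) \<le> K"
    using ev_bounded[of "x + - y"] by metis
  have eq: "ev A x \<ominus>\<^bsub>A\<^esub> ev A y = ev A (x + - y)" if "unital_cstar_algebra A" for A
    using that by (simp add: cprod_add cprod_uminus a_minus_def)
  have 1: "ev A x \<ominus>\<^bsub>A\<^esub> ev A y \<in> carrier A" "nrm A (ev A x \<ominus>\<^bsub>A\<^esub> ev A y) \<le> K"
    if "unital_cstar_algebra A" for A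
    using that K by (auto simp: eq)
  show "zpart (x - y) = zpart x - zpart y"
    "unital_cstar_algebra A \<Longrightarrow> ev A (x - y) = ev A x \<ominus>\<^bsub>A\<^esub> ev A y"
    unfolding minus_cprod_def using build[OF 1] by auto
qed

lemma cprod_mult: "zpart (x * y) = zpart x * zpart y"
    "unital_cstar_algebra A \<Longrightarrow> ev A (x * y) = ev A x \<otimes>\<^bsub>A\<^esub> ev A y"
proof -
  obtain K L where KL: "\<And>A. unital_cstar_algebra A \<Longrightarrow> nrm A (ev A x) \<le> K" "\<And>A. unital_cstar_algebra A \<Longrightarrow> nrm A (ev A y) \<le> L"
    using ev_bounded[of x] ev_bounded[of y] by metis
  have 1: "ev A x \<otimes>\<^bsub>A\<^esub> ev A y \<in> carrier A" if "unital_cstar_algebra A" for A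
    using that by (intro ring.ring_simprules(5) ev_closed) (auto intro: unital_cstar_algebra.axioms)
  have 2: "nrm A (ev A x \<otimes>\<^bsub>A\<^esub> ev A y) \<le> \<bar>K\<bar> * \<bar>L\<bar>" if A: "unital_cstar_algebra A" for A
  proof -
    have "nrm A (ev A x \<otimes>\<^bsub>A\<^esub> ev A y) \<le> nrm A (ev A x) * nrm A (ev A y)"
      using A by (intro unital_cstar_algebra.nrm_mult) auto
    also have "\<dots> \<le> \<bar>K\<bar> * \<bar>L\<bar>"
      using A KL[OF A] by (intro mult_mono) (auto simp: unital_cstar_algebra.nrm_ge_0)
    finally show ?thesis .
  qed
  show "zpart (x * y) = zpart x * zpart y"
    "unital_cstar_algebra A \<Longrightarrow> ev A (x * y) = ev A x \<otimes>\<^bsub>A\<^esub> ev A y"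
    unfolding times_cprod_def using build[OF 1 2] by auto
qed

instance
proof
  fix a b c :: "'a cprod"
  note rules = ring.ring_simprules[OF unital_cstar_algebra.axioms(1)] monoid.r_one[OF ring.is_monoid[OF unital_cstar_algebra.axioms(1)]]
  show "a + b + c = a + (b + c)" "a + b = b + a" "0 + a = a" "- a + a = 0" "a - b = a + - b"
    "a * b * c = a * (b * c)" "1 * a = a" "a * 1 = a" "(a + b) * c = a * c + b * c"
    "a * (b + c) = a * b + a * c"
    by (rule cprod_eqI; simp add: cprod_0 cprod_1 cprod_add cprod_uminus cprod_diff cprod_mult algebra_simps rules)+
  have "zpart 0 \<noteq> zpart (1 :: 'a cprod)"
    by (simp add: cprod_0 cprod_1)
  then show "(0 :: 'a cprod) \<noteq> 1" by metis
qed

end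

lemmas cprod_simps = cprod_0 cprod_1 cprod_add cprod_uminus cprod_diff cprod_mult

text \<open>The complex factor enters at every index and records that are not algebras contribute
  nothing more, so the supremum can run over the whole record type and is never over an empty
  set.\<close>

definition cprod_coord_norm :: "'a cprod \<Rightarrow> 'a star_alg \<Rightarrow> real" where
  "cprod_coord_norm x A = max (cmod (zpart x)) (if unital_cstar_algebra A then nrm A (ev A x) else 0)"

instantiation cprod :: (type) real_normed_algebra_1
begin

definition "r *\<^sub>R x = build (of_real r * zpart x) (\<lambda>A. of_real r \<odot>\<^bsub>A\<^esub> ev A x)"
definition "norm x = (SUP A. cprod_coord_norm x A)"
definition "dist x y = norm (x - y :: 'a cprod)"
definition "sgn x = inverse (norm x) *\<^sub>R (x :: 'a cprod)"
definition "(uniformity :: ('a cprod \<times> 'a cprod) filter) = (INF e\<in>{0<..}. principal {(x, y). dist x y < e})"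
definition "open (U :: 'a cprod set) \<longleftrightarrow> (\<forall>x\<in>U. eventually (\<lambda>(x', y). x' = x \<longrightarrow> y \<in> U) uniformity)"

lemma cprod_scaleR: "zpart (r *\<^sub>R x) = of_real r * zpart x"
    "unital_cstar_algebra A \<Longrightarrow> ev A (r *\<^sub>R x) = of_real r \<odot>\<^bsub>A\<^esub> ev A x"
proof -
  obtain K where K: "\<And>A. unital_cstar_algebra A \<Longrightarrow> nrm A (ev A x) \<le> K"
    using ev_bounded[of x] by metis
  have 1: "of_real r \<odot>\<^bsub>A\<^esub> ev A x \<in> carrier A" "nrm A (of_real r \<odot>\<^bsub>A\<^esub> ev A x) \<le> \<bar>r\<bar> * K"
    if "unital_cstar_algebra A" for A
    using that K by (auto simp: unital_cstar_algebra.smult_closed unital_cstar_algebra.nrm_smult intro: mult_left_mono)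
  show "zpart (r *\<^sub>R x) = of_real r * zpart x"
    "unital_cstar_algebra A \<Longrightarrow> ev A (r *\<^sub>R x) = of_real r \<odot>\<^bsub>A\<^esub> ev A x"
    unfolding scaleR_cprod_def using build[OF 1] by auto
qed

lemma norm_cprod_le_iff:
  "norm x \<le> K \<longleftrightarrow> cmod (zpart x) \<le> K \<and> (\<forall>A. unital_cstar_algebra A \<longrightarrow> nrm A (ev A x) \<le> K)"
proof -
  obtain L where L: "\<And>A. unital_cstar_algebra A \<Longrightarrow> nrm A (ev A x) \<le> L"
    using ev_bounded[of x] by metis
  have "bdd_above (range (cprod_coord_norm x))"
    using L by (intro bdd_aboveI[of _ "max (cmod (zpart x)) (max L 0)"]) (force simp: cprod_coord_norm_def)
  then have "norm x \<le> K \<longleftrightarrow> (\<forall>A. cprod_coord_norm x A \<le> K)"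
    unfolding norm_cprod_def by (subst cSUP_le_iff) auto
  also have "\<dots> \<longleftrightarrow> cmod (zpart x) \<le> K \<and> (\<forall>A. unital_cstar_algebra A \<longrightarrow> nrm A (ev A x) \<le> K)"
    by (auto simp: cprod_coord_norm_def intro: order_trans[OF norm_ge_zero])
  finally show ?thesis .
qed

lemma zpart_le_norm: "cmod (zpart x) \<le> norm x"
  and ev_le_norm: "unital_cstar_algebra A \<Longrightarrow> nrm A (ev A x) \<le> norm x"
  using norm_cprod_le_iff[of x "norm x"] by auto

lemma norm_cprod_ge_0: "0 \<le> norm (x :: 'a cprod)"
  using zpart_le_norm[of x] norm_ge_zero order_trans by blast

instance
proof
  fix a b :: real and x y z :: "'a cprod"
  note u = unital_cstar_algebra.smult_add_left unital_cstar_algebra.smult_add_right unital_cstar_algebra.smult_smult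
    unital_cstar_algebra.smult_1
  note um = unital_cstar_algebra.smult_mult_left unital_cstar_algebra.smult_mult_right
  show "a *\<^sub>R (x + y) = a *\<^sub>R x + a *\<^sub>R y" "(a + b) *\<^sub>R x = a *\<^sub>R x + b *\<^sub>R x"
    "a *\<^sub>R b *\<^sub>R x = (a * b) *\<^sub>R x" "1 *\<^sub>R x = x"
    "a *\<^sub>R x * y = a *\<^sub>R (x * y)" "x * a *\<^sub>R y = a *\<^sub>R (x * y)"
    by (rule cprod_eqI; simp add: cprod_simps cprod_scaleR algebra_simps u um)+
  show "dist x y = norm (x - y)" by (rule dist_cprod_def)
  show "sgn x = inverse (norm x) *\<^sub>R x" by (rule sgn_cprod_def)
  show "(uniformity :: ('a cprod \<times> 'a cprod) filter) = (INF e\<in>{0<..}. principal {(x, y). dist x y < e})"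
    by (rule uniformity_cprod_def)
  show "open U \<longleftrightarrow> (\<forall>x\<in>U. eventually (\<lambda>(x', y). x' = x \<longrightarrow> y \<in> U) uniformity)" for U :: "'a cprod set"
    by (rule open_cprod_def)
  show "norm x = 0 \<longleftrightarrow> x = 0"
  proof
    assume "norm x = 0"
    then have "zpart x = 0" "unital_cstar_algebra A \<Longrightarrow> nrm A (ev A x) = 0" for A
      using zpart_le_norm[of x] ev_le_norm[of A x] unital_cstar_algebra.nrm_ge_0[of A "ev A x"] by auto
    then show "x = 0"
      by (intro cprod_eqI) (simp_all add: cprod_0 unital_cstar_algebra.nrm_eq_0)
  next
    assume "x = 0"
    then have "norm x \<le> 0"
      by (subst norm_cprod_le_iff) (simp add: cprod_0 unital_cstar_algebra.nrm_zero)
    then show "norm x = 0" using norm_cprod_ge_0[of x] by simp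
  qed
  show "norm (x + y) \<le> norm x + norm y"
    unfolding norm_cprod_le_iff[of "x + y"]
  proof (intro conjI allI impI)
    show "cmod (zpart (x + y)) \<le> norm x + norm y"
      using zpart_le_norm[of x] zpart_le_norm[of y] norm_triangle_ineq[of "zpart x" "zpart y"] by (simp add: cprod_simps)
    fix A :: "'a star_alg" assume A: "unital_cstar_algebra A"
    show "nrm A (ev A (x + y)) \<le> norm x + norm y"
      using ev_le_norm[OF A, of x] ev_le_norm[OF A, of y] unital_cstar_algebra.nrm_triangle[OF A, of "ev A x" "ev A y"] A
      by (simp add: cprod_simps)
  qed
  have le: "norm (a *\<^sub>R x) \<le> \<bar>a\<bar> * norm x" for a and x :: "'a cprod"
    unfolding norm_cprod_le_iff[of "a *\<^sub>R x"]
    by (auto simp: cprod_scaleR norm_mult unital_cstar_algebra.nrm_smult intro!: mult_left_mono zpart_le_norm ev_le_norm)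
  show "norm (a *\<^sub>R x) = \<bar>a\<bar> * norm x"
  proof (cases "a = 0")
    case True
    then show ?thesis using le[of a x] norm_cprod_ge_0[of "a *\<^sub>R x"] by simp
  next
    case False
    have "(1 / a) *\<^sub>R a *\<^sub>R x = x"
      using False by (intro cprod_eqI) (simp_all add: cprod_scaleR unital_cstar_algebra.smult_smult unital_cstar_algebra.smult_1 flip: of_real_mult)
    then have "norm x \<le> \<bar>1 / a\<bar> * norm (a *\<^sub>R x)"
      using le[of "1 / a" "a *\<^sub>R x"] by simp
    then have "\<bar>a\<bar> * norm x \<le> norm (a *\<^sub>R x)"
      using False by (simp add: field_simps)
    then show ?thesis using le[of a x] by simp
  qed
  show "norm (x * y) \<le> norm x * norm y"
    unfolding norm_cprod_le_iff[of "x * y"]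
  proof (intro conjI allI impI)
    show "cmod (zpart (x * y)) \<le> norm x * norm y"
      using zpart_le_norm[of x] zpart_le_norm[of y] by (simp add: cprod_simps norm_mult mult_mono norm_cprod_ge_0)
    fix A :: "'a star_alg" assume A: "unital_cstar_algebra A"
    have "nrm A (ev A x \<otimes>\<^bsub>A\<^esub> ev A y) \<le> nrm A (ev A x) * nrm A (ev A y)"
      using A by (intro unital_cstar_algebra.nrm_mult) auto
    also have "\<dots> \<le> norm x * norm y"
      using A by (intro mult_mono ev_le_norm norm_cprod_ge_0) (auto simp: unital_cstar_algebra.nrm_ge_0)
    finally show "nrm A (ev A (x * y)) \<le> norm x * norm y"
      using A by (simp add: cprod_simps)
  qed
  have "norm (1 :: 'a cprod) \<le> 1"
    by (subst norm_cprod_le_iff) (simp add: cprod_1 unital_cstar_algebra.nrm_one_le)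
  moreover have "1 \<le> norm (1 :: 'a cprod)"
    using zpart_le_norm[of "1 :: 'a cprod"] by (simp add: cprod_1)
  ultimately show "norm (1 :: 'a cprod) = 1" by simp
qed

end

instance cprod :: (type) banach
proof
  fix X :: "nat \<Rightarrow> 'a cprod" assume "Cauchy X"
  then have X: "\<exists>N. \<forall>m\<ge>N. \<forall>n\<ge>N. norm (X m - X n) < e" if "e > 0" for e
    using that by (auto simp: Cauchy_iff)
  have "Cauchy (\<lambda>n. zpart (X n))"
    unfolding Cauchy_iff
  proof (intro allI impI)
    fix e :: real assume "0 < e"
    then obtain N where N: "\<And>m n. m \<ge> N \<Longrightarrow> n \<ge> N \<Longrightarrow> norm (X m - X n) < e"
      using X by blast
    then show "\<exists>M. \<forall>m\<ge>M. \<forall>n\<ge>M. norm (zpart (X m) - zpart (X n)) < e"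
      using zpart_le_norm[of "X _ - X _"] unfolding cprod_simps by (meson le_less_trans)
  qed
  then obtain z where z: "(\<lambda>n. zpart (X n)) \<longlonglongrightarrow> z"
    using Cauchy_convergent_iff convergent_def by blast
  have "\<exists>l. l \<in> carrier A \<and> (\<forall>e>0. \<exists>N. \<forall>n\<ge>N. nrm A (ev A (X n) \<ominus>\<^bsub>A\<^esub> l) < e)"
    if A: "unital_cstar_algebra A" for A :: "'a star_alg"
  proof -
    interpret unital_cstar_algebra A by (rule A)
    have "MCauchy (\<lambda>n. ev A (X n))"
      unfolding MCauchy_def
    proof (intro conjI allI impI)
      show "range (\<lambda>n. ev A (X n)) \<subseteq> carrier A" using A by auto
      fix e :: real assume "0 < e"
      then obtain N where N: "\<And>m n. m \<ge> N \<Longrightarrow> n \<ge> N \<Longrightarrow> norm (X m - X n) < e"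
        using X by blast
      have "norm_dist A (ev A (X m)) (ev A (X n)) < e" if "m \<ge> N" "n \<ge> N" for m n
        using N[OF that] ev_le_norm[OF A, of "X m - X n"] A by (simp add: norm_dist_eq cprod_simps)
      then show "\<exists>N. \<forall>n n'. N \<le> n \<longrightarrow> N \<le> n' \<longrightarrow> norm_dist A (ev A (X n)) (ev A (X n')) < e"
        by blast
    qed
    then obtain l where l: "limitin mtopology (\<lambda>n. ev A (X n)) l sequentially"
      using complete by (auto simp: mcomplete_def)
    then have lc: "l \<in> carrier A"
      and *: "\<And>e. e > 0 \<Longrightarrow> \<exists>N. \<forall>n\<ge>N. norm_dist A (ev A (X n)) l < e"
      unfolding limit_metric_sequentially by blast+
    show ?thesis
      using lc * A by (intro exI[of _ l]) (simp add: norm_dist_eq)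
  qed
  then obtain L where Lc: "\<And>A. unital_cstar_algebra A \<Longrightarrow> L A \<in> carrier A"
    and L: "\<And>A e. unital_cstar_algebra A \<Longrightarrow> e > 0 \<Longrightarrow> \<exists>N. \<forall>n\<ge>N. nrm A (ev A (X n) \<ominus>\<^bsub>A\<^esub> L A) < e"
    by metis
  \<comment> \<open>Limits in the single factors assemble to a limit of \<open>X\<close> because the
    index \<open>N\<close> depends on \<open>X\<close> alone and serves all factors \<open>A\<close>
    at once.\<close>
  have near: "nrm A (ev A (X n) \<ominus>\<^bsub>A\<^esub> L A) \<le> e"
    if N: "\<And>m n. m \<ge> N \<Longrightarrow> n \<ge> N \<Longrightarrow> norm (X m - X n) < e" and n: "n \<ge> N" and A: "unital_cstar_algebra A" for N n e A
  proof (rule field_le_epsilon)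
    interpret unital_cstar_algebra A by (rule A)
    fix d :: real assume "0 < d"
    then obtain M where M: "\<And>n. n \<ge> M \<Longrightarrow> nrm A (ev A (X n) \<ominus>\<^bsub>A\<^esub> L A) < d"
      using L[OF A] by blast
    let ?m = "max M N"
    have "nrm A (ev A (X n) \<ominus>\<^bsub>A\<^esub> ev A (X ?m)) \<le> e"
      using N[of n ?m] n ev_le_norm[OF A, of "X n - X ?m"] A by (simp add: cprod_simps)
    moreover have "norm_dist A (ev A (X n)) (L A) \<le> norm_dist A (ev A (X n)) (ev A (X ?m)) + norm_dist A (ev A (X ?m)) (L A)"
      using A Lc by (intro triangle) auto
    ultimately show "nrm A (ev A (X n) \<ominus>\<^bsub>A\<^esub> L A) \<le> e + d"
      using M[of ?m] A Lc by (simp add: norm_dist_eq)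
  qed
  obtain N1 where N1: "\<And>m n. m \<ge> N1 \<Longrightarrow> n \<ge> N1 \<Longrightarrow> norm (X m - X n) < 1"
    using X[of 1] by auto
  have bd: "nrm A (L A) \<le> norm (X N1) + 1" if A: "unital_cstar_algebra A" for A
  proof -
    have "nrm A (L A) \<le> nrm A (ev A (X N1)) + nrm A (ev A (X N1) \<ominus>\<^bsub>A\<^esub> L A)"
      using A Lc[OF A] by (intro unital_cstar_algebra.nrm_le_add_diff) auto
    then show ?thesis
      using near[where N = N1 and n = N1 and e = 1, OF N1 order_refl A] ev_le_norm[OF A, of "X N1"] by linarith
  qed
  define l where "l = build z L"
  have zl: "zpart l = z" and el: "unital_cstar_algebra A \<Longrightarrow> ev A l = L A" for A
    unfolding l_def using build[OF Lc bd] by auto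
  have "X \<longlonglongrightarrow> l"
  proof (rule LIMSEQ_I)
    fix e :: real assume e: "0 < e"
    obtain N where N: "\<And>m n. m \<ge> N \<Longrightarrow> n \<ge> N \<Longrightarrow> norm (X m - X n) < e / 2"
      using X[of "e / 2"] e by auto
    obtain M where M: "\<And>n. n \<ge> M \<Longrightarrow> norm (zpart (X n) - z) < e / 2"
      using LIMSEQ_D[OF z, of "e/2"] e by auto
    have le: "norm (X n - l) \<le> e / 2" if n: "n \<ge> max M N" for n
      unfolding norm_cprod_le_iff[of "X n - l"]
    proof (intro conjI allI impI)
      show "cmod (zpart (X n - l)) \<le> e / 2"
        using M[of n] n by (simp add: cprod_simps zl)
      fix A :: "'a star_alg" assume A: "unital_cstar_algebra A"
      show "nrm A (ev A (X n - l)) \<le> e / 2"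
        using near[where N = N and n = n and e = "e / 2", OF N _ A] n A by (simp add: cprod_simps el)
    qed
    have "norm (X n - l) < e" if "n \<ge> max M N" for n
      using le[OF that] e by linarith
    then show "\<exists>no. \<forall>n\<ge>no. norm (X n - l) < e"
      by blast
  qed
  then show "convergent X" by (rule convergentI)
qed

instantiation cprod :: (type) cstar
begin

definition "ofc u = (build u (\<lambda>A. u \<odot>\<^bsub>A\<^esub> \<one>\<^bsub>A\<^esub>) :: 'a cprod)"
definition "adj x = build (cnj (zpart x)) (\<lambda>A. star A (ev A x))"

lemma cprod_ofc: "zpart (ofc u) = u"
    "unital_cstar_algebra A \<Longrightarrow> ev A (ofc u) = u \<odot>\<^bsub>A\<^esub> \<one>\<^bsub>A\<^esub>"
proof -
  have 1: "u \<odot>\<^bsub>A\<^esub> \<one>\<^bsub>A\<^esub> \<in> carrier A" "nrm A (u \<odot>\<^bsub>A\<^esub> \<one>\<^bsub>A\<^esub>) \<le> cmod u" if A: "unital_cstar_algebra A" for A :: "'a star_alg"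
    using unital_cstar_algebra.nrm_smult_one_le[OF A, of u]
      unital_cstar_algebra.smult_closed[OF A ring.ring_simprules(6)[OF unital_cstar_algebra.axioms(1)[OF A]], of u]
    by simp_all
  show "zpart (ofc u :: 'a cprod) = u"
    "unital_cstar_algebra A \<Longrightarrow> ev A (ofc u) = u \<odot>\<^bsub>A\<^esub> \<one>\<^bsub>A\<^esub>"
    unfolding ofc_cprod_def using build[OF 1] by auto
qed

lemma cprod_adj: "zpart (adj x) = cnj (zpart x)"
    "unital_cstar_algebra A \<Longrightarrow> ev A (adj x) = star A (ev A x)"
proof -
  obtain K where K: "\<And>A. unital_cstar_algebra A \<Longrightarrow> nrm A (ev A x) \<le> K"
    using ev_bounded[of x] by metis
  have 1: "star A (ev A x) \<in> carrier A" "nrm A (star A (ev A x)) \<le> K" if A: "unital_cstar_algebra A" for A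
    using unital_cstar_algebra.nrm_star_le[OF A, of "ev A x"] K[OF A] A by (auto intro: unital_cstar_algebra.star_closed)
  show "zpart (adj x) = cnj (zpart x)"
    "unital_cstar_algebra A \<Longrightarrow> ev A (adj x) = star A (ev A x)"
    unfolding adj_cprod_def using build[OF 1] by auto
qed

instance
proof
  fix u v :: complex and x y :: "'a cprod" and r :: real
  have one: "\<one>\<^bsub>A\<^esub> \<in> carrier A" if "unital_cstar_algebra A" for A :: "'a star_alg"
    using that by (simp add: ring.ring_simprules(6) unital_cstar_algebra.axioms)
  note u = unital_cstar_algebra.smult_add_left unital_cstar_algebra.smult_smult unital_cstar_algebra.smult_1
    unital_cstar_algebra.smult_mult_left unital_cstar_algebra.smult_mult_right unital_cstar_algebra.smult_closed
    unital_cstar_algebra.star_star unital_cstar_algebra.star_add unital_cstar_algebra.star_mult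
    unital_cstar_algebra.star_smult unital_cstar_algebra.star_one
    monoid.r_one[OF ring.is_monoid[OF unital_cstar_algebra.axioms(1)]]
    monoid.l_one[OF ring.is_monoid[OF unital_cstar_algebra.axioms(1)]] mult.commute
  show "ofc (u + v) = (ofc u + ofc v :: 'a cprod)" "ofc (u * v) = (ofc u * ofc v :: 'a cprod)"
    "ofc (of_real r) = (r *\<^sub>R 1 :: 'a cprod)" "ofc u * x = x * ofc u"
    "adj (adj x) = x" "adj (x + y) = adj x + adj y" "adj (x * y) = adj y * adj x"
    "adj (ofc u) = (ofc (cnj u) :: 'a cprod)"
    by (rule cprod_eqI; simp add: cprod_simps cprod_scaleR cprod_ofc cprod_adj one u)+
  show "norm (adj x * x) = (norm x)\<^sup>2"
  proof (rule antisym)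
    show "norm (adj x * x) \<le> (norm x)\<^sup>2"
      unfolding norm_cprod_le_iff[of "adj x * x"]
      by (auto simp: cprod_simps cprod_adj norm_mult unital_cstar_algebra.cstar_identity power2_eq_square[symmetric]
         unital_cstar_algebra.nrm_ge_0 zpart_le_norm ev_le_norm intro!: power_mono)
    have "norm x \<le> sqrt (norm (adj x * x))"
      unfolding norm_cprod_le_iff[of x]
    proof (intro conjI allI impI)
      show "cmod (zpart x) \<le> sqrt (norm (adj x * x))"
        using zpart_le_norm[of "adj x * x"]
        by (intro real_le_rsqrt) (simp add: cprod_simps cprod_adj norm_mult power2_eq_square)
      fix A :: "'a star_alg" assume A: "unital_cstar_algebra A"
      show "nrm A (ev A x) \<le> sqrt (norm (adj x * x))"
        using ev_le_norm[OF A, of "adj x * x"] A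
        by (intro real_le_rsqrt) (simp add: cprod_simps cprod_adj unital_cstar_algebra.cstar_identity)
    qed
    then show "(norm x)\<^sup>2 \<le> norm (adj x * x)"
      using norm_ge_zero real_sqrt_le_iff sqrt_le_D by (metis real_sqrt_abs real_sqrt_pow2 power_mono)
  qed
qed

end

section \<open>One algebra as a corner of the product\<close>

lemmas ev_simps = cprod_0(2) cprod_1(2) cprod_add(2) cprod_uminus(2) cprod_diff(2) cprod_mult(2)
  cprod_scaleR(2) cprod_ofc(2) cprod_adj(2)
lemmas zpart_simps = cprod_0(1) cprod_1(1) cprod_add(1) cprod_uminus(1) cprod_diff(1) cprod_mult(1)
  cprod_scaleR(1) cprod_ofc(1) cprod_adj(1)

definition iota :: "'a star_alg \<Rightarrow> 'a \<Rightarrow> 'a cprod" where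
  "iota A a = build 0 (\<lambda>C. if C = A then a else \<zero>\<^bsub>C\<^esub>)"

context unital_cstar_algebra
begin

lemmas ev_A = ev_simps[OF unital_cstar_algebra_axioms]

lemma ev_A_closed [simp, intro]: "ev A x \<in> carrier A"
  using unital_cstar_algebra_axioms by (rule ev_closed)

lemma iota_coords:
  assumes "a \<in> carrier A"
  shows "zpart (iota A a) = 0"
    and "unital_cstar_algebra C \<Longrightarrow> ev C (iota A a) = (if C = A then a else \<zero>\<^bsub>C\<^esub>)"
proof -
  have 1: "(if C = A then a else \<zero>\<^bsub>C\<^esub>) \<in> carrier C" if "unital_cstar_algebra C" for C
    using that assms by (simp add: ring.ring_simprules(2) unital_cstar_algebra.axioms)
  have 2: "nrm C (if C = A then a else \<zero>\<^bsub>C\<^esub>) \<le> nrm A a" if "unital_cstar_algebra C" for C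
    using that assms by (simp add: unital_cstar_algebra.nrm_zero)
  show "zpart (iota A a) = 0"
    "unital_cstar_algebra C \<Longrightarrow> ev C (iota A a) = (if C = A then a else \<zero>\<^bsub>C\<^esub>)"
    unfolding iota_def using build[OF 1 2] by auto
qed

lemma ev_iota [simp]: "a \<in> carrier A \<Longrightarrow> ev A (iota A a) = a"
  using iota_coords(2)[OF _ unital_cstar_algebra_axioms] by simp

lemma iota_eqI:
  assumes "a \<in> carrier A" "zpart x = 0" "ev A x = a"
    "\<And>C. unital_cstar_algebra C \<Longrightarrow> C \<noteq> A \<Longrightarrow> ev C x = \<zero>\<^bsub>C\<^esub>"
  shows "iota A a = x"
  using assms by (intro cprod_eqI) (auto simp: iota_coords)

lemma iota_inj: "a \<in> carrier A \<Longrightarrow> b \<in> carrier A \<Longrightarrow> iota A a = iota A b \<longleftrightarrow> a = b"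
  using ev_iota by metis

lemma
  assumes a: "a \<in> carrier A" and b: "b \<in> carrier A"
  shows iota_add: "iota A (a \<oplus> b) = iota A a + iota A b"
    and iota_diff: "iota A (a \<ominus> b) = iota A a - iota A b"
    and iota_mult: "iota A (a \<otimes> b) = iota A a * iota A b"
proof -
  note r = ring.ring_simprules[OF unital_cstar_algebra.axioms(1)]
  show "iota A (a \<oplus> b) = iota A a + iota A b" "iota A (a \<ominus> b) = iota A a - iota A b"
    "iota A (a \<otimes> b) = iota A a * iota A b"
    using a b unital_cstar_algebra_axioms
    by (intro iota_eqI; simp add: ev_simps zpart_simps iota_coords r)+
qed

lemma iota_zero [simp]: "iota A \<zero> = 0"
  by (rule iota_eqI) (auto simp: ev_simps zpart_simps unital_cstar_algebra_axioms)

lemma iota_eq_0_iff: "a \<in> carrier A \<Longrightarrow> iota A a = 0 \<longleftrightarrow> a = \<zero>"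
  using iota_inj[of a \<zero>] by simp

lemma iota_star: "a \<in> carrier A \<Longrightarrow> iota A (a\<^sup>\<star>) = adj (iota A a)"
  using unital_cstar_algebra_axioms
  by (intro iota_eqI) (auto simp: ev_simps zpart_simps iota_coords star_closed unital_cstar_algebra.star_zero)

lemma iota_smult: "a \<in> carrier A \<Longrightarrow> iota A (c \<odot> a) = ofc c * iota A a"
  using unital_cstar_algebra_axioms
  by (intro iota_eqI) (auto simp: ev_simps zpart_simps iota_coords unital_cstar_algebra.smult_mult_left
     unital_cstar_algebra.smult_0_right ring.ring_simprules[OF unital_cstar_algebra.axioms(1)])

lemma iota_finsum:
  "finite I \<Longrightarrow> (\<And>i. i \<in> I \<Longrightarrow> f i \<in> carrier A) \<Longrightarrow>
    iota A (\<Oplus>i\<in>I. f i) = (\<Sum>i\<in>I. iota A (f i))"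
  by (induction I rule: finite_induct) (auto simp: iota_add finsum_insert Pi_def)

lemma null_mult: "x \<in> carrier A \<Longrightarrow> \<zero> \<otimes> x = \<zero>" "x \<in> carrier A \<Longrightarrow> x \<otimes> \<zero> = \<zero>"
  by simp_all

lemma mult_one: "x \<in> carrier A \<Longrightarrow> \<one> \<otimes> x = x" "x \<in> carrier A \<Longrightarrow> x \<otimes> \<one> = x"
  by simp_all

lemma iota_ev:
  "iota A (ev A x) = iota A \<one> * x" "iota A (ev A x) = x * iota A \<one>"
  using unital_cstar_algebra_axioms
  by (intro iota_eqI; simp add: ev_simps zpart_simps iota_coords
     unital_cstar_algebra.null_mult unital_cstar_algebra.mult_one)+

lemma iota_one_commute: "iota A \<one> * x = x * iota A \<one>"
  using iota_ev[of x] by simp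

lemma iota_one_mult [simp]:
  "a \<in> carrier A \<Longrightarrow> iota A \<one> * iota A a = iota A a"
  "a \<in> carrier A \<Longrightarrow> iota A a * iota A \<one> = iota A a"
  by (simp_all flip: iota_mult)

lemma adj_iota_one [simp]: "adj (iota A \<one>) = iota A \<one>"
  by (simp flip: iota_star)

lemma norm_iota [simp]:
  assumes "a \<in> carrier A"
  shows "norm (iota A a) = \<parallel>a\<parallel>"
proof (rule antisym)
  show "norm (iota A a) \<le> \<parallel>a\<parallel>"
    unfolding norm_cprod_le_iff using assms
    by (auto simp: iota_coords unital_cstar_algebra.nrm_zero)
  show "\<parallel>a\<parallel> \<le> norm (iota A a)"
    using ev_le_norm[OF unital_cstar_algebra_axioms, of "iota A a"] assms by simp
qed

lemma iota_ev_iff: "iota A (ev A x) = x \<longleftrightarrow> iota A \<one> * x = x"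
  using iota_ev(1)[of x] by simp

lemma norm_dist_iota:
  "a \<in> carrier A \<Longrightarrow> b \<in> carrier A \<Longrightarrow> norm_dist A a b = norm (iota A a - iota A b)"
  by (simp add: norm_dist_eq flip: iota_diff)

lemma limitin_iota:
  assumes "\<And>n. f n \<in> carrier A" "l \<in> carrier A"
  shows "limitin (norm_topology A) f l sequentially \<longleftrightarrow> (\<lambda>n. iota A (f n)) \<longlonglongrightarrow> iota A l"
  using assms by (simp add: limit_metric_sequentially LIMSEQ_iff norm_dist_iota)

lemma iota_limit:
  assumes "\<And>n. f n \<in> carrier A" "(\<lambda>n. iota A (f n)) \<longlonglongrightarrow> x"
  shows "x = iota A (ev A x)"
proof -
  have "(\<lambda>n. iota A \<one> * iota A (f n)) \<longlonglongrightarrow> iota A \<one> * x"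
    by (intro tendsto_intros assms)
  then have "(\<lambda>n. iota A (f n)) \<longlonglongrightarrow> iota A \<one> * x"
    using assms(1) by simp
  from LIMSEQ_unique[OF assms(2) this] show ?thesis
    by (simp only: iota_ev(1))
qed

lemma closedin_iota:
  "closedin (norm_topology A) S \<longleftrightarrow> S \<subseteq> carrier A \<and>
    (\<forall>f l. (\<forall>n. f n \<in> S) \<and> l \<in> carrier A \<and> (\<lambda>n. iota A (f n)) \<longlonglongrightarrow> iota A l \<longrightarrow> l \<in> S)"
proof (cases "S \<subseteq> carrier A")
  case True
  have "(\<forall>n. f n \<in> S) \<and> limitin (norm_topology A) f l sequentially \<longleftrightarrow>
     (\<forall>n. f n \<in> S) \<and> l \<in> carrier A \<and> (\<lambda>n. iota A (f n)) \<longlonglongrightarrow> iota A l" for f l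
    using limitin_iota[of f l] limitin_mspace[of f l sequentially] True by blast
  then show ?thesis
    unfolding metric_closedin_iff_sequentially_closed image_subset_iff by (simp add: True)
qed (simp add: metric_closedin_iff_sequentially_closed)

text \<open>For \<open>t \<noteq> 0\<close> the two notions of spectrum agree: an inverse in
  \<open>A\<close> extends to the product by \<open>1 / t\<close> on the complementary factor, and
  an inverse in the product restricts to \<open>A\<close> by \<open>ev A\<close>. Positivity only
  excludes values different from 0.\<close>

lemma positives_iff_cpos: "a \<in> positives A \<longleftrightarrow> a \<in> carrier A \<and> cpos (iota A a)"
proof
  assume a: "a \<in> positives A"
  then have ac: "a \<in> carrier A" and as: "a\<^sup>\<star> = a"
    by (auto simp: positives_def)
  let ?p = "iota A \<one>"
  have "0 \<le> t" if t: "t \<in> rspec (iota A a)" for t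
  proof (rule ccontr)
    assume neg: "\<not> 0 \<le> t"
    then have "of_real t \<notin> spectrum A a"
      using a by (auto simp: positives_def)
    then obtain b where b: "b \<in> carrier A" "(of_real t \<odot> \<one> \<ominus> a) \<otimes> b = \<one>" "b \<otimes> (of_real t \<odot> \<one> \<ominus> a) = \<one>"
      by (auto simp: spectrum_def Units_def)
    \<comment> \<open>On the complement of the corner \<open>?x\<close> is the scalar
      \<open>t\<close>, which is invertible as \<open>t\<close> is negative.\<close>
    let ?x = "of_real t - iota A a" and ?y = "iota A b + (1 / t) *\<^sub>R (1 - ?p)"
    have i: "iota A (of_real t \<odot> \<one> \<ominus> a) = of_real t * ?p - iota A a"
      using ac by (simp add: iota_diff iota_smult ofc_of_real)
    have "(of_real t * ?p - iota A a) * iota A b = ?p" "iota A b * (of_real t * ?p - iota A a) = ?p"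
      using b ac unfolding i[symmetric] by (simp_all flip: iota_mult)
    then have xb: "?x * iota A b = ?p" "iota A b * ?x = ?p"
      using b(1) by (simp_all add: algebra_simps of_real_def)
    have pa: "?x * (1 - ?p) = of_real t * (1 - ?p)" "(1 - ?p) * ?x = of_real t * (1 - ?p)"
      using ac by (simp_all add: algebra_simps of_real_def)
    have "invertible_elt ?x"
    proof (rule invertible_eltI)
      show "?x * ?y = 1"
        using neg xb(1) pa(1) by (simp add: distrib_left of_real_def)
      show "?y * ?x = 1"
        using neg xb(2) pa(2) by (simp add: distrib_right of_real_def)
    qed
    then show False using t by (simp add: rspec_alt)
  qed
  then show "a \<in> carrier A \<and> cpos (iota A a)"
    using ac as by (simp add: cpos_def flip: iota_star)
next
  assume a: "a \<in> carrier A \<and> cpos (iota A a)"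
  then have as: "a\<^sup>\<star> = a"
    using iota_inj[of "a\<^sup>\<star>" a] by (simp add: cpos_def iota_star star_closed)
  have "Im z = 0 \<and> Re z \<ge> 0" if z: "z \<in> spectrum A a" for z
  proof -
    have "z \<in> spec (iota A a)"
    proof (rule ccontr)
      assume "z \<notin> spec (iota A a)"
      then obtain y where y: "(ofc z - iota A a) * y = 1" "y * (ofc z - iota A a) = 1"
        by (auto simp: spec_def invertible_elt_def)
      then have "ev A ((ofc z - iota A a) * y) = \<one>" "ev A (y * (ofc z - iota A a)) = \<one>"
        by (simp_all add: ev_A)
      then have "z \<odot> \<one> \<ominus> a \<in> Units A"
        unfolding Units_def using a by (auto simp: ev_A intro!: bexI[of _ "ev A y"])
      then show False using z by (simp add: spectrum_def)
    qed
    then obtain t where "t \<in> rspec (iota A a)" "z = of_real t"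
      using spec_eq_of_real_rspec a by (auto simp: cpos_def)
    then show ?thesis using a by (auto simp: cpos_def)
  qed
  then show "a \<in> positives A"
    using a as by (auto simp: positives_def)
qed

text \<open>The square form makes no reference to a spectrum, so it carries positivity from a
  subalgebra to the whole algebra and from entries to matrices.\<close>

lemma positives_iff_square: "a \<in> positives A \<longleftrightarrow> (\<exists>s\<in>carrier A. a = s\<^sup>\<star> \<otimes> s)"
proof
  assume "a \<in> positives A"
  then have a: "a \<in> carrier A" "cpos (iota A a)"
    by (auto simp: positives_iff_cpos)
  let ?s = "psqrt (iota A a)"
  have "ev A (adj ?s * ?s) = a"
    using a by (simp add: adj_psqrt psqrt_mult)
  then show "\<exists>s\<in>carrier A. a = s\<^sup>\<star> \<otimes> s"
    by (intro bexI[of _ "ev A ?s"]) (simp_all add: ev_A)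
qed (auto simp: positives_iff_cpos iota_mult iota_star star_closed cpos_adj_mult)

end

subsection \<open>Subalgebras\<close>

lemma (in unital_cstar_algebra) subalgebra_a_inv:
  assumes "subring B A" "x \<in> B"
  shows "a_inv (A\<lparr>carrier := B\<rparr>) x = \<ominus> x"
proof -
  interpret B: ring "A\<lparr>carrier := B\<rparr>" by (rule subring_is_ring[OF assms(1)])
  have "a_inv (A\<lparr>carrier := B\<rparr>) x \<in> B" "a_inv (A\<lparr>carrier := B\<rparr>) x \<oplus> x = \<zero>"
    using B.a_inv_closed[of x] B.l_neg[of x] assms by auto
  then show ?thesis
    using subringE(1)[OF assms(1)] assms by (intro minus_equality[symmetric]) auto
qed

lemma (in unital_cstar_algebra) subalgebra_a_minus:
  assumes "subring B A" "y \<in> B"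
  shows "x \<ominus>\<^bsub>A\<lparr>carrier := B\<rparr>\<^esub> y = x \<ominus> y"
  using subalgebra_a_inv[OF assms] by (simp add: a_minus_def)

lemma (in unital_cstar_algebra) subalgebra_is_cstar:
  assumes B: "unital_cstar_subalgebra B A"
  shows "unital_cstar_algebra (A\<lparr>carrier := B\<rparr>)"
proof -
  have sub: "subring B A" and cl: "closedin (norm_topology A) B"
    and sm: "\<And>c x. x \<in> B \<Longrightarrow> c \<odot> x \<in> B" and st: "\<And>x. x \<in> B \<Longrightarrow> x\<^sup>\<star> \<in> B"
    using B by (auto simp: unital_cstar_subalgebra_def)
  have BA: "B \<subseteq> carrier A" by (rule subringE(1)[OF sub])
  then have BA': "\<And>x. x \<in> B \<Longrightarrow> x \<in> carrier A" by blast
  interpret B: ring "A\<lparr>carrier := B\<rparr>" by (rule subring_is_ring[OF sub])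
  interpret Submetric "carrier A" "norm_dist A" B
    by unfold_locales (rule BA)
  have "Metric_space.mcomplete B (norm_dist A)"
    by (rule closedin_mcomplete_imp_mcomplete[OF cl complete])
  \<comment> \<open>The distance of the restricted record is 0 as soon as one argument is outside
    \<open>B\<close>, so it is a different function; it agrees with the old one on \<open>B\<close>,
    where Cauchy sequences and limits are tested.\<close>
  moreover have d: "norm_dist (A\<lparr>carrier := B\<rparr>) x y = norm_dist A x y" if "x \<in> B" "y \<in> B" for x y
    using that by (simp add: norm_dist_def subalgebra_a_minus[OF sub] BA')
  have ms: "Metric_space B (norm_dist (A\<lparr>carrier := B\<rparr>))"
  proof
    fix x y z
    show "0 \<le> norm_dist (A\<lparr>carrier := B\<rparr>) x y"
      by (cases "x \<in> B \<and> y \<in> B") (use d nonneg in \<open>auto simp: norm_dist_def[of "A\<lparr>carrier := B\<rparr>"]\<close>)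
    show "norm_dist (A\<lparr>carrier := B\<rparr>) x y = norm_dist (A\<lparr>carrier := B\<rparr>) y x"
      by (cases "x \<in> B \<and> y \<in> B") (use d commute in \<open>auto simp: norm_dist_def[of "A\<lparr>carrier := B\<rparr>"]\<close>)
    assume "x \<in> B" "y \<in> B"
    then show "norm_dist (A\<lparr>carrier := B\<rparr>) x y = 0 \<longleftrightarrow> x = y"
      using BA' by (simp add: d)
    assume "z \<in> B"
    then show "norm_dist (A\<lparr>carrier := B\<rparr>) x z \<le> norm_dist (A\<lparr>carrier := B\<rparr>) x y + norm_dist (A\<lparr>carrier := B\<rparr>) y z"
      using \<open>x \<in> B\<close> \<open>y \<in> B\<close> BA' triangle by (simp add: d)
  qed
  interpret BM: Metric_space B "norm_dist (A\<lparr>carrier := B\<rparr>)" by (rule ms)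
  have "BM.MCauchy s \<longleftrightarrow> sub.MCauchy s" for s
    unfolding BM.MCauchy_def sub.MCauchy_def using d by (metis range_subsetD)
  moreover have "limitin BM.mtopology s l sequentially \<longleftrightarrow> limitin sub.mtopology s l sequentially" for s l
    unfolding BM.limit_metric_sequentially sub.limit_metric_sequentially using d by metis
  ultimately have comp: "BM.mcomplete"
    unfolding BM.mcomplete_def sub.mcomplete_def by simp
  show ?thesis
  proof (intro unital_cstar_algebra.intro unital_cstar_algebra_axioms.intro)
    show "ring (A\<lparr>carrier := B\<rparr>)" by (rule B.ring_axioms)
    show "Module.module complex_ring (A\<lparr>carrier := B\<rparr>)"
    proof (rule moduleI)
      show "cring complex_ring"
        using module.axioms(1)[OF complex_module] .
      show "abelian_group (A\<lparr>carrier := B\<rparr>)" ..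
    qed (use sm BA' in \<open>auto simp: complex_ring_def smult_add_left smult_add_right smult_smult\<close>)
    show "Metric_space.mcomplete (carrier (A\<lparr>carrier := B\<rparr>)) (norm_dist (A\<lparr>carrier := B\<rparr>))"
      using comp by simp
  next
    fix x y c
    assume "x \<in> carrier (A\<lparr>carrier := B\<rparr>)"
    then have x: "x \<in> B" "x \<in> carrier A" using BA' by auto
    show "star (A\<lparr>carrier := B\<rparr>) x \<in> carrier (A\<lparr>carrier := B\<rparr>)"
      "star (A\<lparr>carrier := B\<rparr>) (star (A\<lparr>carrier := B\<rparr>) x) = x"
      "star (A\<lparr>carrier := B\<rparr>) (c \<odot>\<^bsub>A\<lparr>carrier := B\<rparr>\<^esub> x) = cnj c \<odot>\<^bsub>A\<lparr>carrier := B\<rparr>\<^esub> star (A\<lparr>carrier := B\<rparr>) x"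
      "nrm (A\<lparr>carrier := B\<rparr>) x = 0 \<longleftrightarrow> x = \<zero>\<^bsub>A\<lparr>carrier := B\<rparr>\<^esub>"
      "nrm (A\<lparr>carrier := B\<rparr>) (c \<odot>\<^bsub>A\<lparr>carrier := B\<rparr>\<^esub> x) = cmod c * nrm (A\<lparr>carrier := B\<rparr>) x"
      "nrm (A\<lparr>carrier := B\<rparr>) (star (A\<lparr>carrier := B\<rparr>) x \<otimes>\<^bsub>A\<lparr>carrier := B\<rparr>\<^esub> x) = (nrm (A\<lparr>carrier := B\<rparr>) x)\<^sup>2"
      using x(1) st star_star[OF x(2)] star_smult[OF x(2)] nrm_eq_0[OF x(2)] nrm_smult[OF x(2)] cstar_identity[OF x(2)]
      by simp_all
    assume "y \<in> carrier (A\<lparr>carrier := B\<rparr>)"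
    then have y: "y \<in> carrier A" using BA' by auto
    show "(c \<odot>\<^bsub>A\<lparr>carrier := B\<rparr>\<^esub> x) \<otimes>\<^bsub>A\<lparr>carrier := B\<rparr>\<^esub> y = c \<odot>\<^bsub>A\<lparr>carrier := B\<rparr>\<^esub> (x \<otimes>\<^bsub>A\<lparr>carrier := B\<rparr>\<^esub> y)"
      "x \<otimes>\<^bsub>A\<lparr>carrier := B\<rparr>\<^esub> (c \<odot>\<^bsub>A\<lparr>carrier := B\<rparr>\<^esub> y) = c \<odot>\<^bsub>A\<lparr>carrier := B\<rparr>\<^esub> (x \<otimes>\<^bsub>A\<lparr>carrier := B\<rparr>\<^esub> y)"
      "star (A\<lparr>carrier := B\<rparr>) (x \<oplus>\<^bsub>A\<lparr>carrier := B\<rparr>\<^esub> y) = star (A\<lparr>carrier := B\<rparr>) x \<oplus>\<^bsub>A\<lparr>carrier := B\<rparr>\<^esub> star (A\<lparr>carrier := B\<rparr>) y"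
      "star (A\<lparr>carrier := B\<rparr>) (x \<otimes>\<^bsub>A\<lparr>carrier := B\<rparr>\<^esub> y) = star (A\<lparr>carrier := B\<rparr>) y \<otimes>\<^bsub>A\<lparr>carrier := B\<rparr>\<^esub> star (A\<lparr>carrier := B\<rparr>) x"
      "nrm (A\<lparr>carrier := B\<rparr>) (x \<oplus>\<^bsub>A\<lparr>carrier := B\<rparr>\<^esub> y) \<le> nrm (A\<lparr>carrier := B\<rparr>) x + nrm (A\<lparr>carrier := B\<rparr>) y"
      "nrm (A\<lparr>carrier := B\<rparr>) (x \<otimes>\<^bsub>A\<lparr>carrier := B\<rparr>\<^esub> y) \<le> nrm (A\<lparr>carrier := B\<rparr>) x * nrm (A\<lparr>carrier := B\<rparr>) y"
      using smult_mult_left[OF x(2) y] smult_mult_right[OF x(2) y] star_add[OF x(2) y] star_mult[OF x(2) y]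
        nrm_triangle[OF x(2) y] nrm_mult[OF x(2) y] by simp_all
  qed
qed

section \<open>Matrices over a C*-algebra\<close>

subsection \<open>The Hilbert module of columns\<close>

text \<open>Columns and matrices are functions on all of \<open>nat\<close>, read only at indices
  below \<open>n\<close>; the values elsewhere are arbitrary, which is why equalities pass through
  \<open>ip_cong\<close>, \<open>cn_cong\<close> and \<open>opn_cong\<close>.\<close>

definition ip :: "nat \<Rightarrow> (nat \<Rightarrow> 'a::cstar) \<Rightarrow> (nat \<Rightarrow> 'a) \<Rightarrow> 'a" where
  "ip n u v = (\<Sum>k<n. adj (u k) * v k)"

definition cn :: "nat \<Rightarrow> (nat \<Rightarrow> 'a::cstar) \<Rightarrow> real" where
  "cn n v = sqrt (norm (ip n v v))"

definition mv :: "nat \<Rightarrow> (nat \<Rightarrow> nat \<Rightarrow> 'a::cstar) \<Rightarrow> (nat \<Rightarrow> 'a) \<Rightarrow> nat \<Rightarrow> 'a" where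
  "mv n X v i = (\<Sum>k<n. X i k * v k)"

definition mmul :: "nat \<Rightarrow> (nat \<Rightarrow> nat \<Rightarrow> 'a::cstar) \<Rightarrow> (nat \<Rightarrow> nat \<Rightarrow> 'a) \<Rightarrow> nat \<Rightarrow> nat \<Rightarrow> 'a" where
  "mmul n X Y i j = (\<Sum>k<n. X i k * Y k j)"

definition madj :: "(nat \<Rightarrow> nat \<Rightarrow> 'a::cstar) \<Rightarrow> nat \<Rightarrow> nat \<Rightarrow> 'a" where
  "madj X i j = adj (X j i)"

definition opn :: "nat \<Rightarrow> (nat \<Rightarrow> nat \<Rightarrow> 'a::cstar) \<Rightarrow> real" where
  "opn n X = Sup {cn n (mv n X v) | v. cn n v \<le> 1}"

lemma adj_ip: "adj (ip n u v) = ip n v u"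
  by (simp add: ip_def adj_sum adj_mult)

lemma cpos_ip: "cpos (ip n v v)"
  unfolding ip_def by (intro cpos_sum cpos_adj_mult)

lemma cn_ge_0 [simp]: "0 \<le> cn n v"
  by (simp add: cn_def)

lemma cn_power2: "(cn n v)\<^sup>2 = norm (ip n v v)"
  by (simp add: cn_def)

lemma ip_cong: "(\<And>k. k < n \<Longrightarrow> u k = u' k) \<Longrightarrow> (\<And>k. k < n \<Longrightarrow> v k = v' k) \<Longrightarrow> ip n u v = ip n u' v'"
  unfolding ip_def by (intro sum.cong) auto

lemma cn_cong: "(\<And>k. k < n \<Longrightarrow> u k = v k) \<Longrightarrow> cn n u = cn n v"
  unfolding cn_def by (metis ip_cong)

lemma norm_le_cn:
  assumes "k < n"
  shows "norm (v k) \<le> cn n v"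
proof -
  have "ip n v v = adj (v k) * v k + (\<Sum>i\<in>{..<n} - {k}. adj (v i) * v i)"
    unfolding ip_def using assms by (subst sum.remove[of _ k]) auto
  then have "adj (v k) * v k \<preceq> ip n v v"
    by (simp add: cle_def cpos_sum cpos_adj_mult)
  then have "norm (adj (v k) * v k) \<le> norm (ip n v v)"
    by (intro norm_mono cpos_adj_mult)
  then show ?thesis
    by (simp add: norm_adj_mult cn_def real_le_rsqrt)
qed

lemma cn_le_sum: "cn n v \<le> (\<Sum>k<n. norm (v k))"
proof -
  have "norm (ip n v v) \<le> (\<Sum>k<n. (norm (v k))\<^sup>2)"
    unfolding ip_def by (intro sum_norm_le) (simp add: norm_adj_mult)
  then have "cn n v \<le> L2_set (\<lambda>k. norm (v k)) {..<n}"
    by (simp add: cn_def L2_set_def)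
  also have "\<dots> \<le> (\<Sum>k<n. norm (v k))"
    by (intro L2_set_le_sum) auto
  finally show ?thesis .
qed

text \<open>With \<open>a = ip n u v\<close> and \<open>N = norm (ip n u u)\<close>, positivity of
  the inner square of \<open>u a - N v\<close>, together with
  \<open>ip n u u \<preceq> of_real N\<close>, gives
  \<open>adj a * a \<preceq> N *\<^sub>R ip n v v\<close>; taking norms finishes. For
  \<open>N = 0\<close> the column \<open>u\<close> vanishes.\<close>

lemma Cauchy_Schwarz_ip: "norm (ip n u v) \<le> cn n u * cn n v"
proof (cases "norm (ip n u u) = 0")
  case True
  then have "u k = 0" if "k < n" for k
    using norm_le_cn[OF that, of u] by (simp add: cn_def)
  then have "ip n u v = 0"
    by (simp add: ip_def)
  then show ?thesis by simp
next
  case False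
  define N a where "N = norm (ip n u u)" and "a = ip n u v"
  have N: "N > 0" using False by (simp add: N_def)
  have a': "adj a = ip n v u" by (simp add: a_def adj_ip)
  let ?w = "\<lambda>k. u k * a - N *\<^sub>R v k"
  have "ip n ?w ?w = adj a * ip n u u * a - N *\<^sub>R (adj a * ip n u v) - N *\<^sub>R (ip n v u * a) + (N * N) *\<^sub>R ip n v v"
    unfolding ip_def
    by (simp add: adj_diff adj_mult adj_scaleR sum_distrib_left sum_distrib_right scaleR_sum_right
        algebra_simps sum.distrib sum_subtractf)
  then have "ip n ?w ?w = adj a * ip n u u * a - N *\<^sub>R (adj a * a) - N *\<^sub>R (adj a * a) + (N * N) *\<^sub>R ip n v v"
    unfolding a'[symmetric] a_def[symmetric] .
  then have 1: "cpos (adj a * ip n u u * a - N *\<^sub>R (adj a * a) - N *\<^sub>R (adj a * a) + (N * N) *\<^sub>R ip n v v)"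
    using cpos_ip[of n ?w] by simp
  have "ip n u u \<preceq> of_real N"
    unfolding N_def by (intro cle_of_real_norm) (auto simp: adj_ip)
  then have "adj a * ip n u u * a \<preceq> N *\<^sub>R (adj a * a)"
    using cle_conj_mono(1)[of "ip n u u" "of_real N" a] by (simp add: of_real_def)
  then have "cpos (N *\<^sub>R (adj a * a) - adj a * ip n u u * a)"
    by (simp add: cle_def)
  from cpos_add[OF this 1] have "cpos ((N * N) *\<^sub>R ip n v v - N *\<^sub>R (adj a * a))"
    by (simp add: algebra_simps)
  from cpos_scaleR[OF this, of "1 / N"] N have "adj a * a \<preceq> N *\<^sub>R ip n v v"
    by (simp add: cle_def scaleR_diff_right)
  then have "norm (adj a * a) \<le> norm (N *\<^sub>R ip n v v)"
    by (intro norm_mono cpos_adj_mult)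
  then have "(norm a)\<^sup>2 \<le> N * norm (ip n v v)"
    using N by (simp add: norm_adj_mult)
  also have "\<dots> = (cn n u * cn n v)\<^sup>2"
    by (simp add: power_mult_distrib cn_power2 N_def)
  finally show ?thesis
    unfolding a_def by (rule power2_le_imp_le) simp
qed

lemma cn_triangle: "cn n (\<lambda>k. u k + v k) \<le> cn n u + cn n v"
proof -
  have "ip n (\<lambda>k. u k + v k) (\<lambda>k. u k + v k) = ip n u u + ip n u v + (ip n v u + ip n v v)"
    by (simp add: ip_def adj_add algebra_simps sum.distrib)
  then have "(cn n (\<lambda>k. u k + v k))\<^sup>2 \<le> (norm (ip n u u) + norm (ip n u v)) + (norm (ip n v u) + norm (ip n v v))"
    unfolding cn_power2 by (simp only:) (intro norm_triangle_mono norm_triangle_ineq)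
  also have "\<dots> \<le> ((cn n u)\<^sup>2 + cn n u * cn n v) + (cn n v * cn n u + (cn n v)\<^sup>2)"
    using Cauchy_Schwarz_ip[of n u v] Cauchy_Schwarz_ip[of n v u] by (simp add: cn_power2 mult.commute)
  also have "\<dots> = (cn n u + cn n v)\<^sup>2"
    by (simp add: power2_eq_square algebra_simps)
  finally show ?thesis
    by (rule power2_le_imp_le) simp
qed

lemma cn_ofc: "cn n (\<lambda>k. ofc c * v k) = cmod c * cn n v"
proof -
  have "ip n (\<lambda>k. ofc c * v k) (\<lambda>k. ofc c * v k) = ofc (cnj c * c) * ip n v v"
    unfolding ip_def sum_distrib_left
    by (intro sum.cong refl) (simp add: adj_mult adj_ofc ofc_mult mult.assoc ofc_left_commute[of "adj (v _)"])
  then have "(cn n (\<lambda>k. ofc c * v k))\<^sup>2 = (cmod c * cn n v)\<^sup>2"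
    by (simp add: cn_power2 norm_ofc_mult norm_mult power_mult_distrib) (simp add: power2_eq_square)
  then show ?thesis by simp
qed

lemma cn_scaleR: "0 \<le> r \<Longrightarrow> cn n (\<lambda>k. r *\<^sub>R v k) = r * cn n v"
  using cn_ofc[of n "of_real r" v] by (simp add: ofc_of_real scaleR_conv_of_real)

lemma cn_zero: "cn n v = 0 \<Longrightarrow> k < n \<Longrightarrow> v k = 0"
  using norm_le_cn[of k n v] by simp

lemma cn_zero_vec [simp]: "cn n (\<lambda>_. 0) = 0"
  by (simp add: cn_def ip_def)

lemma mv_scaleR: "mv n X (\<lambda>k. r *\<^sub>R v k) = (\<lambda>i. r *\<^sub>R mv n X v i)"
  by (auto simp: mv_def scaleR_sum_right)

lemma mv_mmul: "mv n (mmul n X Y) v i = mv n X (mv n Y v) i"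
  unfolding mv_def mmul_def sum_distrib_left sum_distrib_right
  by (subst sum.swap) (simp add: mult.assoc)

lemma ip_mv: "ip n (mv n X u) v = ip n u (mv n (madj X) v)"
  unfolding ip_def mv_def madj_def adj_sum sum_distrib_left sum_distrib_right
  by (subst sum.swap) (simp add: adj_mult mult.assoc)

lemma cn_mv_le: "cn n (mv n X v) \<le> (\<Sum>i<n. \<Sum>k<n. norm (X i k)) * cn n v"
proof -
  have "cn n (mv n X v) \<le> (\<Sum>i<n. norm (mv n X v i))"
    by (rule cn_le_sum)
  also have "\<dots> \<le> (\<Sum>i<n. \<Sum>k<n. norm (X i k) * cn n v)"
    unfolding mv_def
    by (intro sum_mono sum_norm_le order_trans[OF norm_mult_ineq] mult_left_mono norm_le_cn) auto
  finally show ?thesis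
    by (simp add: sum_distrib_right)
qed

lemma opn_bdd: "bdd_above {cn n (mv n X v) | v. cn n v \<le> 1}"
proof (rule bdd_aboveI, clarify)
  fix v :: "nat \<Rightarrow> 'a" assume "cn n v \<le> 1"
  then show "cn n (mv n X v) \<le> (\<Sum>i<n. \<Sum>k<n. norm (X i k))"
    by (intro order_trans[OF cn_mv_le] mult_left_le sum_nonneg) auto
qed

lemma opn_ge_0: "0 \<le> opn n X"
proof -
  have "cn n (mv n X (\<lambda>_. 0)) \<le> opn n X"
    unfolding opn_def by (intro cSup_upper opn_bdd) (auto intro!: exI[of _ "\<lambda>_. 0"])
  then show ?thesis
    using cn_ge_0 order_trans by blast
qed

lemma opn_bound: "cn n (mv n X v) \<le> opn n X * cn n v"
proof (cases "cn n v = 0")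
  case True
  then show ?thesis
    using cn_mv_le[of n X v] by simp
next
  case False
  then have pos: "cn n v > 0" using cn_ge_0[of n v] by linarith
  let ?w = "\<lambda>k. (1 / cn n v) *\<^sub>R v k"
  have "cn n ?w = 1"
    using pos by (subst cn_scaleR) auto
  then have "cn n (mv n X ?w) \<le> opn n X"
    unfolding opn_def by (intro cSup_upper opn_bdd) auto
  moreover have "cn n (mv n X ?w) = (1 / cn n v) * cn n (mv n X v)"
    unfolding mv_scaleR using pos by (subst cn_scaleR) auto
  ultimately show ?thesis
    using pos by (simp add: field_simps)
qed

lemma opn_least:
  assumes "\<And>v. cn n v \<le> 1 \<Longrightarrow> cn n (mv n X v) \<le> K"
  shows "opn n X \<le> K"
  unfolding opn_def using assms by (intro cSup_least) (auto intro!: exI[of _ "\<lambda>_. 0"])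

lemma opn_le_sum: "opn n X \<le> (\<Sum>i<n. \<Sum>k<n. norm (X i k))"
  by (rule opn_least) (intro order_trans[OF cn_mv_le] mult_left_le sum_nonneg, auto)

text \<open>Test on the standard column \<open>j\<close>. With \<open>opn_le_sum\<close> this makes
  convergence in operator norm the same as convergence of all entries.\<close>

lemma norm_entry_le_opn:
  assumes "i < n" "j < n"
  shows "norm (X i j) \<le> opn n X"
proof -
  let ?v = "\<lambda>k. if k = j then 1 else 0 :: 'a"
  have "ip n ?v ?v = 1"
    using assms by (simp add: ip_def if_distrib if_distribR cong: if_cong)
  then have v: "cn n ?v = 1" by (simp add: cn_def)
  have "mv n X ?v i = X i j"
    using assms by (simp add: mv_def if_distrib if_distribR cong: if_cong)
  then have "norm (X i j) \<le> cn n (mv n X ?v)"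
    using norm_le_cn[OF assms(1), of "mv n X ?v"] by simp
  also have "\<dots> \<le> opn n X"
    using opn_bound[of n X ?v] v by simp
  finally show ?thesis .
qed

lemma opn_cong:
  assumes "\<And>i j. i < n \<Longrightarrow> j < n \<Longrightarrow> X i j = Y i j"
  shows "opn n X = opn n Y"
proof -
  have "cn n (mv n X v) = cn n (mv n Y v)" for v
    using assms by (intro cn_cong) (simp add: mv_def)
  then show ?thesis by (simp add: opn_def)
qed

lemma opn_add: "opn n (\<lambda>i j. X i j + Y i j) \<le> opn n X + opn n Y"
proof (rule opn_least)
  fix v :: "nat \<Rightarrow> 'a" assume v: "cn n v \<le> 1"
  have "mv n (\<lambda>i j. X i j + Y i j) v = (\<lambda>i. mv n X v i + mv n Y v i)"
    by (auto simp: mv_def distrib_right sum.distrib)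
  then have "cn n (mv n (\<lambda>i j. X i j + Y i j) v) \<le> cn n (mv n X v) + cn n (mv n Y v)"
    by (simp add: cn_triangle)
  also have "\<dots> \<le> opn n X + opn n Y"
    using v by (intro add_mono order_trans[OF opn_bound] mult_left_le opn_ge_0) auto
  finally show "cn n (mv n (\<lambda>i j. X i j + Y i j) v) \<le> opn n X + opn n Y" .
qed

lemma opn_ofc_le: "opn n (\<lambda>i j. ofc c * X i j) \<le> cmod c * opn n X"
proof (rule opn_least)
  fix v :: "nat \<Rightarrow> 'a" assume v: "cn n v \<le> 1"
  have "mv n (\<lambda>i j. ofc c * X i j) v = (\<lambda>i. ofc c * mv n X v i)"
    by (auto simp: mv_def sum_distrib_left mult.assoc)
  then have "cn n (mv n (\<lambda>i j. ofc c * X i j) v) = cmod c * cn n (mv n X v)"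
    by (simp add: cn_ofc)
  also have "\<dots> \<le> cmod c * opn n X"
    using v by (intro mult_left_mono order_trans[OF opn_bound] mult_left_le opn_ge_0) auto
  finally show "cn n (mv n (\<lambda>i j. ofc c * X i j) v) \<le> cmod c * opn n X" .
qed

lemma opn_ofc: "opn n (\<lambda>i j. ofc c * X i j) = cmod c * opn n X"
proof (cases "c = 0")
  case True
  then show ?thesis
    using opn_ofc_le[of n c X] opn_ge_0[of n "\<lambda>i j. ofc c * X i j"] by simp
next
  case False
  have "opn n X = opn n (\<lambda>i j. ofc (inverse c) * (ofc c * X i j))"
    using False by (simp add: mult.assoc[symmetric] flip: ofc_mult)
  also have "\<dots> \<le> cmod (inverse c) * opn n (\<lambda>i j. ofc c * X i j)"
    by (rule opn_ofc_le)
  finally have "cmod c * opn n X \<le> opn n (\<lambda>i j. ofc c * X i j)"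
    using False by (simp add: norm_divide inverse_eq_divide field_simps)
  then show ?thesis
    using opn_ofc_le[of n c X] by simp
qed

lemma opn_mmul: "opn n (mmul n X Y) \<le> opn n X * opn n Y"
proof (rule opn_least)
  fix v :: "nat \<Rightarrow> 'a" assume v: "cn n v \<le> 1"
  have "cn n (mv n (mmul n X Y) v) = cn n (mv n X (mv n Y v))"
    by (intro cn_cong mv_mmul)
  also have "\<dots> \<le> opn n X * cn n (mv n Y v)"
    by (rule opn_bound)
  also have "\<dots> \<le> opn n X * opn n Y"
    using v by (intro mult_left_mono order_trans[OF opn_bound] mult_left_le opn_ge_0) auto
  finally show "cn n (mv n (mmul n X Y) v) \<le> opn n X * opn n Y" .
qed

lemma madj_madj [simp]: "madj (madj X) = X"
  by (simp add: madj_def fun_eq_iff)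

text \<open>Moving one factor across the inner product turns the square of
  \<open>cn n (mv n X v)\<close> into \<open>ip n v\<close> of the column \<open>madj X\<close>
  times \<open>X\<close> times \<open>v\<close>, to which Cauchy-Schwarz applies.\<close>

lemma opn_power2_le: "(opn n X)\<^sup>2 \<le> opn n (mmul n (madj X) X)"
proof -
  let ?Y = "mmul n (madj X) X"
  have "opn n X \<le> sqrt (opn n ?Y)"
  proof (rule opn_least)
    fix v :: "nat \<Rightarrow> 'a" assume v: "cn n v \<le> 1"
    have "(cn n (mv n X v))\<^sup>2 = norm (ip n v (mv n (madj X) (mv n X v)))"
      by (simp add: cn_power2 ip_mv)
    also have "\<dots> \<le> cn n v * cn n (mv n (madj X) (mv n X v))"
      by (rule Cauchy_Schwarz_ip)
    also have "cn n (mv n (madj X) (mv n X v)) = cn n (mv n ?Y v)"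
      by (intro cn_cong mv_mmul[symmetric])
    also have "cn n v * cn n (mv n ?Y v) \<le> 1 * opn n ?Y"
      using v by (intro mult_mono order_trans[OF opn_bound] mult_left_le opn_ge_0) auto
    finally show "cn n (mv n X v) \<le> sqrt (opn n ?Y)"
      by (simp add: real_le_rsqrt)
  qed
  then have "(opn n X)\<^sup>2 \<le> (sqrt (opn n ?Y))\<^sup>2"
    by (intro power_mono opn_ge_0)
  then show ?thesis by (simp add: opn_ge_0)
qed

lemma opn_le_opn_madj: "opn n X \<le> opn n (madj X)"
proof (cases "opn n X = 0")
  case False
  then have "opn n X > 0" using opn_ge_0[of n X] by linarith
  moreover have "opn n X * opn n X \<le> opn n (madj X) * opn n X"
    using opn_power2_le[of n X] opn_mmul[of n "madj X" X] by (simp add: power2_eq_square)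
  ultimately show ?thesis by simp
qed (simp add: opn_ge_0)

lemma opn_cstar: "opn n (mmul n (madj X) X) = (opn n X)\<^sup>2"
proof (rule antisym[OF _ opn_power2_le])
  have "opn n (mmul n (madj X) X) \<le> opn n (madj X) * opn n X"
    by (rule opn_mmul)
  also have "opn n (madj X) = opn n X"
    using opn_le_opn_madj[of n X] opn_le_opn_madj[of n "madj X"] by simp
  finally show "opn n (mmul n (madj X) X) \<le> (opn n X)\<^sup>2"
    by (simp add: power2_eq_square)
qed

subsection \<open>The C*-algebra of matrices\<close>

lemma mats_over_iff:
  "X \<in> mats_over n k S \<longleftrightarrow> dim_row X = n \<and> dim_col X = k \<and> (\<forall>i<n. \<forall>j<k. X $$ (i, j) \<in> S)"
proof (cases "X \<in> carrier_mat n k")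
  case True
  then have "elements_mat X = {X $$ (i, j) | i j. i < n \<and> j < k}"
    using elements_matI[OF True] by (auto dest!: elements_matD)
  then show ?thesis
    using True by (auto simp: mats_over_def)
qed (auto simp: mats_over_def)

lemma mat_in_mats_over: "(\<And>i j. i < n \<Longrightarrow> j < k \<Longrightarrow> f (i, j) \<in> S) \<Longrightarrow> mat n k f \<in> mats_over n k S"
  by (simp add: mats_over_iff)

context unital_cstar_algebra
begin

text \<open>Entries are viewed in the product, where ordinary ring arithmetic and finite sums are
  available; \<open>mats_eqI\<close> returns from entries to matrices.\<close>

definition E :: "'a mat \<Rightarrow> nat \<Rightarrow> nat \<Rightarrow> 'a cprod" where
  "E X i j = iota A (X $$ (i, j))"

definition mat_of :: "nat \<Rightarrow> (nat \<Rightarrow> nat \<Rightarrow> 'a cprod) \<Rightarrow> 'a mat" where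
  "mat_of n F = mat n n (\<lambda>(i, j). ev A (F i j))"

lemma E_p [simp]:
  assumes "X \<in> mats_over n k (carrier A)" "i < n" "j < k"
  shows "iota A \<one> * E X i j = E X i j" "E X i j * iota A \<one> = E X i j"
  using assms by (simp_all add: E_def mats_over_iff)

lemma mats_eqI:
  assumes "X \<in> mats_over n k (carrier A)" "Y \<in> mats_over n k (carrier A)"
    and "\<And>i j. i < n \<Longrightarrow> j < k \<Longrightarrow> E X i j = E Y i j"
  shows "X = Y"
  using assms by (intro eq_matI) (auto simp: mats_over_iff E_def iota_inj)

lemma mat_of_closed [simp]: "mat_of n F \<in> mats_over n n (carrier A)"
  by (simp add: mat_of_def mat_in_mats_over)

lemma E_mat_of: "i < n \<Longrightarrow> j < n \<Longrightarrow> E (mat_of n F) i j = iota A \<one> * F i j"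
  by (simp add: E_def mat_of_def iota_ev)

lemma mat_times_closed:
  assumes "X \<in> mats_over n m (carrier A)" "Y \<in> mats_over m k (carrier A)"
  shows "mat_times A X Y \<in> mats_over n k (carrier A)"
  using assms by (auto simp: mats_over_iff mat_times_def intro!: finsum_closed)

lemma E_times:
  assumes "X \<in> mats_over n m (carrier A)" "Y \<in> mats_over m k (carrier A)" "i < n" "j < k"
  shows "E (mat_times A X Y) i j = (\<Sum>l<m. E X i l * E Y l j)"
proof -
  have "X $$ (i, l) \<in> carrier A" "Y $$ (l, j) \<in> carrier A" if "l < m" for l
    using assms that by (auto simp: mats_over_iff)
  then have "iota A (\<Oplus>l\<in>{..<m}. X $$ (i, l) \<otimes> Y $$ (l, j)) = (\<Sum>l<m. E X i l * E Y l j)"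
    by (subst iota_finsum) (auto simp: iota_mult E_def)
  then show ?thesis
    using assms by (simp add: mats_over_iff mat_times_def E_def)
qed

lemma mat_star_closed: "X \<in> mats_over n k (carrier A) \<Longrightarrow> mat_star A X \<in> mats_over k n (carrier A)"
  by (simp add: mats_over_iff mat_star_def star_closed)

lemma E_star:
  assumes "X \<in> mats_over n k (carrier A)" "i < k" "j < n"
  shows "E (mat_star A X) i j = adj (E X j i)"
  using assms by (simp add: mats_over_iff mat_star_def E_def iota_star)

lemma column_norm_eq:
  assumes "v \<in> mats_over n 1 (carrier A)"
  shows "column_norm A v = cn n (\<lambda>k. E v k 0)"
proof -
  let ?w = "mat_times A (mat_star A v) v"
  have w: "?w \<in> mats_over 1 1 (carrier A)"
    by (rule mat_times_closed[OF mat_star_closed[OF assms] assms])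
  then have "nrm A (?w $$ (0, 0)) = norm (E ?w 0 0)"
    by (simp add: E_def mats_over_iff)
  also have "E ?w 0 0 = ip n (\<lambda>k. E v k 0) (\<lambda>k. E v k 0)"
    using E_times[OF mat_star_closed[OF assms] assms, of 0 0] E_star[OF assms, of 0] by (simp add: ip_def)
  finally show ?thesis
    by (simp add: column_norm_def cn_def)
qed

text \<open>The left side takes columns over \<open>A\<close>, the right side columns over the whole
  product. Cutting a column to the factor \<open>A\<close> does not increase its norm and does not
  change its image under \<open>E X\<close>, so the larger supply of columns gives the same
  supremum.\<close>

lemma mat_norm_eq:
  assumes X: "X \<in> mats_over n n (carrier A)"
  shows "mat_norm A n X = opn n (E X)"
proof -
  have "{column_norm A (mat_times A X v) | v. v \<in> mats_over n 1 (carrier A) \<and> column_norm A v \<le> 1}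
      = {cn n (mv n (E X) v) | v. cn n v \<le> 1}" (is "?L = ?R")
  proof (intro antisym subsetI)
    have eq: "column_norm A (mat_times A X v) = cn n (mv n (E X) (\<lambda>k. E v k 0))"
      if "v \<in> mats_over n 1 (carrier A)" for v
      using X that by (subst column_norm_eq[OF mat_times_closed]) (auto intro!: cn_cong simp: E_times mv_def)
    fix r
    show "r \<in> ?R" if "r \<in> ?L"
      using that eq column_norm_eq by auto
    assume "r \<in> ?R"
    then obtain w where w: "r = cn n (mv n (E X) w)" "cn n w \<le> 1" by blast
    let ?p = "iota A \<one>"
    define v where "v = mat n 1 (\<lambda>(k, j). ev A (w k))"
    have v: "v \<in> mats_over n 1 (carrier A)"
      by (simp add: v_def mat_in_mats_over)
    have Ev: "E v k 0 = ?p * w k" if "k < n" for k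
      using that by (simp add: E_def v_def iota_ev)
    have "ip n (\<lambda>k. E v k 0) (\<lambda>k. E v k 0) = ip n (\<lambda>k. ?p * w k) (\<lambda>k. ?p * w k)"
      by (intro ip_cong Ev)
    also have "\<dots> = ?p * ip n w w"
    proof -
      have "adj (?p * x) * (?p * x) = ?p * (adj x * x)" for x
      proof -
        have "adj (?p * x) * (?p * x) = adj x * (?p * ?p * x)"
          by (simp only: adj_mult adj_iota_one mult.assoc)
        also have "?p * ?p = ?p" by simp
        finally show ?thesis
          by (metis iota_one_commute mult.assoc)
      qed
      then show ?thesis by (simp add: ip_def sum_distrib_left)
    qed
    finally have "norm (ip n (\<lambda>k. E v k 0) (\<lambda>k. E v k 0)) \<le> norm ?p * norm (ip n w w)"
      by (simp only: norm_mult_ineq)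
    also have "\<dots> \<le> norm (ip n w w)"
      using nrm_one_le by (simp add: mult_left_le_one_le)
    finally have "cn n (\<lambda>k. E v k 0) \<le> cn n w"
      by (simp add: cn_def)
    moreover have "mv n (E X) (\<lambda>k. E v k 0) i = mv n (E X) w i" if "i < n" for i
    proof -
      have "E X i k * E v k 0 = E X i k * w k" if "k < n" for k
        using X \<open>i < n\<close> that by (simp add: Ev mult.assoc[symmetric])
      then show ?thesis by (simp add: mv_def)
    qed
    then have "r = column_norm A (mat_times A X v)"
      unfolding w(1) eq[OF v] by (intro cn_cong) simp
    ultimately show "r \<in> ?L"
      using v w(2) column_norm_eq[OF v] by auto
  qed
  then show ?thesis
    by (simp add: mat_norm_def opn_def)
qed

lemma matrix_algebra_simps:
  "carrier (matrix_algebra n A) = mats_over n n (carrier A)"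
  "X \<otimes>\<^bsub>matrix_algebra n A\<^esub> Y = mat_times A X Y"
  "X \<oplus>\<^bsub>matrix_algebra n A\<^esub> Y = mat n n (\<lambda>(i, j). X $$ (i, j) \<oplus> Y $$ (i, j))"
  "\<one>\<^bsub>matrix_algebra n A\<^esub> = mat n n (\<lambda>(i, j). if i = j then \<one> else \<zero>)"
  "\<zero>\<^bsub>matrix_algebra n A\<^esub> = mat n n (\<lambda>_. \<zero>)"
  "c \<odot>\<^bsub>matrix_algebra n A\<^esub> X = mat n n (\<lambda>(i, j). c \<odot> X $$ (i, j))"
  "star (matrix_algebra n A) X = mat_star A X"
  "nrm (matrix_algebra n A) X = mat_norm A n X"
  by (simp_all add: matrix_algebra_def)

section \<open>The C*-algebra axioms for matrices, checked on entries\<close>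

context
  fixes n :: nat and M :: "'a mat star_alg"
  defines "M \<equiv> matrix_algebra n A"
begin

lemma carrier_M: "carrier M = mats_over n n (carrier A)"
  by (simp add: M_def matrix_algebra_simps)

lemma M_closed:
  "X \<in> carrier M \<Longrightarrow> Y \<in> carrier M \<Longrightarrow> X \<oplus>\<^bsub>M\<^esub> Y \<in> carrier M"
  "X \<in> carrier M \<Longrightarrow> Y \<in> carrier M \<Longrightarrow> X \<otimes>\<^bsub>M\<^esub> Y \<in> carrier M"
  "\<one>\<^bsub>M\<^esub> \<in> carrier M" "\<zero>\<^bsub>M\<^esub> \<in> carrier M"
  "X \<in> carrier M \<Longrightarrow> c \<odot>\<^bsub>M\<^esub> X \<in> carrier M"
  "X \<in> carrier M \<Longrightarrow> star M X \<in> carrier M"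
  using mat_times_closed[of X n n Y n] mat_star_closed[of X n n]
  by (auto simp: M_def matrix_algebra_simps mats_over_iff)

lemma E_M:
  assumes "i < n" "j < n"
  shows "X \<in> carrier M \<Longrightarrow> Y \<in> carrier M \<Longrightarrow> E (X \<oplus>\<^bsub>M\<^esub> Y) i j = E X i j + E Y i j"
    "X \<in> carrier M \<Longrightarrow> Y \<in> carrier M \<Longrightarrow> E (X \<otimes>\<^bsub>M\<^esub> Y) i j = mmul n (E X) (E Y) i j"
    "E \<one>\<^bsub>M\<^esub> i j = (if i = j then iota A \<one> else 0)" "E \<zero>\<^bsub>M\<^esub> i j = 0"
    "X \<in> carrier M \<Longrightarrow> E (c \<odot>\<^bsub>M\<^esub> X) i j = ofc c * E X i j"
    "X \<in> carrier M \<Longrightarrow> E (star M X) i j = madj (E X) i j"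
  using assms E_times[of X n n Y n i j] E_star[of X n n i j]
  by (auto simp: M_def matrix_algebra_simps mats_over_iff E_def iota_add iota_smult mmul_def madj_def)

lemma M_eqI:
  assumes "X \<in> carrier M" "Y \<in> carrier M" "\<And>i j. i < n \<Longrightarrow> j < n \<Longrightarrow> E X i j = E Y i j"
  shows "X = Y"
  using mats_eqI[of X n n Y] assms by (simp add: carrier_M)

lemma M_p [simp]:
  assumes "X \<in> carrier M" "i < n" "j < n"
  shows "iota A \<one> * E X i j = E X i j" "E X i j * iota A \<one> = E X i j"
  using E_p[of X n n i j] assms by (simp_all add: carrier_M)

lemma nrm_M: "X \<in> carrier M \<Longrightarrow> nrm M X = opn n (E X)"
  using mat_norm_eq by (simp add: M_def matrix_algebra_simps)

lemma ring_M: "ring M"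
proof (rule ringI)
  show "abelian_group M"
  proof (rule abelian_groupI)
    fix X assume X: "X \<in> carrier M"
    let ?Y = "mat_of n (\<lambda>i j. - E X i j)"
    have "?Y \<in> carrier M" by (simp add: carrier_M)
    moreover from this have "?Y \<oplus>\<^bsub>M\<^esub> X = \<zero>\<^bsub>M\<^esub>"
      using X by (intro M_eqI M_closed) (simp_all add: E_M E_mat_of)
    ultimately show "\<exists>Y\<in>carrier M. Y \<oplus>\<^bsub>M\<^esub> X = \<zero>\<^bsub>M\<^esub>" by blast
  qed (auto intro!: M_closed M_eqI simp: E_M M_closed algebra_simps)
  show "monoid M"
  proof (rule monoidI)
    fix X Y Z assume XYZ: "X \<in> carrier M" "Y \<in> carrier M" "Z \<in> carrier M"
    show "X \<otimes>\<^bsub>M\<^esub> Y \<otimes>\<^bsub>M\<^esub> Z = X \<otimes>\<^bsub>M\<^esub> (Y \<otimes>\<^bsub>M\<^esub> Z)"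
    proof (intro M_eqI M_closed XYZ)
      fix i j assume ij: "i < n" "j < n"
      have "mmul n (mmul n (E X) (E Y)) (E Z) i j = mmul n (E X) (mmul n (E Y) (E Z)) i j"
        unfolding mmul_def sum_distrib_left sum_distrib_right
        by (subst sum.swap) (simp add: mult.assoc)
      moreover have "E (X \<otimes>\<^bsub>M\<^esub> Y \<otimes>\<^bsub>M\<^esub> Z) i j = mmul n (mmul n (E X) (E Y)) (E Z) i j"
        using ij XYZ by (simp add: E_M M_closed mmul_def)
      moreover have "E (X \<otimes>\<^bsub>M\<^esub> (Y \<otimes>\<^bsub>M\<^esub> Z)) i j = mmul n (E X) (mmul n (E Y) (E Z)) i j"
        using ij XYZ by (simp add: E_M M_closed mmul_def)
      ultimately show "E (X \<otimes>\<^bsub>M\<^esub> Y \<otimes>\<^bsub>M\<^esub> Z) i j = E (X \<otimes>\<^bsub>M\<^esub> (Y \<otimes>\<^bsub>M\<^esub> Z)) i j" by simp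
    qed
  next
    fix X assume X: "X \<in> carrier M"
    have if1: "(\<Sum>k<n. (if i = k then iota A \<one> else 0) * E X k j) = E X i j" if "i < n" "j < n" for i j
      using X that by (simp add: if_distribR if_distrib[of "\<lambda>x. x * _"] sum.delta' cong: if_cong)
    have if2: "(\<Sum>k<n. E X i k * (if k = j then iota A \<one> else 0)) = E X i j" if "i < n" "j < n" for i j
      using X that by (simp add: if_distrib[of "\<lambda>x. _ * x"] sum.delta cong: if_cong)
    show "\<one>\<^bsub>M\<^esub> \<otimes>\<^bsub>M\<^esub> X = X" "X \<otimes>\<^bsub>M\<^esub> \<one>\<^bsub>M\<^esub> = X"
      using X if1 if2 by (auto intro!: M_eqI M_closed simp: E_M M_closed mmul_def)
  qed (auto intro: M_closed)
  fix X Y Z assume XYZ: "X \<in> carrier M" "Y \<in> carrier M" "Z \<in> carrier M"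
  show "(X \<oplus>\<^bsub>M\<^esub> Y) \<otimes>\<^bsub>M\<^esub> Z = X \<otimes>\<^bsub>M\<^esub> Z \<oplus>\<^bsub>M\<^esub> Y \<otimes>\<^bsub>M\<^esub> Z"
    "Z \<otimes>\<^bsub>M\<^esub> (X \<oplus>\<^bsub>M\<^esub> Y) = Z \<otimes>\<^bsub>M\<^esub> X \<oplus>\<^bsub>M\<^esub> Z \<otimes>\<^bsub>M\<^esub> Y"
    using XYZ by (auto intro!: M_eqI M_closed simp: E_M M_closed mmul_def algebra_simps sum.distrib)
qed

lemma E_M_minus:
  assumes "X \<in> carrier M" "Y \<in> carrier M" "i < n" "j < n"
  shows "E (X \<ominus>\<^bsub>M\<^esub> Y) i j = E X i j - E Y i j"
proof -
  interpret M: ring M by (rule ring_M)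
  have "(X \<ominus>\<^bsub>M\<^esub> Y) \<oplus>\<^bsub>M\<^esub> Y = X"
    using assms by (simp add: M.minus_eq M.a_assoc M.l_neg)
  then have "E (X \<ominus>\<^bsub>M\<^esub> Y) i j + E Y i j = E X i j"
    using E_M(1)[of i j "X \<ominus>\<^bsub>M\<^esub> Y" Y] assms by simp
  then show ?thesis by (simp add: eq_diff_eq)
qed

lemma norm_dist_M:
  assumes "X \<in> carrier M" "Y \<in> carrier M"
  shows "norm_dist M X Y = opn n (\<lambda>i j. E X i j - E Y i j)"
proof -
  interpret M: ring M by (rule ring_M)
  show ?thesis
    using assms by (auto simp: norm_dist_def nrm_M intro!: opn_cong E_M_minus)
qed

lemma opn_minus: "opn n (\<lambda>i j. - X i j) = opn n (X :: nat \<Rightarrow> nat \<Rightarrow> 'b::cstar)"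
  using opn_ofc[of n "- 1" X] by (simp add: ofc_minus)

lemma Metric_space_M: "Metric_space (carrier M) (norm_dist M)"
proof
  interpret M: ring M by (rule ring_M)
  fix X Y Z
  show "0 \<le> norm_dist M X Y"
    by (cases "X \<in> carrier M \<and> Y \<in> carrier M") (auto simp: norm_dist_M opn_ge_0, auto simp: norm_dist_def)
  show "norm_dist M X Y = norm_dist M Y X"
    using opn_minus[of "\<lambda>i j. E X i j - E Y i j"]
    by (cases "X \<in> carrier M \<and> Y \<in> carrier M") (auto simp: norm_dist_M, auto simp: norm_dist_def)
  assume X: "X \<in> carrier M" and Y: "Y \<in> carrier M"
  have "X = Y" if "norm_dist M X Y = 0"
    using that norm_entry_le_opn[of _ n _ "\<lambda>i j. E X i j - E Y i j"] X Y
    by (intro M_eqI) (auto simp: norm_dist_M)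
  moreover have "norm_dist M X X = 0"
    using X opn_le_sum[of n "\<lambda>i j. 0 :: 'a cprod"] opn_ge_0[of n "\<lambda>i j. 0 :: 'a cprod"] by (simp add: norm_dist_M)
  ultimately show "norm_dist M X Y = 0 \<longleftrightarrow> X = Y" by blast
  assume Z: "Z \<in> carrier M"
  show "norm_dist M X Z \<le> norm_dist M X Y + norm_dist M Y Z"
    using X Y Z opn_add[of n "\<lambda>i j. E X i j - E Y i j" "\<lambda>i j. E Y i j - E Z i j"] by (simp add: norm_dist_M)
qed

lemma mcomplete_M: "Metric_space.mcomplete (carrier M) (norm_dist M)"
proof -
  interpret MS: Metric_space "carrier M" "norm_dist M" by (rule Metric_space_M)
  show ?thesis
    unfolding MS.mcomplete_def
  proof (intro allI impI)
    fix \<sigma> assume \<sigma>: "MS.MCauchy \<sigma>"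
    then have \<sigma>c: "\<sigma> m \<in> carrier M" for m
      by (auto simp: MS.MCauchy_def)
    have "\<exists>l. (\<lambda>m. E (\<sigma> m) i j) \<longlonglongrightarrow> l" if ij: "i < n" "j < n" for i j
    proof -
      have "Cauchy (\<lambda>m. E (\<sigma> m) i j)"
        unfolding Cauchy_iff
      proof (intro allI impI)
        fix e :: real assume "e > 0"
        then obtain N where "\<And>m m'. m \<ge> N \<Longrightarrow> m' \<ge> N \<Longrightarrow> norm_dist M (\<sigma> m) (\<sigma> m') < e"
          using \<sigma> unfolding MS.MCauchy_def by blast
        then have "norm (E (\<sigma> m) i j - E (\<sigma> m') i j) < e" if "m \<ge> N" "m' \<ge> N" for m m'
          using norm_entry_le_opn[OF ij, of "\<lambda>i j. E (\<sigma> m) i j - E (\<sigma> m') i j"] that \<sigma>c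
          by (fastforce simp: norm_dist_M)
        then show "\<exists>N. \<forall>m\<ge>N. \<forall>m'\<ge>N. norm (E (\<sigma> m) i j - E (\<sigma> m') i j) < e"
          by blast
      qed
      then show ?thesis
        by (simp add: Cauchy_convergent_iff convergent_def)
    qed
    then obtain L where L: "\<And>i j. i < n \<Longrightarrow> j < n \<Longrightarrow> (\<lambda>m. E (\<sigma> m) i j) \<longlonglongrightarrow> L i j"
      by metis
    define X where "X = mat_of n L"
    have X: "X \<in> carrier M" by (simp add: X_def carrier_M)
    have EX: "E X i j = L i j" if "i < n" "j < n" for i j
      using iota_limit[OF _ L[OF that, unfolded E_def]] \<sigma>c that
      by (simp add: X_def E_mat_of carrier_M mats_over_iff iota_ev)
    have "(\<lambda>m. \<Sum>i<n. \<Sum>j<n. norm (E (\<sigma> m) i j - L i j)) \<longlonglongrightarrow> (\<Sum>i<n. \<Sum>j<n. 0)"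
      by (intro tendsto_sum tendsto_norm_zero LIM_zero L) auto
    then have lim: "(\<lambda>m. \<Sum>i<n. \<Sum>j<n. norm (E (\<sigma> m) i j - L i j)) \<longlonglongrightarrow> 0" by simp
    have le: "norm_dist M (\<sigma> m) X \<le> (\<Sum>i<n. \<Sum>j<n. norm (E (\<sigma> m) i j - L i j))" for m
      using opn_le_sum[of n "\<lambda>i j. E (\<sigma> m) i j - E X i j"] \<sigma>c X EX by (simp add: norm_dist_M)
    have "\<exists>N. \<forall>m\<ge>N. \<sigma> m \<in> carrier M \<and> norm_dist M (\<sigma> m) X < e" if e: "e > 0" for e
    proof -
      have "\<forall>\<^sub>F m in sequentially. (\<Sum>i<n. \<Sum>j<n. norm (E (\<sigma> m) i j - L i j)) < e"
        using lim e by (rule order_tendstoD)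
      then have "\<forall>\<^sub>F m in sequentially. norm_dist M (\<sigma> m) X < e"
        by eventually_elim (use le le_less_trans in blast)
      then show ?thesis
        using \<sigma>c by (auto simp: eventually_sequentially)
    qed
    then show "\<exists>x. limitin MS.mtopology \<sigma> x sequentially"
      using X by (intro exI[of _ X]) (simp add: MS.limit_metric_sequentially)
  qed
qed

lemma matrix_algebra_cstar: "unital_cstar_algebra M"
proof (intro unital_cstar_algebra.intro unital_cstar_algebra_axioms.intro)
  interpret M: ring M by (rule ring_M)
  show "ring M" by (rule ring_M)
  show "Module.module complex_ring M"
  proof (rule moduleI)
    show "cring complex_ring"
      using module.axioms(1)[OF complex_module] .
    show "abelian_group M" ..
  qed (auto simp: complex_ring_def M_closed E_M ofc_add ofc_mult algebra_simps intro!: M_eqI)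
  show "Metric_space.mcomplete (carrier M) (norm_dist M)" by (rule mcomplete_M)
next
  fix X Y c assume X: "X \<in> carrier M"
  show "star M X \<in> carrier M" using X by (rule M_closed)
  show "star M (star M X) = X"
    using X by (intro M_eqI) (auto simp: M_closed E_M madj_def)
  show "star M (c \<odot>\<^bsub>M\<^esub> X) = cnj c \<odot>\<^bsub>M\<^esub> star M X"
    using X by (intro M_eqI M_closed) (auto simp: M_closed E_M madj_def adj_mult adj_ofc ofc_commute[of _ "adj _"])
  show "nrm M X = 0 \<longleftrightarrow> X = \<zero>\<^bsub>M\<^esub>"
  proof
    assume "nrm M X = 0"
    then show "X = \<zero>\<^bsub>M\<^esub>"
      using X norm_entry_le_opn[of _ n _ "E X"] by (intro M_eqI) (auto simp: nrm_M M_closed E_M)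
  next
    assume "X = \<zero>\<^bsub>M\<^esub>"
    then have "opn n (E X) = opn n (\<lambda>i j. 0 :: 'a cprod)"
      by (intro opn_cong) (simp add: E_M)
    then show "nrm M X = 0"
      using X opn_le_sum[of n "\<lambda>i j. 0 :: 'a cprod"] opn_ge_0[of n "E X"] by (simp add: nrm_M)
  qed
  have "opn n (E (c \<odot>\<^bsub>M\<^esub> X)) = opn n (\<lambda>i j. ofc c * E X i j)"
    using X by (intro opn_cong) (simp add: E_M)
  then show "nrm M (c \<odot>\<^bsub>M\<^esub> X) = cmod c * nrm M X"
    using X by (simp add: nrm_M M_closed opn_ofc)
  have "opn n (E (star M X \<otimes>\<^bsub>M\<^esub> X)) = opn n (mmul n (madj (E X)) (E X))"
    using X by (intro opn_cong) (simp add: E_M M_closed mmul_def)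
  then show "nrm M (star M X \<otimes>\<^bsub>M\<^esub> X) = (nrm M X)\<^sup>2"
    using X by (simp add: nrm_M M_closed opn_cstar)
  assume Y: "Y \<in> carrier M"
  show "(c \<odot>\<^bsub>M\<^esub> X) \<otimes>\<^bsub>M\<^esub> Y = c \<odot>\<^bsub>M\<^esub> (X \<otimes>\<^bsub>M\<^esub> Y)"
    using X Y by (intro M_eqI M_closed) (auto simp: M_closed E_M mmul_def sum_distrib_left mult.assoc)
  show "X \<otimes>\<^bsub>M\<^esub> (c \<odot>\<^bsub>M\<^esub> Y) = c \<odot>\<^bsub>M\<^esub> (X \<otimes>\<^bsub>M\<^esub> Y)"
    using X Y by (intro M_eqI M_closed) (auto simp: M_closed E_M mmul_def sum_distrib_left ofc_left_commute[of "E X _ _"])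
  show "star M (X \<oplus>\<^bsub>M\<^esub> Y) = star M X \<oplus>\<^bsub>M\<^esub> star M Y"
    using X Y by (intro M_eqI M_closed) (auto simp: M_closed E_M madj_def adj_add)
  show "star M (X \<otimes>\<^bsub>M\<^esub> Y) = star M Y \<otimes>\<^bsub>M\<^esub> star M X"
    using X Y by (intro M_eqI M_closed) (auto simp: M_closed E_M madj_def mmul_def adj_sum adj_mult)
  have "opn n (E (X \<oplus>\<^bsub>M\<^esub> Y)) = opn n (\<lambda>i j. E X i j + E Y i j)"
    using X Y by (intro opn_cong) (simp add: E_M)
  then show "nrm M (X \<oplus>\<^bsub>M\<^esub> Y) \<le> nrm M X + nrm M Y"
    using X Y by (simp add: nrm_M M_closed opn_add)
  have "opn n (E (X \<otimes>\<^bsub>M\<^esub> Y)) = opn n (mmul n (E X) (E Y))"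
    using X Y by (intro opn_cong) (simp add: E_M)
  then show "nrm M (X \<otimes>\<^bsub>M\<^esub> Y) \<le> nrm M X * nrm M Y"
    using X Y by (simp add: nrm_M M_closed opn_mmul)
qed

end

end

section \<open>Orthogonal copies and finiteness in a corner\<close>

text \<open>Writing a function of \<open>h\<close> as \<open>h\<close> times something shows that
  its value stays in the corner of \<open>h\<close>, and that whatever acts as a left unit on
  \<open>h\<close> does so on the value.\<close>

lemma cfc_cmult_nonzero_factor:
  assumes h: "adj h = h" and f: "continuous_on (rspec h) f" and g: "continuous_on (rspec h) g"
    and eq: "\<And>t. t \<in> rspec h \<Longrightarrow> g t = t * f t"
  shows "cfc h g = h * cfc h f"
proof -
  have "cfc h g = cfc h (\<lambda>t. t * f t)"
    by (rule cfc_cong[OF h eq])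
  also have "\<dots> = h * cfc h f"
    using cfc_mult[OF h continuous_on_id f] by (simp add: cfc_id[OF h])
  finally show ?thesis .
qed

lemma cfc_square:
  assumes h: "adj h = h" and f: "continuous_on (rspec h) f" and g: "continuous_on (rspec h) g"
    and eq: "\<And>t. t \<in> rspec h \<Longrightarrow> g t = f t * f t"
  shows "cfc h g = cfc h f * cfc h f"
  using cfc_cong[OF h eq] cfc_mult[OF h f f] by simp

lemma cfc_sandwich:
  assumes h: "adj h = h" and f: "continuous_on (rspec h) f" and g: "continuous_on (rspec h) g"
    and eq: "\<And>t. t \<in> rspec h \<Longrightarrow> g t = f t * t * f t"
  shows "cfc h g = cfc h f * h * cfc h f"
proof -
  have "cfc h g = cfc h (\<lambda>t. (f t * t) * f t)"
    by (rule cfc_cong[OF h eq])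
  also have "\<dots> = cfc h (\<lambda>t. f t * t) * cfc h f"
    by (intro cfc_mult[OF h] continuous_intros f)
  also have "cfc h (\<lambda>t. f t * t) = cfc h f * h"
    using cfc_mult[OF h f continuous_on_id] by (simp add: cfc_id[OF h])
  finally show ?thesis .
qed

text \<open>Two tent functions of radius half the distance between \<open>t1\<close> and
  \<open>t2\<close> have no common support. The factor \<open>t\<close> on either side puts their
  values into the form \<open>h * d * h\<close>.\<close>

lemma bump_split:
  fixes h :: "'a::cstar"
  assumes h: "adj h = h" and t: "t1 \<in> rspec h" "t2 \<in> rspec h" "t1 \<noteq> t2" "t1 \<noteq> 0" "t2 \<noteq> 0"
  obtains d e where "cpos (h * d * h)" "cpos (h * e * h)" "h * d * h \<noteq> 0" "h * e * h \<noteq> 0"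
    "(h * d * h) * (h * e * h) = 0"
proof -
  define r where "r = \<bar>t1 - t2\<bar> / 2"
  have r: "r > 0" using t by (simp add: r_def)
  let ?k = "\<lambda>s t. max 0 (r - \<bar>t - s\<bar>)"
  let ?f = "\<lambda>s t. t * ?k s t * t"
  have cont: "continuous_on S (?k s)" "continuous_on S (?f s)" for s S
    by (intro continuous_intros)+
  have eq: "cfc h (?f s) = h * cfc h (?k s) * h" for s
  proof -
    have "cfc h (?f s) = cfc h (\<lambda>t. t * ?k s t) * cfc h (\<lambda>t. t)"
      by (intro cfc_mult[OF h] continuous_intros)
    then show ?thesis
      using cfc_mult[OF h continuous_on_id cont(1)[of _ s]] by (simp add: cfc_id[OF h])
  qed
  have pos: "cpos (cfc h (?f s))" for s
  proof (rule cpos_cfc[OF h cont(2)])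
    fix t
    have "?f s t = (t * t) * ?k s t" by (simp only: mult_ac)
    also have "\<dots> \<ge> 0" by (rule mult_nonneg_nonneg) auto
    finally show "0 \<le> ?f s t" .
  qed
  have nz: "cfc h (?f s) \<noteq> 0" if "s \<in> rspec h" "s \<noteq> 0" for s
    using cfc_nonzero[OF h cont(2) that(1), of s] that r by simp
  have "cfc h (?f t1) * cfc h (?f t2) = cfc h (\<lambda>t. ?f t1 t * ?f t2 t)"
    by (rule cfc_mult[OF h cont(2) cont(2), symmetric])
  also have "\<dots> = 0"
  proof (rule cfc_zero[OF h])
    fix t
    have "r \<le> \<bar>t - t1\<bar> \<or> r \<le> \<bar>t - t2\<bar>"
      using abs_triangle_ineq4[of "t - t2" "t - t1"] by (auto simp: r_def)
    then have "?k t1 t = 0 \<or> ?k t2 t = 0"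
      by auto
    then show "?f t1 t * ?f t2 t = 0" by auto
  qed (intro continuous_intros)
  finally show ?thesis
    using that[of "cfc h (?k t1)" "cfc h (?k t2)"] pos nz t unfolding eq by blast
qed

lemma quadratic_if_rspec:
  assumes h: "adj h = h" and l: "\<And>t. t \<in> rspec h \<Longrightarrow> t = 0 \<or> t = l"
  shows "h * h = l *\<^sub>R h"
proof -
  have "cfc h (\<lambda>t. t * t - l * t) = h * h - l *\<^sub>R h"
    by (subst cfc_diff[OF h])
       (auto simp: cfc_mult[OF h] cfc_const[OF h] cfc_id[OF h] continuous_on_id scaleR_conv_of_real
         intro!: continuous_intros)
  moreover have "cfc h (\<lambda>t. t * t - l * t) = 0"
    using l by (intro cfc_zero[OF h] continuous_intros) auto
  ultimately show ?thesis by simp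
qed

text \<open>
  A C*-algebra \<open>A\<close> with carrier set sits in \<^typ>\<open>'a cprod\<close> as the corner \<open>p T\<close> cut out by a
  central projection \<open>p\<close>; \<open>full\<close> below is what simplicity of \<open>A\<close> amounts to.
\<close>

locale corner =
  fixes p :: "'a::cstar"
  assumes adj_p [simp]: "adj p = p"
    and p_p [simp]: "p * p = p"
    and p_commute: "p * x = x * p"
begin

lemma p_right: "p * x = x \<Longrightarrow> x * p = x"
  using p_commute[of x] by simp

lemma p_adj: "p * x = x \<Longrightarrow> p * adj x = adj x"
  by (metis adj_mult adj_p p_commute)

lemma p_mult: "p * x = x \<Longrightarrow> p * (x * y) = x * y"
  by (simp flip: mult.assoc)

lemma cpos_p: "cpos p"
  using cpos_adj_mult[of p] by simp

lemma cpos_1_minus_p: "cpos (1 - p)"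
  using cpos_adj_mult[of "1 - p"] by (simp add: adj_diff algebra_simps)

lemma p_psqrt:
  assumes "cpos y" "p * y = y"
  shows "p * psqrt y = psqrt y"
proof -
  let ?s = "psqrt y"
  have s: "adj ?s = ?s" "?s * ?s = y"
    using assms by (simp_all add: adj_psqrt psqrt_mult)
  have yp: "y * p = y" by (rule p_right[OF assms(2)])
  have "adj ((1 - p) * ?s) * ((1 - p) * ?s) = ?s * ((1 - p) * (1 - p)) * ?s"
    by (simp only: adj_mult s(1) adj_diff adj_1 adj_p mult.assoc)
  also have "(1 - p) * (1 - p) = 1 - p"
    by (simp add: algebra_simps)
  also have "?s * (1 - p) * ?s = ?s * ?s - ?s * ?s * p"
    by (simp add: algebra_simps p_commute[of ?s])
  finally have "(1 - p) * ?s = 0"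
    using s(2) yp by (metis adj_mult_eq_0_iff diff_self)
  then show ?thesis by (simp add: algebra_simps)
qed

section \<open>Fullness, minimal projections and orthogonal copies\<close>

definition full :: bool where
  "full \<longleftrightarrow> (\<forall>b. p * b = b \<and> cpos b \<and> b \<noteq> 0 \<longrightarrow>
     (\<exists>(k::nat) t. (\<forall>i<k. p * t i = t i) \<and> (\<Sum>i<k. t i * b * adj (t i)) = p))"

definition minimal_projection :: "'a \<Rightarrow> bool" where
  "minimal_projection q \<longleftrightarrow> q \<noteq> 0 \<and> adj q = q \<and> q * q = q \<and> p * q = q \<and>
     (\<forall>x. p * x = x \<longrightarrow> (\<exists>l. q * x * q = ofc l * q))"

text \<open>Fullness writes \<open>p\<close> as a sum of conjugates of \<open>c * adj c\<close>. If
  all \<open>b * r * c\<close> vanished, each summand would be killed by \<open>b\<close>, and so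
  \<open>b = b * p = 0\<close>.\<close>

lemma prime:
  assumes full "p * b = b" "p * c = c" "b \<noteq> 0" "c \<noteq> 0"
  shows "\<exists>r. b * r * c \<noteq> 0"
proof (rule ccontr)
  assume "\<not> ?thesis"
  then have 0: "b * r * c = 0" for r by blast
  have "p * (c * adj c) = c * adj c" "cpos (c * adj c)" "c * adj c \<noteq> 0"
    using assms by (simp_all add: p_mult cpos_mult_adj)
  then obtain k :: nat and t where t: "(\<Sum>i<k. t i * (c * adj c) * adj (t i)) = p"
    using \<open>full\<close> unfolding full_def by blast
  have "b * (t i * (c * adj c) * adj (t i)) = 0" for i
    using 0[of "t i"] by (simp flip: mult.assoc)
  then have "b * (\<Sum>i<k. t i * (c * adj c) * adj (t i)) = 0"
    by (simp add: sum_distrib_left)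
  then have "b * p = 0" unfolding t .
  then show False
    using assms(2,4) p_right by auto
qed

text \<open>
  If \<open>c T c\<close> has no two orthogonal nonzero positive elements, then each of its self-adjoint elements has at
  most one nonzero spectral value, and a multiple of \<open>c\<^sup>2\<close> is a minimal projection.
\<close>

lemma orthogonal_split:
  assumes nomin: "\<nexists>q. minimal_projection q" and c: "p * c = c" "cpos c" "c \<noteq> 0"
  shows "\<exists>d e. cpos (c * d * c) \<and> cpos (c * e * c) \<and> c * d * c \<noteq> 0 \<and> c * e * c \<noteq> 0 \<and>
     (c * d * c) * (c * e * c) = 0"
proof (rule ccontr)
  assume no: "\<not> ?thesis"
  have ac: "adj c = c" using c by (simp add: cpos_def)
  \<comment> \<open>Two distinct nonzero spectral values of \<open>h\<close> would give orthogonal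
    bumps of the form \<open>h * x * h\<close>, which is again of the form
    \<open>c * y * c\<close>.\<close>
  have quad: "\<exists>l. l \<noteq> 0 \<and> h * h = l *\<^sub>R h" if h: "adj h = h" "h = c * z * c" "h \<noteq> 0" for h z
  proof -
    obtain l where l: "l \<in> rspec h" "\<bar>l\<bar> = norm h"
      using rspec_attained[OF h(1)] .
    have two: "t = 0 \<or> t = l" if t: "t \<in> rspec h" for t
    proof (rule ccontr)
      assume "\<not> (t = 0 \<or> t = l)"
      then obtain d e where "cpos (h * d * h)" "cpos (h * e * h)" "h * d * h \<noteq> 0" "h * e * h \<noteq> 0"
        "(h * d * h) * (h * e * h) = 0"
        using bump_split[OF h(1) t l(1)] h(3) l(2) by (metis abs_zero norm_eq_zero)
      moreover have "h * x * h = c * (z * c * x * c * z) * c" for x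
        by (simp add: h(2) mult.assoc)
      ultimately show False using no by metis
    qed
    from quadratic_if_rspec[OF h(1) two] show ?thesis
      using l h(3) by (intro exI[of _ l]) auto
  qed
  have cc: "c * c \<noteq> 0"
    using adj_mult_eq_0_iff[of c, unfolded ac] c(3) by (simp only:) simp
  have "adj (c * c) = c * c" "c * c = c * 1 * c"
    by (simp_all add: adj_mult ac)
  then obtain l where l: "l \<noteq> 0" "(c * c) * (c * c) = l *\<^sub>R (c * c)"
    using quad[OF _ _ cc] by blast
  define q where "q = (1 / l) *\<^sub>R (c * c)"
  have q: "q \<noteq> 0" "adj q = q" "q * q = q" "p * q = q"
    using cc l c by (auto simp: q_def adj_scaleR adj_mult ac p_mult)
  have qq: "q * x * q = c * ((1 / (l * l)) *\<^sub>R (c * x * c)) * c" for x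
    by (simp add: q_def mult.assoc)
  \<comment> \<open>A nonzero self-adjoint compression of \<open>q\<close> is a multiple of a
    projection \<open>r\<close> below \<open>q\<close>. If \<open>r\<close> were proper,
    \<open>r\<close> and \<open>q - r\<close> would be an orthogonal pair.\<close>
  have sa: "\<exists>m. q * x * q = m *\<^sub>R q" if x: "adj x = x" for x
  proof (cases "q * x * q = 0")
    case True
    then show ?thesis by (intro exI[of _ 0]) simp
  next
    case False
    let ?y = "q * x * q"
    have ay: "adj ?y = ?y" by (simp add: adj_mult x q mult.assoc)
    obtain m where m: "m \<noteq> 0" "?y * ?y = m *\<^sub>R ?y"
      using quad[OF ay qq False] by blast
    define r where "r = (1 / m) *\<^sub>R ?y"
    have r: "adj r = r" "r * r = r" "r \<noteq> 0"
      using m False ay by (auto simp: r_def adj_scaleR)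
    have rq: "r * q = r" "q * r = r"
      using q(3) by (simp_all add: r_def mult.assoc) (simp_all flip: mult.assoc)
    have "r = q"
    proof (rule ccontr)
      assume "r \<noteq> q"
      have qr: "(q - r) * (q - r) = q - r" "adj (q - r) = q - r"
        using q r rq by (simp_all add: algebra_simps adj_diff)
      have "cpos r" "cpos (q - r)"
        using cpos_adj_mult[of r] cpos_adj_mult[of "q - r"] r qr by simp_all
      moreover have "r * (q - r) = 0"
        using r rq by (simp add: algebra_simps)
      moreover have "r = c * ((1 / m) *\<^sub>R ((1 / (l * l)) *\<^sub>R (c * x * c))) * c"
        unfolding r_def qq by (simp add: mult.assoc)
      moreover have "q - r = c * ((1 / l) *\<^sub>R 1 - (1 / m) *\<^sub>R ((1 / (l * l)) *\<^sub>R (c * x * c))) * c"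
        unfolding r_def qq by (simp add: q_def algebra_simps)
      ultimately show False
        using no r(3) \<open>r \<noteq> q\<close> by (metis eq_iff_diff_eq_0)
    qed
    moreover have "?y = m *\<^sub>R r"
      using m by (simp add: r_def)
    ultimately show ?thesis by metis
  qed
  have "\<exists>m. q * x * q = ofc m * q" for x
  proof -
    \<comment> \<open>Real and imaginary part: \<open>x = x1 + ofc \<i> * x2\<close>, which reduces
      the claim to self-adjoint \<open>x\<close>.\<close>
    define x1 x2 where "x1 = (1/2) *\<^sub>R (x + adj x)" and "x2 = (1/2) *\<^sub>R (ofc \<i> * (adj x - x))"
    have "adj (ofc \<i> * w) = - (ofc \<i> * adj w)" for w :: 'a
      by (simp add: adj_mult adj_ofc ofc_minus ofc_commute[of \<i> "adj w"])
    then have "adj x2 = x2"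
      by (simp add: x2_def adj_scaleR adj_diff right_diff_distrib)
    moreover have "adj x1 = x1"
      by (simp add: x1_def adj_scaleR adj_add add.commute)
    ultimately obtain m1 m2 where m: "q * x1 * q = m1 *\<^sub>R q" "q * x2 * q = m2 *\<^sub>R q"
      using sa by blast
    have ii: "ofc \<i> * (ofc \<i> * w) = - w" for w :: 'a
      by (simp add: mult.assoc[symmetric] ofc_minus flip: ofc_mult)
    have "ofc \<i> * x2 = (1/2) *\<^sub>R (x - adj x)"
      by (simp add: x2_def ii)
    moreover have "(x + adj x) + (x - adj x) = 2 *\<^sub>R x"
      by (simp add: scaleR_2)
    ultimately have "x = x1 + ofc \<i> * x2"
      by (simp add: x1_def flip: scaleR_add_right)
    then have "q * x * q = q * x1 * q + ofc \<i> * (q * x2 * q)"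
      by (simp add: distrib_left distrib_right ofc_left_commute[of q] mult.assoc)
    also have "\<dots> = ofc (of_real m1 + \<i> * of_real m2) * q"
      unfolding m by (simp add: ofc_add ofc_mult ofc_of_real distrib_right scaleR_conv_of_real mult.assoc)
    finally show ?thesis by blast
  qed
  then have "minimal_projection q"
    using q by (simp add: minimal_projection_def)
  then show False using nomin by blast
qed

text \<open>Split \<open>c\<close> into an orthogonal pair, keep the first element and continue
  inside the second. The factorization \<open>f i = c * d i * c\<close> is carried along because
  \<open>orthogonal_copies\<close> needs the \<open>f i\<close> as elements made from the square
  root of \<open>y\<close>.\<close>

lemma orthogonal_family:
  assumes nomin: "\<nexists>q. minimal_projection q"
  shows "p * c = c \<Longrightarrow> cpos c \<Longrightarrow> c \<noteq> 0 \<Longrightarrow>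
    \<exists>f d. \<forall>i<N::nat. f i = c * d i * c \<and> cpos (f i) \<and> f i \<noteq> 0 \<and> (\<forall>j<N. j \<noteq> i \<longrightarrow> f i * f j = 0)"
proof (induction N arbitrary: c)
  case (Suc N)
  obtain d e where de: "cpos (c * d * c)" "cpos (c * e * c)" "c * d * c \<noteq> 0" "c * e * c \<noteq> 0"
    "(c * d * c) * (c * e * c) = 0"
    using orthogonal_split[OF nomin Suc.prems] by blast
  let ?a = "c * d * c" and ?b = "c * e * c"
  have "p * ?b = ?b"
    using p_mult[OF p_mult[OF Suc.prems(1)], of e c] by simp
  then obtain f d' where f: "\<And>i. i < N \<Longrightarrow> f i = ?b * d' i * ?b \<and> cpos (f i) \<and> f i \<noteq> 0 \<and> (\<forall>j<N. j \<noteq> i \<longrightarrow> f i * f j = 0)"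
    using Suc.IH[OF _ de(2,4)] by blast
  have ba: "?b * ?a = 0"
    using de(5) adj_mult[of ?a ?b] cpos_adj[OF de(1)] cpos_adj[OF de(2)] by simp
  have af: "?a * f i = 0" "f i * ?a = 0" if "i < N" for i
  proof -
    have "?a * f i = (?a * ?b) * (d' i * ?b)" "f i * ?a = ?b * d' i * (?b * ?a)"
      using f[OF that] by (simp_all add: mult.assoc)
    then show "?a * f i = 0" "f i * ?a = 0"
      unfolding de(5) ba by simp_all
  qed
  define F D where "F = (\<lambda>i. case i of 0 \<Rightarrow> ?a | Suc i \<Rightarrow> f i)"
    and "D = (\<lambda>i. case i of 0 \<Rightarrow> d | Suc i \<Rightarrow> e * c * d' i * c * e)"
  have "F i = c * D i * c \<and> cpos (F i) \<and> F i \<noteq> 0 \<and> (\<forall>j<Suc N. j \<noteq> i \<longrightarrow> F i * F j = 0)" if "i < Suc N" for i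
  proof (cases i)
    case 0
    then show ?thesis
      using de af by (auto simp: F_def D_def split: nat.split)
  next
    case (Suc m)
    then have m: "m < N" using that by simp
    have "f m = c * (e * c * d' m * c * e) * c"
      using f[OF m] by (simp add: mult.assoc)
    moreover have "cpos (f m)" "f m \<noteq> 0" "\<And>j. j < N \<Longrightarrow> j \<noteq> m \<Longrightarrow> f m * f j = 0"
      using f[OF m] by blast+
    moreover have "F j = ?a \<or> (\<exists>j'. j = Suc j' \<and> F j = f j')" for j
      by (auto simp: F_def split: nat.split)
    ultimately show ?thesis
      using af(2)[OF m] unfolding Suc
      by (auto simp only: F_def D_def nat.case) (metis Suc_less_eq nat.case old.nat.exhaust)
  qed
  then show ?case by blast
qed simp

text \<open>All \<open>c i * w i\<close> have the same source \<open>e\<close>. For one more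
  \<open>c n\<close>, primeness leads from \<open>c n\<close> to \<open>a\<close>, giving a nonzero
  \<open>v = c n * q * a\<close> with \<open>h = adj v * v\<close>; since \<open>e * a = a\<close>,
  \<open>e\<close> is a unit for \<open>h\<close>. Shrinking to functions of \<open>h\<close> then
  works for old and new elements alike: the old \<open>w i\<close> are multiplied by the root of the
  cut-off of \<open>h\<close>, and \<open>v\<close> is rescaled to the same source. The element
  \<open>a\<close> keeps room for the next step, as an element on which the source acts as a
  unit.\<close>

lemma common_source:
  fixes n N :: nat
  assumes full: full and "p \<noteq> 0"
    and c: "\<And>i. i < N \<Longrightarrow> p * c i = c i \<and> c i \<noteq> 0 \<and> adj (c i) = c i"
  shows "n \<le> N \<Longrightarrow> \<exists>w e a. (\<forall>i<n. adj (c i * w i) * (c i * w i) = e) \<and> e * a = a \<and> a \<noteq> 0 \<and>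
    adj a = a \<and> p * a = a \<and> p * e = e \<and> cpos e"
proof (induction n)
  case 0
  show ?case
    using assms(2) by (intro exI[of _ "\<lambda>_. 0"] exI[of _ p]) (auto simp: cpos_p)
next
  case (Suc n)
  then obtain w e a where IH: "\<And>i. i < n \<Longrightarrow> adj (c i * w i) * (c i * w i) = e" "e * a = a" "a \<noteq> 0"
    "adj a = a" "p * a = a" "p * e = e" "cpos e" by (metis Suc_leD)
  have cn: "p * c n = c n" "c n \<noteq> 0" "adj (c n) = c n" using c Suc.prems by auto
  obtain q where q: "c n * q * a \<noteq> 0"
    using prime[OF full cn(1) IH(5) cn(2) IH(3)] by blast
  define v where "v = c n * q * a"
  define h where "h = adj v * v"
  have "v \<noteq> 0" using q by (simp add: v_def)
  then have h: "adj h = h" "cpos h" "h \<noteq> 0"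
    unfolding h_def by (simp_all add: adj_mult cpos_adj_mult)
  have eh: "e * h = h" and ph: "p * h = h"
  proof -
    have "h = a * (adj q * c n * v)"
      by (simp add: h_def v_def adj_mult cn IH mult.assoc)
    then show "e * h = h" "p * h = h"
      using IH(2,5) by (metis mult.assoc)+
  qed
  define M where "M = norm h"
  have M: "M > 0" using h by (simp add: M_def)
  have Mr: "M \<in> rspec h"
    using rspec_attained[OF h(1)] h(2) by (metis M_def abs_of_nonneg cpos_def)
  \<comment> \<open>\<open>?\<phi>\<close> is 0 up to \<open>M / 3\<close> and 1 from
    \<open>2 * M / 3\<close> on, while \<open>?\<psi>\<close> lives only above
    \<open>2 * M / 3\<close>; hence \<open>?\<phi> * ?\<psi> = ?\<psi>\<close>, and
    \<open>?\<psi>\<close> is nonzero at the spectral value \<open>M\<close>. The function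
    \<open>?m\<close> stands for \<open>t\<close> in denominators: it never vanishes and equals
    \<open>t\<close> wherever \<open>?\<phi>\<close> is nonzero.\<close>
  let ?\<phi> = "\<lambda>t. min 1 (max 0 ((3 * t - M) / M))"
  let ?m = "\<lambda>t. max t (M / 3)"
  let ?s = "\<lambda>t. sqrt (?\<phi> t)"
  let ?\<rho> = "\<lambda>t. sqrt (?\<phi> t) / ?m t"
  let ?\<kappa> = "\<lambda>t. sqrt (?\<phi> t / ?m t)"
  let ?\<psi> = "\<lambda>t. max 0 (t - 2 * M / 3)"
  have m: "?m t > 0" for t using M by (simp add: less_max_iff_disj)
  then have m': "?m t \<noteq> 0" for t by (metis less_irrefl)
  have cont: "continuous_on S ?\<phi>" "continuous_on S ?s" "continuous_on S ?\<rho>" "continuous_on S ?\<kappa>" "continuous_on S ?\<psi>" for S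
    using m' by (auto intro!: continuous_intros simp: M[THEN less_imp_neq, symmetric])
  have \<phi>0: "?\<phi> t \<ge> 0" for t by simp
  have \<phi>m: "?\<phi> t = 0 \<or> ?m t = t" for t
    using M by (auto simp: max_def min_def field_simps)
  \<comment> \<open>The factor \<open>h\<close> in front lets \<open>e\<close> act as a unit, so the
    old sources \<open>e\<close> become the cut-off itself.\<close>
  have s\<rho>: "cfc h ?s = h * cfc h ?\<rho>"
  proof (rule cfc_cmult_nonzero_factor[OF h(1) cont(3) cont(2)])
    show "?s t = t * ?\<rho> t" for t using \<phi>m[of t] m'[of t] by auto
  qed
  have es: "e * cfc h ?s = cfc h ?s" and ps: "p * cfc h ?s = cfc h ?s"
    unfolding s\<rho> by (simp_all only: mult.assoc[symmetric] eh ph)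
  have ss: "cfc h ?\<phi> = cfc h ?s * cfc h ?s"
    by (rule cfc_square[OF h(1) cont(2) cont(1)]) (simp only: real_sqrt_mult_self abs_of_nonneg[OF \<phi>0])
  have kk: "cfc h ?\<phi> = cfc h ?\<kappa> * h * cfc h ?\<kappa>"
  proof (rule cfc_sandwich[OF h(1) cont(4) cont(1)])
    fix t
    have "?\<kappa> t * ?\<kappa> t = ?\<phi> t / ?m t"
      using \<phi>0[of t] m[of t] by (simp only: real_sqrt_mult_self abs_of_nonneg divide_nonneg_pos)
    moreover have "a * t * a = (a * a) * t" for a :: real by simp
    ultimately have "?\<kappa> t * t * ?\<kappa> t = ?\<phi> t / ?m t * t"
      by (simp only:)
    also have "\<dots> = ?\<phi> t"
      using \<phi>m[of t]
    proof
      assume "?m t = t"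
      with m'[of t] show ?thesis by simp
    qed simp
    finally show "?\<phi> t = ?\<kappa> t * t * ?\<kappa> t" ..
  qed
  let ?w = "\<lambda>i. if i < n then w i * cfc h ?s else q * a * cfc h ?\<kappa>"
  have w': "adj (c i * ?w i) * (c i * ?w i) = cfc h ?\<phi>" if "i < Suc n" for i
  proof (cases "i < n")
    case True
    have "adj (c i * ?w i) * (c i * ?w i) = cfc h ?s * (adj (c i * w i) * (c i * w i)) * cfc h ?s"
      using True by (simp add: adj_mult adj_cfc[OF h(1) cont(2)] mult.assoc)
    then show ?thesis
      using IH(1)[OF True] es ss by (simp add: mult.assoc)
  next
    case False
    then have "i = n" using that by simp
    then have eqv: "c i * ?w i = v * cfc h ?\<kappa>"
      by (simp add: v_def mult.assoc)
    have vx: "adj (v * x) * (v * x) = x * h * x" if "adj x = x" for x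
      using that by (simp add: adj_mult h_def mult.assoc)
    show ?thesis
      by (simp only: eqv vx[OF adj_cfc[OF h(1) cont(4)]] kk)
  qed
  have ea: "cfc h ?\<phi> * cfc h ?\<psi> = cfc h ?\<psi>"
  proof -
    have "?\<phi> t * ?\<psi> t = ?\<psi> t" for t
      using M by (auto simp: max_def min_def field_simps)
    then have "cfc h (\<lambda>t. ?\<phi> t * ?\<psi> t) = cfc h ?\<psi>"
      by (rule cfc_cong[OF h(1)])
    then show ?thesis
      by (rule trans[OF cfc_mult[OF h(1) cont(1) cont(5), symmetric]])
  qed
  have a0: "cfc h ?\<psi> \<noteq> 0"
    using M by (intro cfc_nonzero[OF h(1) cont(5) Mr]) simp
  have pe: "p * cfc h ?\<phi> = cfc h ?\<phi>"
    unfolding ss by (rule p_mult[OF ps])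
  have pa: "p * cfc h ?\<psi> = cfc h ?\<psi>"
    using p_mult[OF pe, of "cfc h ?\<psi>"] unfolding ea .
  show ?case
  proof (rule exI[of _ ?w], rule exI[of _ "cfc h ?\<phi>"], rule exI[of _ "cfc h ?\<psi>"], intro conjI allI impI)
    show "cpos (cfc h ?\<phi>)"
      by (intro cpos_cfc[OF h(1) cont(1)]) simp
  qed (fact w' ea a0 adj_cfc[OF h(1) cont(5)] pa pe)+
qed

text \<open>Let \<open>s\<close> be the square root of \<open>y\<close> and take the orthogonal
  family as \<open>f i = s * d i * s\<close>. With \<open>V i\<close> built from
  \<open>adj (d i * s * w i)\<close>, one has \<open>s * adj (V j) = f j * w j\<close>, so the
  product with \<open>y\<close> in the middle is \<open>adj (f i * w i) * (f j * w j)\<close>: the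
  common source on the diagonal, 0 off it.\<close>

lemma orthogonal_copies:
  assumes full: full and nomin: "\<nexists>q. minimal_projection q" and y: "p * y = y" "cpos y" "y \<noteq> 0"
  shows "\<exists>V e. (\<forall>i<N::nat. p * V i = V i) \<and> e \<noteq> 0 \<and> cpos e \<and> p * e = e \<and>
    (\<forall>i<N. \<forall>j<N. V i * y * adj (V j) = (if i = j then e else 0))"
proof -
  let ?s = "psqrt y"
  have s: "p * ?s = ?s" "cpos ?s" "?s \<noteq> 0" "?s * ?s = y" "adj ?s = ?s"
    using p_psqrt[OF y(2,1)] cpos_psqrt[OF y(2)] psqrt_mult[OF y(2)] y(3) adj_psqrt[OF y(2)] by auto
  have p0: "p \<noteq> 0" using y by auto
  obtain f d where fd: "\<And>i. i < N \<Longrightarrow> f i = ?s * d i * ?s \<and> cpos (f i) \<and> f i \<noteq> 0 \<and> (\<forall>j<N. j \<noteq> i \<longrightarrow> f i * f j = 0)"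
    using orthogonal_family[OF nomin s(1,2,3), of N] by blast
  have pf: "p * f i = f i" if "i < N" for i
    using fd[OF that] p_mult[OF p_mult[OF s(1)], of "d i" ?s] by simp
  obtain w e a where we: "\<And>i. i < N \<Longrightarrow> adj (f i * w i) * (f i * w i) = e" "e * a = a" "a \<noteq> 0" "p * e = e" "cpos e"
  proof -
    have "p * f i = f i \<and> f i \<noteq> 0 \<and> adj (f i) = f i" if "i < N" for i
      using fd[OF that] pf[OF that] by (auto simp only: cpos_adj)
    from common_source[OF full p0, where N = N and n = N and c = f, OF this] that show ?thesis
      by blast
  qed
  define V where "V i = p * adj (d i * ?s * w i)" for i
  have sV: "?s * adj (V j) = f j * w j" if "j < N" for j
  proof -
    let ?z = "d j * ?s * w j"
    have "adj (V j) = p * ?z"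
      unfolding V_def p_commute[of ?z] adj_mult[of p "adj ?z"] by simp
    then have "?s * adj (V j) = (?s * p) * ?z"
      by (simp only: mult.assoc)
    also have "?s * p = ?s" by (rule p_right[OF s(1)])
    finally show ?thesis
      using fd[OF that] by (simp add: mult.assoc)
  qed
  have "V i * y * adj (V j) = (if i = j then e else 0)" if ij: "i < N" "j < N" for i j
  proof -
    have "adj (?s * adj (V i)) * (?s * adj (V j)) = V i * (?s * ?s) * adj (V j)"
      by (simp only: adj_mult adj_adj s(5) mult.assoc)
    then have "V i * y * adj (V j) = adj (?s * adj (V i)) * (?s * adj (V j))"
      by (simp only: s(4))
    also have "\<dots> = adj (f i * w i) * (f j * w j)"
      using ij by (simp add: sV)
    also have "\<dots> = (if i = j then e else 0)"
    proof (cases "i = j")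
      case False
      have "adj (f i) = f i"
        using fd[OF ij(1)] cpos_adj by blast
      then have "adj (f i * w i) * (f j * w j) = adj (w i) * (f i * f j) * w j"
        by (simp add: adj_mult mult.assoc)
      also have "f i * f j = 0" using fd[OF ij(1)] ij False by auto
      finally show ?thesis using False by simp
    qed (use we(1) ij in simp)
    finally show ?thesis .
  qed
  moreover have "p * V i = V i" for i
    by (simp add: V_def flip: mult.assoc)
  moreover have "e \<noteq> 0" using we by auto
  ultimately show ?thesis
    using we by (intro exI[of _ V] exI[of _ e]) auto
qed

end

section \<open>Finiteness of the corner and the lower norm bound\<close>

lemma cle_diff_mono: "x \<preceq> y \<Longrightarrow> z - y \<preceq> z - x"
  by (simp add: cle_def)

lemma cle_of_norm_diff:
  assumes "adj x = x" "adj y = y" "norm (x - y) \<le> r"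
  shows "x \<preceq> y + of_real r"
  using cle_of_real_norm[of "x - y" r] assms by (simp add: cle_def adj_diff algebra_simps)

context corner
begin

definition finite_corner :: bool where
  "finite_corner \<longleftrightarrow> (\<forall>s. p * s = s \<and> adj s * s = p \<longrightarrow> s * adj s = p)"

text \<open>Normalizing \<open>adj R\<close> by the inverse square root of \<open>R * adj R\<close>
  gives an isometry \<open>s\<close> of the corner. By finiteness its range is everything, so
  \<open>u = s * adj s * u\<close>; but the right side contains the factor
  \<open>R * u = 0\<close>.\<close>

lemma no_orthogonal_to_full_range:
  assumes fin: finite_corner and R: "p * R = R" "r *\<^sub>R p \<preceq> R * adj R" "r > 0"
    and u: "p * u = u" "R * u = 0"
  shows "u = 0"
proof -
  define H where "H = R * adj R + (1 - p)"
  have adjR: "p * adj R = adj R" by (rule p_adj[OF R(1)])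
  have pR: "R * p = R" by (rule p_right[OF R(1)])
  \<comment> \<open>\<open>H\<close> is at least \<open>r\<close> on the corner and at least 1 on
    its complement.\<close>
  define r' where "r' = min r 1"
  have r': "0 < r'" "r' \<le> r" "r' \<le> 1" using R by (auto simp: r'_def)
  have "cpos ((r - r') *\<^sub>R p + (1 - r') *\<^sub>R (1 - p) + (R * adj R - r *\<^sub>R p))"
    using R(2) r' by (intro cpos_add cpos_scaleR cpos_p cpos_1_minus_p) (simp_all add: cle_def)
  then have "of_real r' \<preceq> H"
    by (simp add: cle_def H_def algebra_simps of_real_def)
  moreover have "adj H = H"
    by (simp add: H_def adj_add adj_mult adj_diff)
  ultimately obtain y where y: "adj y = y" "y * H * y = 1"
    using inverse_sqrt_ex r'(1) by metis
  define s where "s = adj R * y * p"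
  have ps: "p * s = s"
    unfolding s_def by (simp add: adjR flip: mult.assoc)
  have pH: "p * H = R * adj R"
    using R(1) by (simp add: H_def algebra_simps flip: mult.assoc)
  have "adj s * s = p * y * (R * adj R) * y * p"
    by (simp add: s_def adj_mult y mult.assoc)
  also have "\<dots> = p * (y * p) * H * y * p"
    unfolding pH[symmetric] by (simp only: mult.assoc)
  also have "\<dots> = p * (p * y) * H * y * p"
    by (simp only: p_commute[of y])
  also have "\<dots> = p * (y * H * y) * p"
    by (simp add: mult.assoc[symmetric])
  also have "\<dots> = p" by (simp add: y)
  finally have "s * adj s = p"
    using fin ps by (simp add: finite_corner_def)
  moreover have "s * adj s * u = adj R * y * p * (y * (R * u))"
  proof -
    have "s * adj s * u = adj R * y * (p * p) * y * R * u"
      by (simp only: s_def adj_mult adj_adj adj_p y(1) mult.assoc)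
    then show ?thesis by (simp add: mult.assoc)
  qed
  ultimately show "u = 0"
    using u by simp
qed

text \<open>
  The norm bound of condition (5) in the definition of a large subalgebra is automatic in a finite
  simple algebra once \<open>g\<close> is dominated by an element with enough orthogonal copies: otherwise
  finitely many conjugates of \<open>g\<close> would add up to an element above \<open>p\<close>, and \<open>k\<close> of the
  \<open>k + 1\<close> copies would already fill up \<open>p\<close>.
\<close>

lemma norm_complement_sandwich:
  assumes full: full and fin: finite_corner
    and x: "cpos x" "p * x = x" "norm x = 1" and \<epsilon>: "0 < \<epsilon>" "\<epsilon> < 1"
  obtains k :: nat where "\<And>x0 u g v. \<lbrakk>\<And>i. i \<le> k \<Longrightarrow> p * u i = u i;
      \<And>i j. i \<le> k \<Longrightarrow> j \<le> k \<Longrightarrow> adj (u i) * u j = (if i = j then x0 else 0); x0 \<noteq> 0;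
      cpos g; p * g = g; g \<preceq> p; (\<lambda>n. v n * x0 * adj (v n)) \<longlonglongrightarrow> g\<rbrakk>
    \<Longrightarrow> norm ((p - g) * x * (p - g)) > 1 - \<epsilon>"
proof -
  \<comment> \<open>A level between \<open>1 - \<epsilon>\<close> and the top spectral value 1: the
    cut-down \<open>F\<close> is nonzero, and \<open>(1 - \<epsilon>) / c\<close> is below
    1.\<close>
  define c where "c = 1 - \<epsilon> / 2"
  have c: "c > 0" using \<epsilon> by (simp add: c_def)
  have xa: "adj x = x" using x(1) by (rule cpos_adj)
  let ?f = "\<lambda>t. max 0 (t - c)"
  let ?m = "\<lambda>t. max t c"
  \<comment> \<open>Chosen so that \<open>?ft t * sqrt t = ?f t\<close>, which lets a bound on
    \<open>s * (?q * ?q) * s\<close>, with \<open>s\<close> the square root of \<open>x\<close>, be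
    sandwiched into one on \<open>F * (?q * ?q) * F\<close>.\<close>
  let ?ft = "\<lambda>t. ?f t / sqrt (?m t)"
  have m0: "?m t > 0" for t using c by (simp add: less_max_iff_disj)
  then have m': "?m t \<noteq> 0" "sqrt (?m t) \<noteq> 0" for t by (metis less_irrefl real_sqrt_gt_zero)+
  have cont: "continuous_on S ?f" "continuous_on S (\<lambda>t. ?f t / ?m t)" "continuous_on S ?ft" for S
    using m' by (auto intro!: continuous_intros simp del: real_sqrt_eq_zero_cancel_iff)
  define F Ft where "F = cfc x ?f" and "Ft = cfc x ?ft"
  have Fa: "adj F = F" "adj Ft = Ft"
    unfolding F_def Ft_def by (intro adj_cfc[OF xa] cont)+
  have fm: "?f t = 0 \<or> ?m t = t" for t
    by (auto simp: max_def)
  have "F = x * cfc x (\<lambda>t. ?f t / ?m t)"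
    unfolding F_def
  proof (rule cfc_cmult_nonzero_factor[OF xa cont(2) cont(1)])
    show "?f t = t * (?f t / ?m t)" for t using fm[of t] m'[of t] by auto
  qed
  then have pF: "p * F = F"
    using x(2) by (simp flip: mult.assoc)
  have "1 \<in> rspec x"
    using rspec_attained[OF xa] x(1,3) by (metis abs_of_nonneg cpos_def)
  then have "F \<noteq> 0"
    unfolding F_def using \<epsilon> by (intro cfc_nonzero[OF xa cont(1)]) (auto simp: c_def)
  \<comment> \<open>This is the element whose conjugates sum to \<open>p\<close>; it is built from
    \<open>x\<close> and \<open>\<epsilon>\<close>, so the number \<open>k\<close> of conjugates is
    fixed before \<open>g\<close> enters.\<close>
  define b where "b = F * F"
  have b: "p * b = b" "cpos b" "b \<noteq> 0"
    using pF \<open>F \<noteq> 0\<close> Fa adj_mult_eq_0_iff[of F] cpos_adj_mult[of F] by (auto simp: b_def p_mult simp del: adj_mult_eq_0_iff)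
  then obtain k :: nat and t where t: "\<And>i. i < k \<Longrightarrow> p * t i = t i" "(\<Sum>i<k. t i * b * adj (t i)) = p"
    using full unfolding full_def by metis
  show ?thesis
  proof (rule that[of k], rule ccontr)
    fix x0 u g v
    assume u: "\<And>i. i \<le> k \<Longrightarrow> p * u i = u i"
      and uu: "\<And>i j. i \<le> k \<Longrightarrow> j \<le> k \<Longrightarrow> adj (u i) * u j = (if i = j then x0 else 0)"
      and x0: "x0 \<noteq> 0" and g: "cpos g" "p * g = g" "g \<preceq> p"
      and v: "(\<lambda>n. v n * x0 * adj (v n)) \<longlonglongrightarrow> g"
      and le: "\<not> norm ((p - g) * x * (p - g)) > 1 - \<epsilon>"
    have ga: "adj g = g" using g(1) by (rule cpos_adj)
    have gp: "g * p = g" by (rule p_right[OF g(2)])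
    define s where "s = psqrt x"
    have s: "s * s = x" "adj s = s"
      using x by (simp_all add: s_def psqrt_mult adj_psqrt)
    let ?q = "p - g"
    have qa: "adj ?q = ?q" by (simp add: adj_diff ga)
    have "norm (s * (?q * ?q) * s) = (norm (?q * s))\<^sup>2"
      using norm_adj_mult[of "?q * s"] by (simp only: adj_mult qa s(2) mult.assoc)
    also have "\<dots> = norm (?q * x * ?q)"
      using norm_mult_adj[of "?q * s"] by (simp only: adj_mult qa s(2) s(1)[symmetric] mult.assoc)
    finally have nle: "norm (s * (?q * ?q) * s) \<le> 1 - \<epsilon>" using le by simp
    have "adj (s * (?q * ?q) * s) = s * (?q * ?q) * s"
      by (simp only: adj_mult qa s(2) mult.assoc)
    from cle_of_real_norm[OF this nle] have "s * (?q * ?q) * s \<preceq> of_real (1 - \<epsilon>)" .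
    from cle_conj_mono(1)[OF this, of Ft] have 1: "(Ft * s) * (?q * ?q) * (s * Ft) \<preceq> (1 - \<epsilon>) *\<^sub>R (Ft * Ft)"
      by (simp only: Fa mult.assoc) (simp add: of_real_def)
    have sF: "Ft * s = F" "s * Ft = F"
    proof -
      have "continuous_on (rspec x) sqrt" by (intro continuous_intros)
      then have "Ft * s = cfc x (\<lambda>t. ?ft t * sqrt t)" "s * Ft = cfc x (\<lambda>t. sqrt t * ?ft t)"
        unfolding Ft_def s_def psqrt_def using cfc_mult[OF xa cont(3)] cfc_mult[OF xa _ cont(3)] by auto
      moreover have "?ft t * sqrt t = ?f t" "sqrt t * ?ft t = ?f t" for t
        using fm[of t] m'(2)[of t] by auto
      ultimately show "Ft * s = F" "s * Ft = F"
        by (simp_all add: F_def)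
    qed
    have "Ft * Ft = cfc x (\<lambda>t. ?ft t * ?ft t)" "F * F = cfc x (\<lambda>t. ?f t * ?f t)"
      unfolding Ft_def F_def by (intro cfc_mult[OF xa, symmetric] cont)+
    moreover have "cpos (cfc x (\<lambda>t. (1 / c) * (?f t * ?f t) - ?ft t * ?ft t))"
    proof (rule cpos_cfc[OF xa])
      fix t
      have "?ft t * ?ft t = (?f t * ?f t) / ?m t"
        using m0[of t] by (simp add: less_imp_le)
      also have "\<dots> \<le> (?f t * ?f t) / c"
        using c by (intro divide_left_mono) auto
      finally show "0 \<le> (1 / c) * (?f t * ?f t) - ?ft t * ?ft t" by simp
    qed (intro continuous_on_diff continuous_on_mult continuous_on_const cont)
    moreover have "cfc x (\<lambda>t. (1 / c) * (?f t * ?f t) - ?ft t * ?ft t)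
        = (1 / c) *\<^sub>R cfc x (\<lambda>t. ?f t * ?f t) - cfc x (\<lambda>t. ?ft t * ?ft t)"
      by (subst cfc_diff[OF xa])
         (intro continuous_on_mult continuous_on_const cont cfc_cmult[OF xa] arg_cong2[where f = minus] refl)+
    ultimately have 2: "Ft * Ft \<preceq> (1 / c) *\<^sub>R (F * F)"
      by (simp only: cle_def)
    have "F * (?q * ?q) * F \<preceq> (1 - \<epsilon>) *\<^sub>R (Ft * Ft)"
      using 1 by (simp only: sF)
    also have "\<dots> \<preceq> (1 - \<epsilon>) *\<^sub>R ((1 / c) *\<^sub>R (F * F))"
      using \<epsilon> by (intro cle_scaleR_mono 2) auto
    finally have 3: "F * (?q * ?q) * F \<preceq> ((1 - \<epsilon>) / c) *\<^sub>R b"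
      by (simp add: b_def)
    \<comment> \<open>If the norm bound failed, compressing by \<open>p - g\<close> would leave at
      most the proportion \<open>(1 - \<epsilon>) / c\<close> of \<open>b\<close>. The missing
      proportion \<open>d\<close> must be carried by \<open>g\<close>, since
      \<open>p - ?q * ?q\<close> is at most \<open>2 *\<^sub>R g\<close>.\<close>
    define d where "d = 1 - (1 - \<epsilon>) / c"
    have d: "d > 0" using \<epsilon> c by (simp add: d_def c_def field_simps)
    have "p - ?q * ?q = 2 *\<^sub>R g - g * g"
      by (simp add: algebra_simps g(2) gp scaleR_2)
    also have "\<dots> \<preceq> 2 *\<^sub>R g"
      using cpos_square[OF ga] by (simp add: cle_def)
    finally have "F * (p - ?q * ?q) * F \<preceq> F * (2 *\<^sub>R g) * F"
      using cle_conj_mono(1)[of _ _ F] Fa by metis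
    moreover have "F * (p - z) * F = b - F * z * F" for z
      using p_right[OF pF] by (simp add: b_def right_diff_distrib left_diff_distrib)
    moreover have "F * (2 *\<^sub>R g) * F = 2 *\<^sub>R (F * g * F)"
      by simp
    ultimately have 4: "b - F * (?q * ?q) * F \<preceq> 2 *\<^sub>R (F * g * F)"
      by (simp only:)
    have "d *\<^sub>R b = b - ((1 - \<epsilon>) / c) *\<^sub>R b"
      by (simp add: d_def scaleR_diff_left)
    also have "\<dots> \<preceq> b - F * (?q * ?q) * F"
      by (rule cle_diff_mono[OF 3])
    also note 4
    finally have "(1 / d) *\<^sub>R (d *\<^sub>R b) \<preceq> (1 / d) *\<^sub>R (2 *\<^sub>R (F * g * F))"
      using d by (intro cle_scaleR_mono) auto
    then have 5: "b \<preceq> (2 / d) *\<^sub>R (F * g * F)" using d by simp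
    define K where "K = 2 / d"
    have K: "K > 0" using d by (simp add: K_def)
    \<comment> \<open>The \<open>k\<close> conjugations that send \<open>b\<close> to
      \<open>p\<close>, applied to the bound of \<open>b\<close> by \<open>F * g * F\<close>: hence
      \<open>p \<preceq> G g\<close>.\<close>
    define G where "G z = (\<Sum>i<k. K *\<^sub>R (t i * F * z * adj (t i * F)))" for z
    have "p \<preceq> (\<Sum>i<k. t i * (K *\<^sub>R (F * g * F)) * adj (t i))"
      unfolding t(2)[symmetric] using 5 by (intro cle_sum_mono cle_conj_mono) (simp add: K_def)
    also have "\<dots> = G g"
      unfolding G_def by (intro sum.cong refl) (simp add: adj_mult Fa mult.assoc)
    finally have pG: "p \<preceq> G g" .
    have "(\<lambda>n. G (v n * x0 * adj (v n))) \<longlonglongrightarrow> G g"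
      unfolding G_def by (intro tendsto_intros v)
    \<comment> \<open>Replacing \<open>g\<close> by an approximant \<open>w * x0 * adj w\<close>
      costs less than 1/2, so half of \<open>p\<close> is still dominated.\<close>
    from tendstoD[OF this, of "1/2"]
    have "\<forall>\<^sub>F n in sequentially. norm (G (v n * x0 * adj (v n)) - G g) < 1/2"
      by (simp add: dist_norm)
    then obtain n where n: "norm (G (v n * x0 * adj (v n)) - G g) < 1/2"
      by (auto simp: eventually_sequentially)
    define w where "w = v n"
    define H where "H = G (w * x0 * adj w)"
    have x0a: "adj x0 = x0"
      using uu[of 0 0] by (metis adj_adj adj_mult le0)
    have Ga: "adj (G z) = G z" if "adj z = z" for z
      using that by (simp add: G_def adj_sum adj_scaleR adj_mult mult.assoc)
    have Ha: "adj H = H"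
      unfolding H_def by (rule Ga) (simp add: adj_mult x0a mult.assoc)
    have "norm (G g - H) \<le> 1/2"
      using n by (simp add: H_def w_def norm_minus_commute)
    then have "G g \<preceq> H + of_real (1/2)"
      by (intro cle_of_norm_diff Ha Ga ga)
    with pG have "p \<preceq> H + of_real (1/2)" by (rule cle_trans)
    from cle_conj_mono(1)[OF this, of p] have "p \<preceq> p * H * p + (1/2) *\<^sub>R p"
      by (simp add: distrib_left distrib_right) (simp add: of_real_def)
    moreover have "p * H * p = H"
    proof -
      have "p * (t i * y) = t i * y" if "i < k" for i y
        using t(1)[OF that] by (simp flip: mult.assoc)
      then have "p * H = H"
        by (simp add: H_def G_def sum_distrib_left mult.assoc)
      then show ?thesis using p_right by simp
    qed
    moreover have "H + (1/2) *\<^sub>R p - p = H - (1/2) *\<^sub>R p"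
      using scaleR_left_diff_distrib[of "1/2" 1 p] by (simp add: algebra_simps)
    ultimately have Hp: "(1/2) *\<^sub>R p \<preceq> H"
      by (simp only: cle_def)
    \<comment> \<open>Orthogonality of \<open>u 0, \<dots>, u (k - 1)\<close> removes the mixed
      terms, so \<open>R * adj R\<close> is \<open>H\<close>, while the copy \<open>u k\<close> left
      over is annihilated by \<open>R\<close>.\<close>
    define R where "R = sqrt K *\<^sub>R (\<Sum>i<k. t i * F * w * adj (u i))"
    have "(\<Sum>i<k. t i * F * w * adj (u i)) * adj (\<Sum>i<k. t i * F * w * adj (u i))
        = (\<Sum>i<k. \<Sum>j<k. t i * F * w * (adj (u i) * u j) * adj (t j * F * w))"
      unfolding adj_sum sum_distrib_left sum_distrib_right
      by (subst sum.swap) (simp add: adj_mult mult.assoc)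
    also have "\<dots> = (\<Sum>i<k. \<Sum>j<k. if i = j then t i * F * w * x0 * adj (t i * F * w) else 0)"
      by (intro sum.cong refl) (use uu in \<open>auto simp: less_imp_le\<close>)
    also have "\<dots> = (\<Sum>i<k. t i * F * w * x0 * adj (t i * F * w))"
      by simp
    finally have "R * adj R = K *\<^sub>R (\<Sum>i<k. t i * F * w * x0 * adj (t i * F * w))"
      using K by (simp add: R_def adj_scaleR)
    also have "\<dots> = H"
      unfolding H_def G_def scaleR_sum_right
      by (intro sum.cong refl arg_cong[where f = "scaleR K"]) (simp add: adj_mult mult.assoc)
    finally have RR: "R * adj R = H" .
    have pR: "p * R = R"
    proof -
      have "p * (t i * y) = t i * y" if "i < k" for i y
        using t(1)[OF that] by (simp flip: mult.assoc)
      then show ?thesis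
        by (simp add: R_def sum_distrib_left mult.assoc)
    qed
    have "R * u k = sqrt K *\<^sub>R (\<Sum>i<k. t i * F * w * (adj (u i) * u k))"
      by (simp add: R_def sum_distrib_right mult.assoc)
    also have "\<dots> = 0"
      using uu by (simp add: less_imp_le)
    finally have "u k = 0"
      using no_orthogonal_to_full_range[OF fin pR, of "1/2" "u k"] Hp u[of k] unfolding RR by simp
    then show False
      using uu[of k k] x0 by simp
  qed
qed

end

section \<open>Simple C*-algebras\<close>

sublocale unital_cstar_algebra \<subseteq> C: corner "iota A \<one>"
  by unfold_locales (simp, simp, rule iota_one_commute)

lemma ofc_sum: "ofc (sum f S) = (\<Sum>i\<in>S. ofc (f i))"
  by (induction S rule: infinite_finite_induct) (simp_all add: ofc_add)

lemma closure_translate: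
  fixes S :: "'a::real_normed_algebra set"
  assumes "x \<in> closure S" "\<And>y. y \<in> S \<Longrightarrow> f y \<in> S" "continuous_on UNIV f"
  shows "f x \<in> closure S"
proof -
  obtain X where X: "\<And>n. X n \<in> S" "X \<longlonglongrightarrow> x"
    using assms(1) by (auto simp: closure_sequential)
  have "(\<lambda>n. f (X n)) \<longlonglongrightarrow> f x"
    using continuous_on_tendsto_compose[OF assms(3) X(2)] by simp
  then show ?thesis
    unfolding closure_sequential using assms(2) X(1) by (intro exI[of _ "\<lambda>n. f (X n)"]) auto
qed

lemma closure_add_mem:
  fixes S :: "'a::real_normed_vector set"
  assumes "x \<in> closure S" "y \<in> closure S" "\<And>x y. x \<in> S \<Longrightarrow> y \<in> S \<Longrightarrow> x + y \<in> S"
  shows "x + y \<in> closure S"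
proof -
  obtain X Y where X: "\<And>n. X n \<in> S" "X \<longlonglongrightarrow> x" and Y: "\<And>n. Y n \<in> S" "Y \<longlonglongrightarrow> y"
    using assms(1,2) unfolding closure_sequential by blast
  have "(\<lambda>n. X n + Y n) \<longlonglongrightarrow> x + y"
    by (intro tendsto_intros X Y)
  then show ?thesis
    unfolding closure_sequential using assms(3) X(1) Y(1) by (intro exI[of _ "\<lambda>n. X n + Y n"]) auto
qed

text \<open>
  The bound \<open>r b s + (r b s)* \<le> r b r* + s* b s\<close> replaces the two-sided products by conjugates; the
  sum of these is then invertible in the corner.
\<close>

lemma (in corner) sum_conjugates_eq_p:
  assumes b: "cpos b" "p * b = b"
    and L: "norm ((\<Sum>(r, s)\<leftarrow>L. r * b * s) - p) < 1/2"
    and Lp: "\<And>r s. (r, s) \<in> set L \<Longrightarrow> p * r = r \<and> p * s = s"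
  shows "\<exists>(k::nat) t. (\<forall>i<k. p * t i = t i) \<and> (\<Sum>i<k. t i * b * adj (t i)) = p"
proof -
  have ab: "adj b = b" using b(1) by (rule cpos_adj)
  let ?Q = "\<lambda>T. \<Sum>t\<leftarrow>T. t * b * adj t"
  define y where "y = (\<Sum>(r, s)\<leftarrow>L. r * b * s)"
  \<comment> \<open>The conjugating elements are the left factors \<open>r\<close> together with the
    adjoints of the right factors \<open>s\<close>.\<close>
  define T where "T = map fst L @ map (\<lambda>x. adj (snd x)) L"
  have "y + adj y \<preceq> ?Q T"
    unfolding y_def T_def
  proof (induction L)
    case (Cons x L)
    obtain r s where x: "x = (r, s)" by (cases x)
    have "cpos ((r - adj s) * b * adj (r - adj s))"
      by (intro cpos_conj b)
    then have "r * b * s + adj s * b * adj r \<preceq> r * b * adj r + adj s * b * s"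
      by (simp add: cle_def adj_diff algebra_simps)
    from cle_add_mono[OF this Cons.IH] show ?case
      by (simp add: x adj_add adj_mult ab algebra_simps)
  qed simp
  moreover have "p \<preceq> y + adj y"
  proof -
    \<comment> \<open>Twice the error of less than 1/2; cutting down by \<open>p\<close> leaves
      \<open>p\<close> below \<open>y + adj y\<close>.\<close>
    have "norm (2 *\<^sub>R p - (y + adj y)) \<le> 1"
    proof -
      have "norm ((p - y) + adj (p - y)) \<le> norm (p - y) + norm (p - y)"
        using norm_triangle_ineq[of "p - y" "adj (p - y)"] by simp
      also have "\<dots> \<le> 1"
        using L by (simp add: y_def[symmetric] norm_minus_commute)
      also have "(p - y) + adj (p - y) = 2 *\<^sub>R p - (y + adj y)"
        by (simp add: adj_diff scaleR_2 algebra_simps)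
      finally show ?thesis .
    qed
    then have "2 *\<^sub>R p \<preceq> (y + adj y) + of_real 1"
      by (intro cle_of_norm_diff) (simp_all add: adj_scaleR adj_add add.commute)
    from cle_conj_mono(1)[OF this, of p] have *: "2 *\<^sub>R p \<preceq> p * (y + adj y) * p + p"
      by (simp add: distrib_left distrib_right)
    have py: "p * y = y"
      unfolding y_def using Lp
    proof (induction L)
      case (Cons x L)
      obtain r s where x: "x = (r, s)" by (cases x)
      have "p * r = r" "p * (\<Sum>(r, s)\<leftarrow>L. r * b * s) = (\<Sum>(r, s)\<leftarrow>L. r * b * s)"
        using Cons.prems[of r s] Cons.IH Cons.prems by (auto simp: x)
      then show ?case
        by (simp add: x distrib_left mult.assoc[symmetric])
    qed simp
    have "p * (y + adj y) * p = y + adj y"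
      using py p_adj[OF py] p_right[OF py] p_right[OF p_adj[OF py]] by (simp add: distrib_left distrib_right)
    with * show ?thesis
      by (simp add: cle_def scaleR_2 algebra_simps)
  qed
  ultimately have pQ: "p \<preceq> ?Q T" by (rule cle_trans[rotated])
  have Tp: "p * t = t" if "t \<in> set T" for t
    using that Lp by (force simp: T_def p_adj)
  have pQT: "p * ?Q T = ?Q T"
    using Tp by (induction T) (simp_all add: distrib_left mult.assoc[symmetric])
  have "cpos (?Q T)"
    using cpos_trans[OF cpos_p pQ] .
  \<comment> \<open>Adding \<open>1 - p\<close> makes the sum invertible in the whole algebra, so
    that its inverse square root exists; multiplication by \<open>p\<close> removes the addition
    again.\<close>
  define H where "H = ?Q T + (1 - p)"
  have H1: "of_real 1 \<preceq> H"
    using pQ by (simp add: H_def cle_def)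
  have H2: "adj H = H"
    using \<open>cpos (?Q T)\<close> by (simp add: H_def adj_add adj_diff cpos_adj)
  obtain z where z: "adj z = z" "z * H * z = 1"
    by (rule inverse_sqrt_ex[OF H2 H1]) auto
  have pH: "p * H = ?Q T"
    using pQT by (simp add: H_def algebra_simps)
  define t where "t i = p * z * (T ! i)" for i
  have "(\<Sum>i<length T. t i * b * adj (t i)) = p * z * (\<Sum>i<length T. T ! i * b * adj (T ! i)) * (z * p)"
    by (simp add: t_def adj_mult z sum_distrib_left sum_distrib_right mult.assoc)
  also have "(\<Sum>i<length T. T ! i * b * adj (T ! i)) = ?Q T"
    by (simp add: sum_list_sum_nth atLeast0LessThan)
  also have "p * z * ?Q T * (z * p) = p * (z * p) * H * z * p"
    unfolding pH[symmetric] by (simp only: mult.assoc)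
  also have "\<dots> = p * (p * z) * H * z * p"
    by (simp only: p_commute[of z])
  also have "\<dots> = (p * p) * (z * H * z) * p"
    by (simp only: mult.assoc)
  also have "\<dots> = p" by (simp add: z)
  finally have "(\<Sum>i<length T. t i * b * adj (t i)) = p" .
  moreover have "p * t i = t i" for i
    by (simp add: t_def flip: mult.assoc)
  ultimately show ?thesis by blast
qed

section \<open>Simplicity gives fullness; minimal projections force finite dimension\<close>

context unital_cstar_algebra
begin

definition min_proj :: "'a \<Rightarrow> bool" where
  "min_proj q \<longleftrightarrow> q \<in> carrier A \<and> q \<noteq> \<zero> \<and> q\<^sup>\<star> = q \<and> q \<otimes> q = q \<and>
     (\<forall>x\<in>carrier A. \<exists>l. q \<otimes> x \<otimes> q = l \<odot> q)"

text \<open>The closure of the finite sums of products \<open>r * b * s\<close> pulls back to a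
  nonzero closed ideal of \<open>A\<close>, hence to all of \<open>A\<close>. So some such sum lies
  within 1/2 of the unit, and \<open>sum_conjugates_eq_p\<close> turns it into an exact sum of
  conjugates.\<close>

lemma simple_full:
  assumes "simple_cstar A"
  shows "C.full"
  unfolding C.full_def
proof (intro allI impI, elim conjE)
  let ?p = "iota A \<one>"
  fix b assume b: "?p * b = b" "cpos b" "b \<noteq> 0"
  define J where "J = {y. \<exists>L. (\<forall>(r, s)\<in>set L. ?p * r = r \<and> ?p * s = s) \<and> y = (\<Sum>(r, s)\<leftarrow>L. r * b * s)}"
  have J0: "0 \<in> J"
    by (auto simp: J_def intro!: exI[of _ "[]"])
  have Jadd: "x + y \<in> J" if "x \<in> J" "y \<in> J" for x y
  proof -
    obtain L L' where "\<forall>(r, s)\<in>set L. ?p * r = r \<and> ?p * s = s" "x = (\<Sum>(r, s)\<leftarrow>L. r * b * s)"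
      "\<forall>(r, s)\<in>set L'. ?p * r = r \<and> ?p * s = s" "y = (\<Sum>(r, s)\<leftarrow>L'. r * b * s)"
      using \<open>x \<in> J\<close> \<open>y \<in> J\<close> unfolding J_def by blast
    then show ?thesis
      unfolding J_def by (intro CollectI exI[of _ "L @ L'"]) auto
  qed
  have Jmult: "z * y \<in> J" "y * z \<in> J" if "y \<in> J" "?p * z = z" for y z
  proof -
    obtain L where L: "\<And>r s. (r, s) \<in> set L \<Longrightarrow> ?p * r = r \<and> ?p * s = s" "y = (\<Sum>(r, s)\<leftarrow>L. r * b * s)"
      using \<open>y \<in> J\<close> unfolding J_def by blast
    have "z * y = (\<Sum>(r, s)\<leftarrow>map (\<lambda>(r, s). (z * r, s)) L. r * b * s)"
      unfolding L(2) by (induction L) (auto simp: distrib_left mult.assoc)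
    then show "z * y \<in> J"
      unfolding J_def using L(1) that(2)
      by (intro CollectI exI[of _ "map (\<lambda>(r, s). (z * r, s)) L"]) (auto simp flip: mult.assoc)
    have "y * z = (\<Sum>(r, s)\<leftarrow>map (\<lambda>(r, s). (r, s * z)) L. r * b * s)"
      unfolding L(2) by (induction L) (auto simp: distrib_right mult.assoc)
    then show "y * z \<in> J"
      unfolding J_def using L(1)
      by (intro CollectI exI[of _ "map (\<lambda>(r, s). (r, s * z)) L"]) (auto simp flip: mult.assoc)
  qed
  have cadd: "x + y \<in> closure J" if "x \<in> closure J" "y \<in> closure J" for x y
    using that Jadd by (rule closure_add_mem)
  have cmult: "z * y \<in> closure J" "y * z \<in> closure J" if "y \<in> closure J" "?p * z = z" for y z
    using that Jmult by (auto intro!: closure_translate[of y J "\<lambda>y. z * y"] closure_translate[of y J "\<lambda>y. y * z"] continuous_intros)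
  define I where "I = {a \<in> carrier A. iota A a \<in> closure J}"
  have "ideal I A"
  proof (rule idealI)
    show "ring A" by (rule ring_axioms)
    show "subgroup I (add_monoid A)"
    proof (rule add.subgroupI)
      show "I \<noteq> {}" using J0 closure_subset[of J] by (auto simp: I_def intro!: exI[of _ \<zero>])
      fix a assume a: "a \<in> I"
      have "iota A (\<ominus> a) = iota A (\<ominus> \<one>) * iota A a"
        using a by (simp add: I_def l_minus flip: iota_mult)
      moreover have "iota A (\<ominus> \<one>) * iota A a \<in> closure J"
        using a by (intro cmult) (auto simp: I_def)
      ultimately show "\<ominus> a \<in> I"
        using a by (simp add: I_def)
    qed (auto simp: I_def iota_add intro: cadd)
  qed (auto simp: I_def iota_mult intro: cmult)
  moreover have "closedin (norm_topology A) I"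
    unfolding closedin_iota
  proof (intro conjI allI impI)
    fix f l assume fl: "(\<forall>n. f n \<in> I) \<and> l \<in> carrier A \<and> (\<lambda>n. iota A (f n)) \<longlonglongrightarrow> iota A l"
    then have "iota A l \<in> closure J"
      by - (rule closed_sequentially[OF closed_closure, of "\<lambda>n. iota A (f n)"], simp_all add: I_def)
    with fl show "l \<in> I" by (simp add: I_def)
  qed (auto simp: I_def)
  moreover have "I \<noteq> {\<zero>}"
  proof -
    have "b = iota A (ev A b)" using b by (simp add: iota_ev)
    moreover have "b \<in> J"
      unfolding J_def using b C.p_right[OF b(1)]
      by (intro CollectI exI[of _ "[(?p, ?p)]"]) auto
    ultimately have "ev A b \<in> I"
      using closure_subset[of J] by (auto simp: I_def)
    moreover have "ev A b \<noteq> \<zero>"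
      using b \<open>b = iota A (ev A b)\<close> by auto
    ultimately show ?thesis by blast
  qed
  ultimately have "I = carrier A"
    using assms by (auto simp: simple_cstar_def)
  then have "\<one> \<in> I" by simp
  then have "?p \<in> closure J" by (simp add: I_def)
  then have "\<exists>y\<in>J. dist y ?p < 1/2"
    unfolding closure_approachable by (rule allE[of _ "1/2"]) simp
  then obtain y where y: "y \<in> J" "dist y ?p < 1/2" by blast
  then obtain L where "\<forall>(r, s)\<in>set L. ?p * r = r \<and> ?p * s = s" "y = (\<Sum>(r, s)\<leftarrow>L. r * b * s)"
    by (auto simp: J_def)
  then show "\<exists>(k::nat) t. (\<forall>i<k. ?p * t i = t i) \<and> (\<Sum>i<k. t i * b * adj (t i)) = ?p"
    using y(2) b by (intro C.sum_conjugates_eq_p[of b L]) (auto simp: dist_norm)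
qed

lemma minimal_projection_min_proj:
  assumes "C.minimal_projection q"
  shows "min_proj (ev A q)" "iota A (ev A q) = q"
proof -
  have q: "q \<noteq> 0" "adj q = q" "q * q = q" "iota A \<one> * q = q"
    and min: "\<And>x. iota A \<one> * x = x \<Longrightarrow> \<exists>l. q * x * q = ofc l * q"
    using assms by (auto simp: C.minimal_projection_def)
  show i: "iota A (ev A q) = q"
    using q by (simp add: iota_ev_iff)
  let ?q = "ev A q"
  have "?q \<noteq> \<zero>" using i q by auto
  moreover have "?q\<^sup>\<star> = ?q" "?q \<otimes> ?q = ?q"
    using q ev_A by metis+
  moreover have "\<exists>l. ?q \<otimes> x \<otimes> ?q = l \<odot> ?q" if x: "x \<in> carrier A" for x
  proof -
    obtain l where "q * iota A x * q = ofc l * q"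
      using min[of "iota A x"] x by auto
    then have "ev A (q * iota A x * q) = ev A (ofc l * q)" by simp
    then show ?thesis
      using x by (auto simp: ev_A smult_mult_left)
  qed
  ultimately show "min_proj ?q"
    by (simp add: min_proj_def)
qed

text \<open>\<open>infinite_dimensional\<close> speaks of spanning sets with one coefficient for
  each element, whereas spanning families come indexed and may repeat; coefficients over a fibre of
  \<open>z\<close> are added up.\<close>

lemma finsum_regroup:
  assumes x: "x \<in> carrier A" "finite K" "\<And>k. k \<in> K \<Longrightarrow> z k \<in> carrier A"
    and eq: "iota A x = (\<Sum>k\<in>K. ofc (m k) * iota A (z k))"
  shows "\<exists>c. x = (\<Oplus>s\<in>z ` K. c s \<odot> s)"
proof -
  define c where "c s = (\<Sum>k | k \<in> K \<and> z k = s. m k)" for s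
  have "iota A x = (\<Sum>s\<in>z ` K. \<Sum>k | k \<in> K \<and> z k = s. ofc (m k) * iota A (z k))"
    unfolding eq by (rule sum.image_gen[OF x(2)])
  also have "\<dots> = (\<Sum>s\<in>z ` K. ofc (c s) * iota A s)"
  proof (intro sum.cong refl)
    fix s
    have "(\<Sum>k | k \<in> K \<and> z k = s. ofc (m k) * iota A (z k)) = (\<Sum>k | k \<in> K \<and> z k = s. ofc (m k) * iota A s)"
      by (intro sum.cong refl) auto
    then show "(\<Sum>k | k \<in> K \<and> z k = s. ofc (m k) * iota A (z k)) = ofc (c s) * iota A s"
      by (simp add: c_def sum_distrib_right ofc_sum)
  qed
  also have "\<dots> = (\<Sum>s\<in>z ` K. iota A (c s \<odot> s))"
    using x(3) by (intro sum.cong refl) (auto simp: iota_smult)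
  also have "\<dots> = iota A (\<Oplus>s\<in>z ` K. c s \<odot> s)"
    using x by (intro iota_finsum[symmetric]) auto
  finally have "x = (\<Oplus>s\<in>z ` K. c s \<odot> s)"
    using x by (subst (asm) iota_inj) (auto intro!: finsum_closed)
  then show ?thesis by (rule exI[of _ c])
qed

text \<open>By fullness the unit is a sum of elements \<open>t i * q * adj (t i)\<close>. Inserting
  it on both sides of \<open>x\<close> produces compressions of the form \<open>q * y * q\<close>,
  which are scalar multiples of \<open>q\<close>; so the finitely many
  \<open>t i * q * adj (t j)\<close> span.\<close>

lemma min_proj_finite_dimensional:
  assumes full: "C.full" and q: "min_proj q"
  shows "\<not> infinite_dimensional A"
proof -
  let ?p = "iota A \<one>" and ?q = "iota A q"
  have qc: "q \<in> carrier A" "q \<noteq> \<zero>" "q\<^sup>\<star> = q" "q \<otimes> q = q"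
    and min: "\<And>x. x \<in> carrier A \<Longrightarrow> \<exists>l. q \<otimes> x \<otimes> q = l \<odot> q"
    using q by (auto simp: min_proj_def)
  have qq: "?q * ?q = ?q" "adj ?q = ?q" "?p * ?q = ?q" "?q \<noteq> 0"
    using qc by (simp_all add: iota_eq_0_iff flip: iota_mult iota_star)
  have "cpos ?q" using cpos_adj_mult[of ?q] qq by simp
  then have "\<exists>(k::nat) t. (\<forall>i<k. ?p * t i = t i) \<and> (\<Sum>i<k. t i * ?q * adj (t i)) = ?p"
    using full[unfolded C.full_def, rule_format, of ?q] qq by blast
  then obtain k :: nat and t where t: "\<And>i. i < k \<Longrightarrow> ?p * t i = t i" "(\<Sum>i<k. t i * ?q * adj (t i)) = ?p"
    by blast
  define K where "K = {..<k} \<times> {..<k}"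
  define z where "z = (\<lambda>(i, j). t i * ?q * adj (t j))"
  define S where "S = (\<lambda>x. ev A (z x)) ` K"
  have zS: "iota A (ev A (z x)) = z x" if "x \<in> K" for x
    using that t(1) by (auto simp: iota_ev_iff K_def z_def simp flip: mult.assoc)
  have "\<exists>c. x = (\<Oplus>s\<in>S. c s \<odot> s)" if x: "x \<in> carrier A" for x
  proof -
    have "\<exists>l. ?q * y * ?q = ofc l * ?q" for y
    proof -
      obtain l where l: "q \<otimes> ev A y \<otimes> q = l \<odot> q" using min[of "ev A y"] by auto
      have "?q * y * ?q = ?q * (?p * y) * ?q"
        using C.p_right[OF qq(3)] by (simp flip: mult.assoc)
      also have "\<dots> = iota A (q \<otimes> ev A y \<otimes> q)"
        using qc by (simp add: iota_mult iota_ev(1))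
      also have "\<dots> = ofc l * ?q"
        unfolding l using qc by (simp add: iota_smult)
      finally show ?thesis by blast
    qed
    then obtain l where l: "\<And>y. ?q * y * ?q = ofc (l y) * ?q" by metis
    define m where "m = (\<lambda>(i, j). l (adj (t i) * iota A x * t j))"
    have "iota A x = ?p * iota A x * ?p" using x by simp
    also have "\<dots> = (\<Sum>i<k. \<Sum>j<k. (t i * ?q * adj (t i)) * iota A x * (t j * ?q * adj (t j)))"
      unfolding t(2)[symmetric] by (simp add: sum_distrib_left sum_distrib_right) (rule sum.swap)
    also have "\<dots> = (\<Sum>i<k. \<Sum>j<k. ofc (m (i, j)) * z (i, j))"
    proof (intro sum.cong refl)
      fix i j
      have "(t i * ?q * adj (t i)) * iota A x * (t j * ?q * adj (t j))
          = t i * (?q * (adj (t i) * iota A x * t j) * ?q) * adj (t j)"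
        by (simp only: mult.assoc)
      also have "\<dots> = ofc (m (i, j)) * z (i, j)"
        unfolding l by (simp add: m_def z_def mult.assoc ofc_left_commute[of "t i"])
      finally show "(t i * ?q * adj (t i)) * iota A x * (t j * ?q * adj (t j)) = ofc (m (i, j)) * z (i, j)" .
    qed
    also have "\<dots> = (\<Sum>x\<in>K. ofc (m x) * z x)"
      by (simp add: K_def sum.cartesian_product case_prod_unfold)
    also have "\<dots> = (\<Sum>x\<in>K. ofc (m x) * iota A (ev A (z x)))"
      using zS by (intro sum.cong refl) simp
    finally have "\<exists>c. x = (\<Oplus>s\<in>(\<lambda>x. ev A (z x)) ` K. c s \<odot> s)"
      by (intro finsum_regroup[OF x]) (auto simp: K_def)
    then show ?thesis by (simp only: S_def)
  qed
  moreover have "finite S" "S \<subseteq> carrier A"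
    by (auto simp: S_def K_def)
  ultimately show ?thesis
    unfolding infinite_dimensional_def by blast
qed

lemma orthogonal_copies_carrier:
  assumes "C.full" "\<nexists>q. min_proj q" "y \<in> positives A" "y \<noteq> \<zero>"
  shows "\<exists>V e. (\<forall>i<N::nat. V i \<in> carrier A) \<and> e \<in> positives A \<and> e \<noteq> \<zero> \<and>
    (\<forall>i<N. \<forall>j<N. V i \<otimes> y \<otimes> (V j)\<^sup>\<star> = (if i = j then e else \<zero>))"
proof -
  have y: "y \<in> carrier A" "cpos (iota A y)"
    using assms(3) by (auto simp: positives_iff_cpos)
  have "\<nexists>q. C.minimal_projection q"
    using assms(2) minimal_projection_min_proj by blast
  moreover have "iota A \<one> * iota A y = iota A y" "iota A y \<noteq> 0"
    using y assms(4) by (simp_all add: iota_eq_0_iff)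
  ultimately obtain V e where V: "e \<noteq> 0" "cpos e" "iota A \<one> * e = e"
    "\<And>i j. i < N \<Longrightarrow> j < N \<Longrightarrow> V i * iota A y * adj (V j) = (if i = j then e else 0)"
    using C.orthogonal_copies[OF assms(1) _ _ y(2), of N] by blast
  have ie: "iota A (ev A e) = e" using V(3) by (simp add: iota_ev_iff)
  have "ev A (V i) \<otimes> y \<otimes> (ev A (V j))\<^sup>\<star> = (if i = j then ev A e else \<zero>)" if "i < N" "j < N" for i j
  proof -
    have "ev A (V i * iota A y * adj (V j)) = ev A (if i = j then e else 0)"
      using V(4)[OF that] by simp
    then show ?thesis
      using y by (simp add: ev_A split: if_splits)
  qed
  moreover have "ev A e \<in> positives A" "ev A e \<noteq> \<zero>"
    using V ie by (auto simp: positives_iff_cpos)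
  ultimately show ?thesis
    by (intro exI[of _ "\<lambda>i. ev A (V i)"] exI[of _ "ev A e"]) auto
qed

end

section \<open>Large subalgebras\<close>

lemma large_subalgebraD:
  assumes "large_subalgebra B A"
  shows "unital_cstar_algebra A" "infinite_dimensional A" "simple_cstar A" "unital_cstar_subalgebra B A"
  using assms by (auto simp: large_subalgebra_def)

lemma large_subalgebraE:
  fixes a :: "nat \<Rightarrow> 'a" and m :: nat
  assumes "large_subalgebra B A" "\<And>j. j < m \<Longrightarrow> a j \<in> carrier A" "\<epsilon> > 0"
    "x \<in> positives A" "nrm A x = 1" "y \<in> positives (A\<lparr>carrier := B\<rparr>)" "y \<noteq> \<zero>\<^bsub>A\<^esub>"
  obtains g c where "g \<in> B" "\<And>j. j < m \<Longrightarrow> c j \<in> carrier A"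
    "g \<in> positives (A\<lparr>carrier := B\<rparr>)" "\<one>\<^bsub>A\<^esub> \<ominus>\<^bsub>A\<^esub> g \<in> positives (A\<lparr>carrier := B\<rparr>)"
    "\<And>j. j < m \<Longrightarrow> nrm A (c j \<ominus>\<^bsub>A\<^esub> a j) < \<epsilon>"
    "\<And>j. j < m \<Longrightarrow> (\<one>\<^bsub>A\<^esub> \<ominus>\<^bsub>A\<^esub> g) \<otimes>\<^bsub>A\<^esub> c j \<in> B"
    "cuntz_subeq (A\<lparr>carrier := B\<rparr>) g y" "cuntz_subeq A g x"
    "nrm A ((\<one>\<^bsub>A\<^esub> \<ominus>\<^bsub>A\<^esub> g) \<otimes>\<^bsub>A\<^esub> x \<otimes>\<^bsub>A\<^esub> (\<one>\<^bsub>A\<^esub> \<ominus>\<^bsub>A\<^esub> g)) > 1 - \<epsilon>"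
proof -
  interpret unital_cstar_algebra A using assms(1) by (rule large_subalgebraD)
  \<comment> \<open>The definition numbers from 1 and asks for at least one element. The family is
    shifted and padded with one entry \<open>\<one>\<close>, so that \<open>m = 0\<close> is covered
    too.\<close>
  let ?a = "\<lambda>j. if j - 1 < m then a (j - 1) else \<one>\<^bsub>A\<^esub>"
  have prem: "Suc m \<ge> 1 \<and> (\<forall>j\<in>{1..Suc m}. ?a j \<in> carrier A) \<and> \<epsilon> > 0 \<and> x \<in> positives A \<and> nrm A x = 1 \<and>
      y \<in> positives (A\<lparr>carrier := B\<rparr>) - {\<zero>\<^bsub>A\<^esub>}"
    using assms by auto
  note L = assms(1)[unfolded large_subalgebra_def, THEN conjunct2, THEN conjunct2, THEN conjunct2, THEN conjunct2, rule_format]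
  have j: "Suc j \<in> {1..Suc m}" "?a (Suc j) = a j" if "j < m" for j
    using that by auto
  from L[OF prem] show ?thesis
  proof (elim exE bexE conjE)
    fix c g
    assume g: "g \<in> B" "g \<in> positives (A\<lparr>carrier := B\<rparr>)" "\<one>\<^bsub>A\<^esub> \<ominus>\<^bsub>A\<^esub> g \<in> positives (A\<lparr>carrier := B\<rparr>)"
      "cuntz_subeq (A\<lparr>carrier := B\<rparr>) g y" "cuntz_subeq A g x"
      "nrm A ((\<one>\<^bsub>A\<^esub> \<ominus>\<^bsub>A\<^esub> g) \<otimes>\<^bsub>A\<^esub> x \<otimes>\<^bsub>A\<^esub> (\<one>\<^bsub>A\<^esub> \<ominus>\<^bsub>A\<^esub> g)) > 1 - \<epsilon>"
      and c: "\<forall>j\<in>{1..Suc m}. c j \<in> carrier A" "\<forall>j\<in>{1..Suc m}. nrm A (c j \<ominus>\<^bsub>A\<^esub> ?a j) < \<epsilon>"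
      "\<forall>j\<in>{1..Suc m}. (\<one>\<^bsub>A\<^esub> \<ominus>\<^bsub>A\<^esub> g) \<otimes>\<^bsub>A\<^esub> c j \<in> B"
    show ?thesis
    proof (rule that[of g "\<lambda>j. c (Suc j)"])
      fix i assume i: "i < m"
      show "c (Suc i) \<in> carrier A" "(\<one>\<^bsub>A\<^esub> \<ominus>\<^bsub>A\<^esub> g) \<otimes>\<^bsub>A\<^esub> c (Suc i) \<in> B"
        using c j(1)[OF i] by blast+
      show "nrm A (c (Suc i) \<ominus>\<^bsub>A\<^esub> a i) < \<epsilon>"
        using bspec[OF c(2) j(1)[OF i]] unfolding j(2)[OF i] .
    qed (fact g)+
  qed
qed

context unital_cstar_algebra
begin

text \<open>The two embeddings land in different factors of the product, so the limits cannot be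
  identified; convergence depends only on norms of differences, which are the same in both.\<close>

lemma tendsto_iota_subalgebra:
  assumes B: "unital_cstar_subalgebra B A" and "\<And>n. f n \<in> B" "l \<in> B"
  shows "(\<lambda>n. iota (A\<lparr>carrier := B\<rparr>) (f n)) \<longlonglongrightarrow> iota (A\<lparr>carrier := B\<rparr>) l \<longleftrightarrow> (\<lambda>n. iota A (f n)) \<longlonglongrightarrow> iota A l"
proof -
  have sub: "subring B A" using B by (simp add: unital_cstar_subalgebra_def)
  interpret B: unital_cstar_algebra "A\<lparr>carrier := B\<rparr>" by (rule subalgebra_is_cstar[OF B])
  have "norm (iota (A\<lparr>carrier := B\<rparr>) (f n) - iota (A\<lparr>carrier := B\<rparr>) l) = norm (iota A (f n) - iota A l)" for n
  proof -
    have "norm (iota (A\<lparr>carrier := B\<rparr>) (f n) - iota (A\<lparr>carrier := B\<rparr>) l) = nrm A (f n \<ominus> l)"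
      using assms B.minus_closed[of "f n" l] by (simp add: subalgebra_a_minus[OF sub] flip: B.iota_diff)
    also have "\<dots> = norm (iota A (f n) - iota A l)"
    proof -
      have "f n \<in> carrier A" "l \<in> carrier A"
        using assms subringE(1)[OF sub] by blast+
      then show ?thesis by (simp flip: iota_diff)
    qed
    finally show ?thesis .
  qed
  then show ?thesis
    by (simp add: LIMSEQ_iff)
qed

lemma positives_subalgebra:
  assumes B: "unital_cstar_subalgebra B A" and "a \<in> positives (A\<lparr>carrier := B\<rparr>)"
  shows "a \<in> positives A" "a \<in> B"
proof -
  have sub: "subring B A" using B by (simp add: unital_cstar_subalgebra_def)
  interpret B: unital_cstar_algebra "A\<lparr>carrier := B\<rparr>" by (rule subalgebra_is_cstar[OF B])
  obtain s where s: "s \<in> B" "a = s\<^sup>\<star> \<otimes> s"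
    using assms(2) by (auto simp: B.positives_iff_square)
  then show "a \<in> positives A"
    using subringE(1)[OF sub] by (auto simp: positives_iff_square)
  show "a \<in> B" using assms(2) by (simp add: positives_def)
qed

lemma iota_contraction:
  assumes "g \<in> positives A" "\<one> \<ominus> g \<in> positives A"
  shows "cpos (iota A g)" "iota A g \<preceq> iota A \<one>" "cpos (iota A \<one> - iota A g)" "iota A \<one> - iota A g \<preceq> 1"
    "norm (iota A \<one> - iota A g) \<le> 1"
proof -
  have g: "g \<in> carrier A" using assms by (simp add: positives_def)
  show "cpos (iota A g)" "cpos (iota A \<one> - iota A g)" "iota A g \<preceq> iota A \<one>"
    using assms g by (simp_all add: positives_iff_cpos cle_def flip: iota_diff)
  then show 1: "iota A \<one> - iota A g \<preceq> 1"
    using cpos_add[OF C.cpos_1_minus_p, of "iota A g"] by (simp add: cle_def algebra_simps)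
  show "norm (iota A \<one> - iota A g) \<le> 1"
    using norm_mono[OF \<open>cpos (iota A \<one> - iota A g)\<close> 1] by simp
qed

text \<open>
  For a nonzero positive \<open>b\<close> in an ideal \<open>I\<close> of \<open>B\<close>, write \<open>1 = \<Sum> t\<^sub>i b t\<^sub>i*\<close> in \<open>A\<close> and approximate the \<open>t\<^sub>i\<close> with
  \<open>g \<precsim> b\<close>, so that \<open>g \<in> I\<close>. Then \<open>(1 - g)\<^sup>2 \<approx> \<Sum> (1 - g) c\<^sub>i b c\<^sub>i* (1 - g) \<in> I\<close>, hence \<open>1\<close> is a limit of
  elements of \<open>I\<close>.
\<close>

lemma large_subalgebra_simple:
  assumes large: "large_subalgebra B A"
  shows "simple_cstar (A\<lparr>carrier := B\<rparr>)"
proof -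
  let ?B = "A\<lparr>carrier := B\<rparr>" and ?p = "iota A \<one>"
  note sA = large_subalgebraD[OF large]
  have sub: "subring B A" using sA by (simp add: unital_cstar_subalgebra_def)
  have BA: "x \<in> carrier A" if "x \<in> B" for x using subringE(1)[OF sub] that by blast
  interpret B: unital_cstar_algebra ?B by (rule subalgebra_is_cstar[OF sA(4)])
  have full: "C.full" by (rule simple_full[OF sA(3)])
  have one: "\<one> \<noteq> \<zero>"
    using sA(3) one_zeroD by (auto simp: simple_cstar_def)
  have "I = carrier ?B" if I: "ideal I ?B" and cl: "closedin (norm_topology ?B) I" and "I \<noteq> {\<zero>}" for I
  proof -
    interpret I: ideal I ?B by (rule I)
    have IB: "x \<in> B" if "x \<in> I" for x using I.a_subset that by auto
    have Iadd: "x \<oplus> y \<in> I" if "x \<in> I" "y \<in> I" for x y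
      using I.a_closed[OF that] by simp
    have Imul: "x \<otimes> y \<in> I" "y \<otimes> x \<in> I" if "x \<in> I" "y \<in> B" for x y
      using I.I_l_closed[of x y] I.I_r_closed[of x y] that by simp_all
    have Ineg: "\<ominus> x \<in> I" if "x \<in> I" for x
      using I.a_inv_closed[OF that] subalgebra_a_inv[OF sub IB[OF that]] by simp
    have Ilim: "l \<in> I" if f: "\<And>n. f n \<in> I" and l: "l \<in> B" "(\<lambda>n. iota A (f n)) \<longlonglongrightarrow> iota A l" for f l
    proof -
      have "(\<lambda>n. iota ?B (f n)) \<longlonglongrightarrow> iota ?B l"
        using tendsto_iota_subalgebra[OF sA(4) IB[OF f] l(1)] l(2) by (rule iffD2)
      then show ?thesis
        using cl[unfolded B.closedin_iota, THEN conjunct2, rule_format, of f l] f l(1) by simp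
    qed
    have Isum: "\<exists>e\<in>I. iota A e = (\<Sum>i<k. iota A (f i))" if "\<And>i. i < k \<Longrightarrow> f i \<in> I" for k :: nat and f
      using that
    proof (induction k)
      case 0
      then show ?case using I.zero_closed by (auto intro!: bexI[of _ \<zero>])
    next
      case (Suc k)
      then obtain e where "e \<in> I" "iota A e = (\<Sum>i<k. iota A (f i))" by auto
      then show ?case
        using Iadd[of e "f k"] Suc.prems[of k] by (intro bexI[of _ "e \<oplus> f k"]) (auto simp: iota_add BA IB)
    qed
    obtain z where z: "z \<in> I" "z \<noteq> \<zero>"
      using I.zero_closed \<open>I \<noteq> {\<zero>}\<close> by auto
    define b where "b = z\<^sup>\<star> \<otimes> z"
    have zB: "z \<in> B" "z\<^sup>\<star> \<in> B" "z \<in> carrier A"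
      using IB[OF z(1)] BA B.star_closed[of z] by auto
    have bI: "b \<in> I" unfolding b_def using Imul(2)[OF z(1) zB(2)] .
    have bpos: "b \<in> positives ?B"
      unfolding B.positives_iff_square using zB by (auto simp: b_def)
    have b0: "iota A b = adj (iota A z) * iota A z"
      using zB by (simp add: b_def iota_mult iota_star star_closed)
    then have ib: "cpos (iota A b)" "iota A b \<noteq> 0"
      using z(2) zB by (simp_all add: cpos_adj_mult iota_eq_0_iff)
    then have bz: "b \<noteq> \<zero>" by auto
    have bA: "b \<in> carrier A" using bI BA IB by blast
    obtain k :: nat and t where t: "\<And>i. i < k \<Longrightarrow> ?p * t i = t i" "(\<Sum>i<k. t i * iota A b * adj (t i)) = ?p"
      using full[unfolded C.full_def, rule_format, of "iota A b"] ib bA by auto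
    have pp: "\<one> \<in> positives A" "nrm A \<one> = 1"
    proof -
      show "\<one> \<in> positives A" unfolding positives_iff_square by (auto intro!: bexI[of _ \<one>])
      have "nrm A \<one> = (nrm A \<one>)\<^sup>2" using cstar_identity[of \<one>] by simp
      then show "nrm A \<one> = 1" using nrm_eq_0[of \<one>] one by (auto simp: power2_eq_square)
    qed
    have ex: "\<exists>c e. (\<forall>i<k. c i \<in> carrier A \<and> norm (iota A (c i) - t i) < 1 / Suc n) \<and> e \<in> I \<and>
        norm (iota A e - ?p) \<le> norm ((\<Sum>i<k. iota A (c i) * iota A b * adj (iota A (c i))) - ?p)" for n
    proof -
      have en: "1 / real (Suc n) > 0" by simp
      obtain c g where gc: "g \<in> B" "\<And>i. i < k \<Longrightarrow> c i \<in> carrier A" "g \<in> positives ?B" "\<one> \<ominus> g \<in> positives ?B"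
          "\<And>i. i < k \<Longrightarrow> nrm A (c i \<ominus> ev A (t i)) < 1 / Suc n"
          "\<And>i. i < k \<Longrightarrow> (\<one> \<ominus> g) \<otimes> c i \<in> B"
          "cuntz_subeq ?B g b" "cuntz_subeq A g \<one>" "nrm A ((\<one> \<ominus> g) \<otimes> \<one> \<otimes> (\<one> \<ominus> g)) > 1 - 1 / Suc n"
        by (rule large_subalgebraE[where m = k and a = "\<lambda>i. ev A (t i)", OF large ev_A_closed en pp bpos bz])
           (rule that; blast)
      note g = gc(1,3,4) and c = gc(2,5,6) and cu = gc(7)
      have gA: "g \<in> carrier A" using g BA by blast
      obtain v where v: "\<And>n. v n \<in> B" "limitin (norm_topology ?B) (\<lambda>n. v n \<otimes> b \<otimes> (v n)\<^sup>\<star>) g sequentially"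
        using cu by (auto simp: cuntz_subeq_def)
      have vI: "v n \<otimes> b \<otimes> (v n)\<^sup>\<star> \<in> I" for n
        using Imul(1)[OF Imul(2)[OF bI v(1)], of "(v n)\<^sup>\<star>"] B.star_closed[of "v n"] v(1) by auto
      have gI: "g \<in> I"
      proof (rule Ilim[OF vI g(1)])
        have "(\<lambda>n. iota ?B (v n \<otimes> b \<otimes> (v n)\<^sup>\<star>)) \<longlonglongrightarrow> iota ?B g"
          using v(2) vI IB g(1) by (subst (asm) B.limitin_iota) auto
        then show "(\<lambda>n. iota A (v n \<otimes> b \<otimes> (v n)\<^sup>\<star>)) \<longlonglongrightarrow> iota A g"
          using tendsto_iota_subalgebra[OF sA(4)] vI IB g(1) by auto
      qed
      let ?w = "\<lambda>i. (\<one> \<ominus> g) \<otimes> c i"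
      have wI: "?w i \<otimes> b \<otimes> (?w i)\<^sup>\<star> \<in> I" if "i < k" for i
        using Imul(1)[OF Imul(2)[OF bI c(3)[OF that]], of "(?w i)\<^sup>\<star>"] B.star_closed[of "?w i"] c(3)[OF that] by auto
      have "\<exists>e\<in>I. iota A e = (\<Sum>i<k. iota A (?w i \<otimes> b \<otimes> (?w i)\<^sup>\<star>))"
        by (rule Isum) (rule wI)
      then obtain e where e: "e \<in> I" "iota A e = (\<Sum>i<k. iota A (?w i \<otimes> b \<otimes> (?w i)\<^sup>\<star>))"
        by blast
      define S where "S = (\<Sum>i<k. iota A (c i) * iota A b * adj (iota A (c i)))"
      let ?g = "iota A g"
      let ?h = "?p - ?g"
      have hadj: "adj ?h = ?h"
        using iota_contraction(3)[OF positives_subalgebra(1)[OF sA(4) g(2)] positives_subalgebra(1)[OF sA(4) g(3)]]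
        by (rule cpos_adj)
      have nh: "norm ?h \<le> 1"
        using iota_contraction(5)[OF positives_subalgebra(1)[OF sA(4) g(2)] positives_subalgebra(1)[OF sA(4) g(3)]] .
      have eS: "iota A e = ?h * S * ?h"
        unfolding e(2) S_def sum_distrib_left sum_distrib_right
        by (intro sum.cong refl) (use c(1) gA bA hadj in \<open>simp add: iota_mult iota_star iota_diff star_closed adj_mult mult.assoc\<close>)
      \<comment> \<open>The correction \<open>2 g - g\<^sup>2\<close> lies in \<open>I\<close> and
        completes \<open>(1 - g)\<^sup>2\<close> to 1. Hence \<open>e'\<close> differs from the unit
        exactly by \<open>?h * (S - ?p) * ?h\<close>, and \<open>?h\<close> is a
        contraction.\<close>
      define e' where "e' = e \<oplus> ((g \<oplus> g) \<oplus> \<ominus> (g \<otimes> g))"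
      have e'I: "e' \<in> I"
        unfolding e'_def using e(1) gI g(1) by (intro Iadd Ineg Imul)
      have "iota A (\<ominus> (g \<otimes> g)) = - (?g * ?g)"
        using iota_diff[of \<zero> "g \<otimes> g"] gA by (simp add: minus_eq iota_mult)
      then have "iota A e' = iota A e + (?g + ?g - ?g * ?g)"
        using BA[OF IB[OF e(1)]] gA by (simp add: e'_def iota_add)
      moreover have "?h * (S - ?p) * ?h = ?h * S * ?h - (?p - ?g - ?g + ?g * ?g)"
        using gA by (simp add: right_diff_distrib left_diff_distrib mult.assoc)
      ultimately have "iota A e' - ?p = ?h * (S - ?p) * ?h"
        using eS by simp
      then have "norm (iota A e' - ?p) \<le> norm (?h * (S - ?p)) * norm ?h"
        by (simp only: norm_mult_ineq)
      also have "\<dots> \<le> norm (?h * (S - ?p))"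
        using nh by (simp add: mult_left_le)
      also have "\<dots> \<le> norm ?h * norm (S - ?p)"
        by (rule norm_mult_ineq)
      also have "\<dots> \<le> norm (S - ?p)"
        using nh by (simp add: mult_left_le_one_le)
      finally have "norm (iota A e' - ?p) \<le> norm (S - ?p)" .
      moreover have "norm (iota A (c i) - t i) < 1 / Suc n" if "i < k" for i
      proof -
        have "t i = iota A (ev A (t i))" using t(1)[OF that] by (simp add: iota_ev)
        then have "norm (iota A (c i) - t i) = nrm A (c i \<ominus> ev A (t i))"
          using c(1)[OF that] by (metis ev_A_closed iota_diff minus_closed norm_iota)
        then show ?thesis using c(2)[OF that] by simp
      qed
      ultimately show ?thesis
        using c(1) e'I unfolding S_def by (intro exI[of _ c] exI[of _ e'] conjI allI impI) auto
    qed
    let ?P = "\<lambda>n c e. (\<forall>i<k. c i \<in> carrier A \<and> norm (iota A (c i) - t i) < 1 / Suc n) \<and> e \<in> I \<and>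
        norm (iota A e - ?p) \<le> norm ((\<Sum>i<k. iota A (c i) * iota A b * adj (iota A (c i))) - ?p)"
    have "\<forall>n. \<exists>c e. ?P n c e" by (intro allI ex)
    then obtain c where "\<forall>n. \<exists>e. ?P n (c n) e"
      by (rule choice[THEN exE])
    then obtain e where P: "\<forall>n. ?P n (c n) (e n)"
      by (rule choice[THEN exE])
    have ce: "\<And>n i. i < k \<Longrightarrow> norm (iota A (c n i) - t i) < 1 / Suc n" "\<And>n. e n \<in> I"
        "\<And>n. norm (iota A (e n) - ?p) \<le> norm ((\<Sum>i<k. iota A (c n i) * iota A b * adj (iota A (c n i))) - ?p)"
      using P by simp_all
    have "(\<lambda>n. iota A (c n i)) \<longlonglongrightarrow> t i" if "i < k" for i
    proof (rule LIM_zero_cancel, rule Lim_null_comparison)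
      show "\<forall>\<^sub>F n in sequentially. norm (iota A (c n i) - t i) \<le> 1 / real (Suc n)"
        using ce(1)[OF that] by (intro always_eventually allI less_imp_le)
      show "(\<lambda>n. 1 / real (Suc n)) \<longlonglongrightarrow> 0"
        using LIMSEQ_inverse_real_of_nat by (simp add: inverse_eq_divide)
    qed
    then have "(\<lambda>n. \<Sum>i<k. iota A (c n i) * iota A b * adj (iota A (c n i))) \<longlonglongrightarrow> (\<Sum>i<k. t i * iota A b * adj (t i))"
      by (intro tendsto_sum tendsto_mult tendsto_const tendsto_adj) auto
    then have "(\<lambda>n. norm ((\<Sum>i<k. iota A (c n i) * iota A b * adj (iota A (c n i))) - ?p)) \<longlonglongrightarrow> 0"
      unfolding t(2) by (intro tendsto_norm_zero LIM_zero)
    then have "(\<lambda>n. iota A (e n) - ?p) \<longlonglongrightarrow> 0"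
      by (rule Lim_null_comparison[rotated]) (use ce(3) in auto)
    then have "(\<lambda>n. iota A (e n)) \<longlonglongrightarrow> iota A \<one>"
      by (rule LIM_zero_cancel)
    then have "\<one> \<in> I"
      using Ilim[of e \<one>] ce(2) subringE(3)[OF sub] by blast
    then show ?thesis
      using I.one_imp_carrier by simp
  qed
  moreover have "carrier ?B \<noteq> {\<zero>}"
    using one subringE(3)[OF sub] by auto
  ultimately show ?thesis
    unfolding simple_cstar_def by auto
qed

text \<open>
  With \<open>x = y = q\<close>, minimality makes \<open>q g q\<close> a multiple of \<open>q\<close>, and \<open>\<parallel>(1 - g) q (1 - g)\<parallel> \<approx> 1\<close> forces that
  multiple to be small, whence \<open>q a q \<approx> q (1 - g) c q\<close>.
\<close>

lemma large_subalgebra_min_proj: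
  assumes large: "large_subalgebra B A" and q: "unital_cstar_algebra.min_proj (A\<lparr>carrier := B\<rparr>) q"
  shows "min_proj q"
proof -
  let ?B = "A\<lparr>carrier := B\<rparr>" and ?p = "iota A \<one>" and ?q = "iota A q"
  note sA = large_subalgebraD[OF large]
  have sub: "subring B A" using sA by (simp add: unital_cstar_subalgebra_def)
  have BA: "x \<in> carrier A" if "x \<in> B" for x using subringE(1)[OF sub] that by blast
  interpret B: unital_cstar_algebra ?B by (rule subalgebra_is_cstar[OF sA(4)])
  have qB: "q \<in> B" "q \<noteq> \<zero>" "q\<^sup>\<star> = q" "q \<otimes> q = q"
    and min: "\<And>x. x \<in> B \<Longrightarrow> \<exists>l. q \<otimes> x \<otimes> q = l \<odot> q"
    using q by (auto simp: B.min_proj_def)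
  have qA: "q \<in> carrier A" using qB BA by blast
  have qq: "?q * ?q = ?q" "adj ?q = ?q" "?p * ?q = ?q" "?q * ?p = ?q" "?q \<noteq> 0"
    using qA qB by (simp_all add: iota_eq_0_iff flip: iota_mult iota_star)
  have qpos: "cpos ?q" using cpos_adj_mult[of ?q] qq by simp
  have nq: "norm ?q = 1"
  proof -
    have "norm ?q = (norm ?q)\<^sup>2" using norm_adj_mult[of ?q] qq by simp
    then show ?thesis using qq(5) by (auto simp: power2_eq_square)
  qed
  have min': "\<exists>l. ?q * iota A x * ?q = ofc l * ?q" if x: "x \<in> B" for x
  proof -
    obtain l where "q \<otimes> x \<otimes> q = l \<odot> q" using min[OF x] by blast
    then have "iota A (q \<otimes> x \<otimes> q) = iota A (l \<odot> q)" by simp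
    then show ?thesis using qA BA[OF x] by (auto simp: iota_mult iota_smult)
  qed
  \<comment> \<open>A compression that is positive and a scalar multiple of \<open>q\<close> has a
    nonnegative real factor, because \<open>q\<close> is itself positive and nonzero.\<close>
  have real: "\<exists>r\<ge>0. ?q * y * ?q = r *\<^sub>R ?q" if y: "cpos y" "\<exists>l. ?q * y * ?q = ofc l * ?q" for y
  proof -
    obtain l where l: "?q * y * ?q = ofc l * ?q" using y(2) by blast
    have pos: "cpos (ofc l * ?q)"
      unfolding l[symmetric] by (rule cpos_sandwich[OF y(1) qq(2)])
    then have "ofc (cnj l) * ?q = ofc l * ?q"
      using cpos_adj[OF pos] by (simp add: adj_mult adj_ofc qq ofc_commute[of _ ?q])
    then have "ofc (cnj l - l) * ?q = 0" by (simp add: ofc_diff left_diff_distrib)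
    then have "cmod (cnj l - l) = 0"
      using norm_ofc_mult[of "cnj l - l" ?q] nq by simp
    then have "l = of_real (Re l)" by (simp add: complex_eq_iff)
    then have lR: "ofc l * ?q = Re l *\<^sub>R ?q"
      by (metis ofc_of_real scaleR_conv_of_real)
    have "Re l \<ge> 0"
    proof (rule ccontr)
      assume "\<not> 0 \<le> Re l"
      then have "cpos ((- Re l) *\<^sub>R ?q)"
        by (intro cpos_scaleR qpos) simp
      then have "Re l *\<^sub>R ?q = 0"
        using pos unfolding lR by (intro cpos_antisym) simp_all
      then show False using qq(5) \<open>\<not> 0 \<le> Re l\<close> by simp
    qed
    then show ?thesis using l lR by auto
  qed
  have qpos': "q \<in> positives ?B" unfolding B.positives_iff_square
    using qB by (auto intro!: bexI[of _ q])
  have qposA: "q \<in> positives A" by (rule positives_subalgebra[OF sA(4) qpos'])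
  have "\<exists>l. q \<otimes> a \<otimes> q = l \<odot> q" if a: "a \<in> carrier A" for a
  proof -
    \<comment> \<open>The first term is the distance of \<open>a\<close> from \<open>c\<close>; the
      second bounds \<open>?q * ?g\<close> by the root of the tolerance, times a bound for
      \<open>norm (iota A c)\<close>.\<close>
    have "\<exists>l. norm (?q * iota A a * ?q - ofc l * ?q) \<le> 1 / Suc n + sqrt (1 / Suc n) * (norm (iota A a) + 1)" for n
    proof -
      let ?e = "1 / real (Suc n)"
      have en: "?e > 0" by simp
      have nq': "nrm A q = 1" using nq qA by simp
      obtain c' g where gc: "g \<in> B" "\<And>j. j < (1::nat) \<Longrightarrow> c' j \<in> carrier A" "g \<in> positives ?B" "\<one> \<ominus> g \<in> positives ?B"
          "\<And>j. j < 1 \<Longrightarrow> nrm A (c' j \<ominus> a) < ?e" "\<And>j. j < 1 \<Longrightarrow> (\<one> \<ominus> g) \<otimes> c' j \<in> B"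
          "cuntz_subeq ?B g q" "cuntz_subeq A g q" "nrm A ((\<one> \<ominus> g) \<otimes> q \<otimes> (\<one> \<ominus> g)) > 1 - ?e"
        by (rule large_subalgebraE[where m = 1 and a = "\<lambda>_. a", OF large a en qposA nq' qpos' qB(2)])
           (rule that; blast)
      define c where "c = c' 0"
      have c: "c \<in> carrier A" "nrm A (c \<ominus> a) < ?e" "(\<one> \<ominus> g) \<otimes> c \<in> B"
        using gc(2,5,6)[of 0] by (simp_all add: c_def)
      note g = gc(1,3,4) and big = gc(9)
      have gA: "g \<in> carrier A" using g BA by blast
      let ?g = "iota A g"
      let ?h = "?p - ?g"
      note con = iota_contraction[OF positives_subalgebra(1)[OF sA(4) g(2)] positives_subalgebra(1)[OF sA(4) g(3)]]
      have ha: "adj ?h = ?h" "adj ?g = ?g" using con by (simp_all add: cpos_adj)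
      have hB: "\<one> \<ominus> g \<in> B" by (rule positives_subalgebra[OF sA(4) g(3)])
      obtain r where r: "r \<ge> 0" "?q * ?h * ?q = r *\<^sub>R ?q"
        using real[OF con(3)] min'[OF hB] gA by (auto simp: iota_diff)
      obtain r' where r': "r' \<ge> 0" "?q * ?g * ?q = r' *\<^sub>R ?q"
        using real[OF con(1)] min'[OF g(1)] by blast
      have "r *\<^sub>R ?q + r' *\<^sub>R ?q = ?q"
        unfolding r(2)[symmetric] r'(2)[symmetric] using qq by (simp add: right_diff_distrib left_diff_distrib)
      then have "(r + r' - 1) *\<^sub>R ?q = 0" by (simp add: algebra_simps)
      \<comment> \<open>The norm condition on \<open>(1 - g) q (1 - g)\<close> forces
        \<open>r\<close> above \<open>1 - ?e\<close>, because that norm equals the norm of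
        \<open>?q * (?h * ?h) * ?q\<close>, which is at most \<open>r\<close>. What remains for
        \<open>r'\<close> is less than \<open>?e\<close>.\<close>
      then have rr: "r + r' = 1" using qq(5) by simp
      have "1 - ?e < norm (?h * ?q * ?h)"
        using big gA qA by (simp add: iota_mult iota_diff flip: norm_iota)
      also have "?h * ?q * ?h = (?h * ?q) * adj (?h * ?q)"
        using qq(1) by (simp add: adj_mult ha qq(2)) (metis mult.assoc)
      also have "norm \<dots> = norm (adj (?h * ?q) * (?h * ?q))"
        by (simp only: norm_mult_adj norm_adj_mult)
      also have "adj (?h * ?q) * (?h * ?q) = ?q * (?h * ?h) * ?q"
        by (simp only: adj_mult ha qq(2) mult.assoc)
      also have "norm (?q * (?h * ?h) * ?q) \<le> norm (?q * ?h * ?q)"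
        using cle_conj_mono(1)[OF square_cle[OF con(3,4)], of ?q] qq(2) cpos_square[OF ha(1)]
        by (intro norm_mono cpos_sandwich) auto
      also have "\<dots> = r" using r nq by simp
      finally have r'e: "r' < ?e" using rr by simp
      have g1: "?g \<preceq> 1"
        using cle_trans[OF con(2)] C.cpos_1_minus_p by (simp add: cle_def)
      have "(norm (?q * ?g))\<^sup>2 = norm (?q * (?g * ?g) * ?q)"
        using norm_mult_adj[of "?q * ?g"] by (simp only: adj_mult ha qq(2) mult.assoc)
      also have "\<dots> \<le> norm (?q * ?g * ?q)"
        using cle_conj_mono(1)[OF square_cle[OF con(1) g1], of ?q] qq(2) cpos_square[OF ha(2)]
        by (intro norm_mono cpos_sandwich) auto
      also have "\<dots> \<le> ?e" using r' r'e nq by simp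
      finally have qg: "norm (?q * ?g) \<le> sqrt ?e" by (rule real_le_rsqrt)
      obtain l where l: "?q * iota A ((\<one> \<ominus> g) \<otimes> c) * ?q = ofc l * ?q"
        using min'[OF c(3)] by blast
      have ca: "norm (iota A a - iota A c) < ?e"
        using c a by (simp add: nrm_diff_commute[of a c] flip: iota_diff)
      then have nc: "norm (iota A c) \<le> norm (iota A a) + 1"
        using norm_triangle_ineq2[of "iota A c" "iota A a"] by (simp add: norm_minus_commute) (smt (verit) divide_le_eq_1 of_nat_0_le_iff)
      have w: "iota A ((\<one> \<ominus> g) \<otimes> c) = iota A c - ?g * iota A c"
        using gA c by (simp add: iota_mult iota_diff left_diff_distrib)
      have "?q * iota A a * ?q - ofc l * ?q = ?q * (iota A a - iota A c) * ?q + (?q * ?g) * iota A c * ?q"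
        unfolding l[symmetric] w by (simp add: algebra_simps)
      also have "norm \<dots> \<le> norm (?q * (iota A a - iota A c) * ?q) + norm ((?q * ?g) * iota A c * ?q)"
        by (rule norm_triangle_ineq)
      also have "\<dots> \<le> norm (iota A a - iota A c) + norm (?q * ?g) * norm (iota A c)"
      proof -
        have "norm (x * ?q) \<le> norm x" "norm (?q * x) \<le> norm x" for x
          using norm_mult_ineq[of x ?q] norm_mult_ineq[of ?q x] nq by simp_all
        then show ?thesis
          by (meson add_mono norm_mult_ineq order_trans)
      qed
      also have "\<dots> \<le> ?e + sqrt ?e * (norm (iota A a) + 1)"
        using ca qg nc by (intro add_mono mult_mono) auto
      finally show ?thesis by blast
    qed
    then obtain l where l: "\<And>n. norm (?q * iota A a * ?q - ofc (l n) * ?q) \<le> 1 / Suc n + sqrt (1 / Suc n) * (norm (iota A a) + 1)"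
      by metis
    have lim: "(\<lambda>n. 1 / real (Suc n) + sqrt (1 / real (Suc n)) * (norm (iota A a) + 1)) \<longlonglongrightarrow> 0"
    proof -
      have "(\<lambda>n. 1 / real (Suc n)) \<longlonglongrightarrow> 0"
        using LIMSEQ_inverse_real_of_nat by (simp add: inverse_eq_divide)
      then have "(\<lambda>n. 1 / real (Suc n) + sqrt (1 / real (Suc n)) * (norm (iota A a) + 1)) \<longlonglongrightarrow> 0 + sqrt 0 * (norm (iota A a) + 1)"
        by (intro tendsto_intros)
      then show ?thesis by simp
    qed
    have "(\<lambda>n. ?q * iota A a * ?q - ofc (l n) * ?q) \<longlonglongrightarrow> 0"
      by (rule Lim_null_comparison[OF _ lim]) (use l in auto)
    then have conv: "(\<lambda>n. ofc (l n) * ?q) \<longlonglongrightarrow> ?q * iota A a * ?q"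
      by (rule Lim_transform2[OF tendsto_const])
    \<comment> \<open>Since \<open>q\<close> has norm one, \<open>l\<close> is a Cauchy sequence of
      numbers; its limit gives the exact scalar.\<close>
    then have "Cauchy (\<lambda>n. ofc (l n) * ?q)"
      by (rule LIMSEQ_imp_Cauchy)
    moreover have "norm (ofc (l m) * ?q - ofc (l n) * ?q) = norm (l m - l n)" for m n
      using norm_ofc_mult[of "l m - l n" ?q] nq by (simp add: ofc_diff left_diff_distrib)
    ultimately have "Cauchy l" by (simp add: Cauchy_iff)
    then obtain l' where "l \<longlonglongrightarrow> l'"
      by (auto simp: Cauchy_convergent_iff convergent_def)
    then have "(\<lambda>n. ofc (l n) * ?q) \<longlonglongrightarrow> ofc l' * ?q"
      by (intro tendsto_intros)
    from LIMSEQ_unique[OF conv this] have "iota A (q \<otimes> a \<otimes> q) = iota A (l' \<odot> q)"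
      using a qA by (simp add: iota_mult iota_smult)
    then show ?thesis
      using a qA by (subst (asm) iota_inj) auto
  qed
  then show ?thesis
    using qA qB by (simp add: min_proj_def)
qed

end

lemma large_subalgebra_finite_index:
  fixes a :: "'i \<Rightarrow> 'a"
  assumes "large_subalgebra B A" "finite K" "\<forall>k\<in>K. a k \<in> carrier A" "\<epsilon> > 0"
    "x \<in> positives A" "nrm A x = 1" "y \<in> positives (A\<lparr>carrier := B\<rparr>)" "y \<noteq> \<zero>\<^bsub>A\<^esub>"
  shows "\<exists>g c. g \<in> B \<and> g \<in> positives (A\<lparr>carrier := B\<rparr>) \<and> \<one>\<^bsub>A\<^esub> \<ominus>\<^bsub>A\<^esub> g \<in> positives (A\<lparr>carrier := B\<rparr>) \<and>
    (\<forall>k\<in>K. c k \<in> carrier A) \<and> (\<forall>k\<in>K. nrm A (c k \<ominus>\<^bsub>A\<^esub> a k) < \<epsilon>) \<and>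
    (\<forall>k\<in>K. (\<one>\<^bsub>A\<^esub> \<ominus>\<^bsub>A\<^esub> g) \<otimes>\<^bsub>A\<^esub> c k \<in> B) \<and>
    cuntz_subeq (A\<lparr>carrier := B\<rparr>) g y \<and> cuntz_subeq A g x"
proof -
  obtain h where h: "bij_betw h {0..<card K} K"
    using ex_bij_betw_nat_finite[OF assms(2)] by blast
  define h' where "h' = inv_into {0..<card K} h"
  have h': "h' k < card K" "h (h' k) = k" if "k \<in> K" for k
    using that h inv_into_into[of k h "{0..<card K}"] f_inv_into_f[of k h "{0..<card K}"]
    by (auto simp: h'_def bij_betw_def)
  have ah: "a (h j) \<in> carrier A" if "j < card K" for j
    using h that by (intro bspec[OF assms(3)] bij_betw_apply[OF h]) simp
  show ?thesis
  proof (rule large_subalgebraE[where m = "card K" and a = "\<lambda>j. a (h j)", OF assms(1) ah assms(4-8)])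
    fix g c
    assume g: "g \<in> B" "g \<in> positives (A\<lparr>carrier := B\<rparr>)" "\<one>\<^bsub>A\<^esub> \<ominus>\<^bsub>A\<^esub> g \<in> positives (A\<lparr>carrier := B\<rparr>)"
        "cuntz_subeq (A\<lparr>carrier := B\<rparr>) g y" "cuntz_subeq A g x"
      and c: "\<And>j. j < card K \<Longrightarrow> c j \<in> carrier A" "\<And>j. j < card K \<Longrightarrow> nrm A (c j \<ominus>\<^bsub>A\<^esub> a (h j)) < \<epsilon>"
        "\<And>j. j < card K \<Longrightarrow> (\<one>\<^bsub>A\<^esub> \<ominus>\<^bsub>A\<^esub> g) \<otimes>\<^bsub>A\<^esub> c j \<in> B"
    show ?thesis
    proof (intro exI[of _ g] exI[of _ "\<lambda>k. c (h' k)"] conjI ballI)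
      fix k assume k: "k \<in> K"
      show "c (h' k) \<in> carrier A" "(\<one>\<^bsub>A\<^esub> \<ominus>\<^bsub>A\<^esub> g) \<otimes>\<^bsub>A\<^esub> c (h' k) \<in> B"
        using c h'[OF k] by auto
      show "nrm A (c (h' k) \<ominus>\<^bsub>A\<^esub> a k) < \<epsilon>"
        using c(2)[OF h'(1)[OF k]] h'(2)[OF k] by simp
    qed (fact g)+
  qed
qed

context unital_cstar_algebra
begin

lemma positives_add: "a \<in> positives A \<Longrightarrow> b \<in> positives A \<Longrightarrow> a \<oplus> b \<in> positives A"
  by (auto simp: positives_iff_cpos iota_add cpos_add)

lemma zero_in_positives: "\<zero> \<in> positives A"
  by (simp add: positives_iff_cpos)

lemma carrier_is_unital_cstar_subalgebra: "unital_cstar_subalgebra (carrier A) A"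
  by (auto simp: unital_cstar_subalgebra_def carrier_is_subring star_closed closedin_iota)

lemma update_carrier [simp]: "A\<lparr>carrier := carrier A\<rparr> = A"
  by simp

lemma finite_cstar_finite_corner:
  assumes "finite_cstar A"
  shows "C.finite_corner"
  unfolding C.finite_corner_def
proof (intro allI impI, elim conjE)
  fix s assume s: "iota A \<one> * s = s" "adj s * s = iota A \<one>"
  have isb: "iota A (ev A s) = s" using s(1) by (simp add: iota_ev_iff)
  have "(ev A s)\<^sup>\<star> \<otimes> ev A s = ev A (adj s * s)" by (simp add: ev_A)
  also have "\<dots> = \<one>" by (simp add: s(2))
  finally have "ev A s \<otimes> (ev A s)\<^sup>\<star> = \<one>"
    using assms by (simp add: finite_cstar_def)
  then have "iota A (ev A s \<otimes> (ev A s)\<^sup>\<star>) = iota A \<one>" by simp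
  then show "s * adj s = iota A \<one>"
    by (simp add: iota_mult iota_star star_closed isb)
qed

text \<open>Largeness is formulated for \<open>x\<close> of norm one. Scaling the \<open>V i\<close>
  by a factor \<open>r\<close> scales the common copy by \<open>r * r\<close>, so the root of the
  inverse norm of \<open>e\<close> is the right factor.\<close>

lemma orthogonal_copies_normalized:
  assumes "C.full" "\<nexists>q. min_proj q" "y \<in> positives A" "y \<noteq> \<zero>"
  shows "\<exists>V e. (\<forall>i<N::nat. V i \<in> carrier A) \<and> e \<in> positives A \<and> nrm A e = 1 \<and>
    (\<forall>i<N. \<forall>j<N. V i \<otimes> y \<otimes> (V j)\<^sup>\<star> = (if i = j then e else \<zero>))"
proof -
  obtain V e where V: "\<forall>i<N. V i \<in> carrier A" and e: "e \<in> positives A" "e \<noteq> \<zero>"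
    and VV: "\<forall>i<N. \<forall>j<N. V i \<otimes> y \<otimes> (V j)\<^sup>\<star> = (if i = j then e else \<zero>)"
    using orthogonal_copies_carrier[OF assms, of N] by (elim exE conjE)
  have yA: "y \<in> carrier A" and eA: "e \<in> carrier A" using assms e by (auto simp: positives_def)
  have ne: "nrm A e > 0" using nrm_ge_0[OF eA] nrm_eq_0[OF eA] e by linarith
  define r where "r = complex_of_real (1 / sqrt (nrm A e))"
  have rr: "r * r = complex_of_real (1 / nrm A e)" "cnj r = r"
    using ne by (simp_all add: r_def flip: of_real_mult)
  show ?thesis
  proof (intro exI[of _ "\<lambda>i. r \<odot> V i"] exI[of _ "(r * r) \<odot> e"] conjI allI impI)
    show "(r * r) \<odot> e \<in> positives A"
      using e eA cpos_scaleR[of "iota A e" "1 / nrm A e"]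
      unfolding positives_iff_cpos iota_smult[OF eA] rr(1) ofc_of_real scaleR_conv_of_real by simp
    show "nrm A ((r * r) \<odot> e) = 1"
      using ne eA by (simp add: nrm_smult rr norm_divide)
    fix i j assume ij: "i < N" "j < N"
    then have Vij: "V i \<in> carrier A" "V j \<in> carrier A" using V by auto
    have "(r \<odot> V i) \<otimes> y \<otimes> (r \<odot> V j)\<^sup>\<star> = (r * r) \<odot> (V i \<otimes> y \<otimes> (V j)\<^sup>\<star>)"
      using Vij yA by (simp add: star_smult star_closed smult_mult_left smult_mult_right smult_smult rr(2))
    then show "(r \<odot> V i) \<otimes> y \<otimes> (r \<odot> V j)\<^sup>\<star> = (if i = j then (r * r) \<odot> e else \<zero>)"
      using VV ij by simp
  qed (use V in auto)
qed

lemma subalgebra_finsum_positives: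
  assumes B: "unital_cstar_subalgebra B A" and "finite I" "\<And>i. i \<in> I \<Longrightarrow> f i \<in> positives (A\<lparr>carrier := B\<rparr>)"
  shows "(\<Oplus>i\<in>I. f i) \<in> positives (A\<lparr>carrier := B\<rparr>)"
  using assms(2,3)
proof (induction I rule: finite_induct)
  interpret B: unital_cstar_algebra "A\<lparr>carrier := B\<rparr>" by (rule subalgebra_is_cstar[OF B])
  case empty
  show ?case using B.zero_in_positives by simp
next
  interpret B: unital_cstar_algebra "A\<lparr>carrier := B\<rparr>" by (rule subalgebra_is_cstar[OF B])
  case (insert x I)
  have "f i \<in> carrier A" if "i \<in> insert x I" for i
    using positives_subalgebra(1)[OF B insert.prems[OF that]] by (simp add: positives_def)
  then have "(\<Oplus>i\<in>insert x I. f i) = f x \<oplus> (\<Oplus>i\<in>I. f i)"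
    using insert.hyps by (subst finsum_insert) auto
  then show ?case
    using B.positives_add[of "f x" "\<Oplus>i\<in>I. f i"] insert by simp
qed

end

section \<open>Matrix algebras over simple C*-algebras\<close>

lemma (in unital_cstar_algebra) subring_finsum_closed:
  assumes "subring B A" "finite I" "\<And>i. i \<in> I \<Longrightarrow> f i \<in> B"
  shows "(\<Oplus>i\<in>I. f i) \<in> B"
  using assms(2,3)
proof (induction I rule: finite_induct)
  case empty
  then show ?case using subringE(2)[OF assms(1)] by simp
next
  case (insert x I)
  have "f i \<in> carrier A" if "i \<in> insert x I" for i
    using insert.prems[OF that] subringE(1)[OF assms(1)] by blast
  then show ?case
    using insert subringE(7)[OF assms(1), of "f x" "\<Oplus>i\<in>I. f i"] by (subst finsum_insert) auto
qed

context unital_cstar_algebra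
begin

context
  fixes n :: nat and M :: "'a mat star_alg"
  defines "M \<equiv> matrix_algebra n A"
begin

interpretation M: unital_cstar_algebra M
  unfolding M_def by (rule matrix_algebra_cstar)

lemmas cM = carrier_M[of n, folded M_def]
lemmas EM = E_M[of _ n _, folded M_def]
lemmas EM_minus = E_M_minus[of _ n, folded M_def]
lemmas M_eq = M_eqI[of _ n, folded M_def]
lemmas nM = nrm_M[of _ n, folded M_def]
lemma iota_M_tendsto_iff:
  assumes "\<And>m. X m \<in> carrier M" "L \<in> carrier M"
  shows "(\<lambda>m. iota M (X m)) \<longlonglongrightarrow> iota M L \<longleftrightarrow> (\<forall>i<n. \<forall>j<n. (\<lambda>m. E (X m) i j) \<longlonglongrightarrow> E L i j)"
proof
  have nrm: "norm (iota M (X m) - iota M L) = opn n (\<lambda>i j. E (X m) i j - E L i j)" for m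
  proof -
    have "norm (iota M (X m) - iota M L) = nrm M (X m \<ominus>\<^bsub>M\<^esub> L)"
      using assms by (simp flip: M.iota_diff)
    also have "\<dots> = opn n (E (X m \<ominus>\<^bsub>M\<^esub> L))"
      using assms by (intro nM) auto
    also have "\<dots> = opn n (\<lambda>i j. E (X m) i j - E L i j)"
      using assms by (intro opn_cong EM_minus) auto
    finally show ?thesis .
  qed
  show "\<forall>i<n. \<forall>j<n. (\<lambda>m. E (X m) i j) \<longlonglongrightarrow> E L i j" if "(\<lambda>m. iota M (X m)) \<longlonglongrightarrow> iota M L"
  proof (intro allI impI, rule LIM_zero_cancel)
    fix i j assume ij: "i < n" "j < n"
    have lim: "(\<lambda>m. norm (iota M (X m) - iota M L)) \<longlonglongrightarrow> 0"
      by (rule tendsto_norm_zero[OF LIM_zero[OF that]])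
    have "norm (E (X m) i j - E L i j) \<le> norm (iota M (X m) - iota M L)" for m
      unfolding nrm using norm_entry_le_opn[OF ij, of "\<lambda>i j. E (X m) i j - E L i j"] .
    then show "(\<lambda>m. E (X m) i j - E L i j) \<longlonglongrightarrow> 0"
      by (rule Lim_null_comparison[OF always_eventually[OF allI] lim])
  qed
  assume lim: "\<forall>i<n. \<forall>j<n. (\<lambda>m. E (X m) i j) \<longlonglongrightarrow> E L i j"
  have "(\<lambda>m. \<Sum>i<n. \<Sum>j<n. norm (E (X m) i j - E L i j)) \<longlonglongrightarrow> (\<Sum>i<n. \<Sum>j<n. 0)"
    using lim by (intro tendsto_sum tendsto_norm_zero LIM_zero) auto
  then have slim: "(\<lambda>m. \<Sum>i<n. \<Sum>j<n. norm (E (X m) i j - E L i j)) \<longlonglongrightarrow> 0" by simp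
  have "norm (iota M (X m) - iota M L) \<le> (\<Sum>i<n. \<Sum>j<n. norm (E (X m) i j - E L i j))" for m
    unfolding nrm by (rule opn_le_sum)
  then show "(\<lambda>m. iota M (X m)) \<longlonglongrightarrow> iota M L"
    by (rule LIM_zero_cancel[OF Lim_null_comparison[OF always_eventually[OF allI] slim]])
qed

section \<open>Matrix units, simplicity and infinite dimension\<close>

definition unit_mat :: "nat \<Rightarrow> nat \<Rightarrow> 'a \<Rightarrow> 'a mat" where
  "unit_mat i j a = mat_of n (\<lambda>k l. if k = i \<and> l = j then iota A a else 0)"

lemma unit_mat_closed [simp]: "unit_mat i j a \<in> carrier M"
  by (simp add: unit_mat_def cM)

lemma E_unit_mat:
  "a \<in> carrier A \<Longrightarrow> k < n \<Longrightarrow> l < n \<Longrightarrow> E (unit_mat i j a) k l = (if k = i \<and> l = j then iota A a else 0)"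
  by (simp add: unit_mat_def E_mat_of)

lemma unit_mat_sandwich:
  assumes X: "X \<in> carrier M" and ij: "i < n" "j < n" "k < n" "l < n" and ab: "a \<in> carrier A" "b \<in> carrier A"
  shows "unit_mat k i a \<otimes>\<^bsub>M\<^esub> X \<otimes>\<^bsub>M\<^esub> unit_mat j l b = unit_mat k l (a \<otimes> X $$ (i, j) \<otimes> b)"
proof (rule M_eq)
  have Xij: "X $$ (i, j) \<in> carrier A"
    using X ij by (auto simp: cM mats_over_iff)
  fix r s assume rs: "r < n" "s < n"
  have "E (unit_mat k i a \<otimes>\<^bsub>M\<^esub> X) r t = (if r = k then iota A a * E X i t else 0)" if "t < n" for t
    using X rs that ij ab
    by (simp add: EM mmul_def E_unit_mat if_distribR if_distrib[of "\<lambda>x. x * _"] sum.delta' conj_commute cong: if_cong conj_cong)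
  then have "E (unit_mat k i a \<otimes>\<^bsub>M\<^esub> X \<otimes>\<^bsub>M\<^esub> unit_mat j l b) r s
      = (\<Sum>t<n. (if r = k then iota A a * E X i t else 0) * (if t = j \<and> s = l then iota A b else 0))"
    using X rs ab by (simp add: EM mmul_def E_unit_mat)
  also have "\<dots> = (\<Sum>t<n. if t = j then (if r = k \<and> s = l then iota A a * E X i j * iota A b else 0) else 0)"
    by (intro sum.cong refl) auto
  also have "\<dots> = (if r = k \<and> s = l then iota A a * E X i j * iota A b else 0)"
    using ij by simp
  also have "\<dots> = E (unit_mat k l (a \<otimes> X $$ (i, j) \<otimes> b)) r s"
    using rs ab Xij by (simp add: E_unit_mat iota_mult) (simp add: E_def)
  finally show "E (unit_mat k i a \<otimes>\<^bsub>M\<^esub> X \<otimes>\<^bsub>M\<^esub> unit_mat j l b) r s = E (unit_mat k l (a \<otimes> X $$ (i, j) \<otimes> b)) r s" .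
qed (use X in auto)

lemma unit_mat_entry: "i < n \<Longrightarrow> j < n \<Longrightarrow> a \<in> carrier A \<Longrightarrow> unit_mat i j a $$ (i, j) = a"
  by (simp add: unit_mat_def mat_of_def)

text \<open>For a closed ideal \<open>I\<close> of matrices, the \<open>a\<close> with
  \<open>unit_mat 0 0 a \<in> I\<close> form a closed ideal \<open>J\<close> of \<open>A\<close>.
  Matrix units move any entry of an element of \<open>I\<close> to position \<open>(0, 0)\<close>,
  so \<open>J\<close> is nonzero and thus everything; moving \<open>\<one>\<close> along the
  diagonal and summing gives the unit matrix.\<close>

lemma matrix_algebra_simple:
  assumes n: "n \<ge> 1" and simple: "simple_cstar A"
  shows "simple_cstar M"
proof -
  have one: "\<one> \<noteq> \<zero>"
    using simple one_zeroD by (auto simp: simple_cstar_def)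
  have 0: "0 < n" using n by simp
  have "E \<one>\<^bsub>M\<^esub> 0 0 \<noteq> E \<zero>\<^bsub>M\<^esub> 0 0"
    using 0 one by (simp add: EM iota_eq_0_iff)
  then have "\<one>\<^bsub>M\<^esub> \<noteq> \<zero>\<^bsub>M\<^esub>" by metis
  then have "carrier M \<noteq> {\<zero>\<^bsub>M\<^esub>}" using M.one_closed by blast
  moreover have "I = carrier M" if I: "ideal I M" and cl: "closedin (norm_topology M) I" and nz: "I \<noteq> {\<zero>\<^bsub>M\<^esub>}" for I
  proof -
    interpret I: ideal I M by (rule I)
    have IM: "X \<in> carrier M" if "X \<in> I" for X using I.a_subset that by auto
    have Isand: "X \<otimes>\<^bsub>M\<^esub> Y \<otimes>\<^bsub>M\<^esub> Z \<in> I" if "Y \<in> I" "X \<in> carrier M" "Z \<in> carrier M" for X Y Z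
      using that by (intro I.I_r_closed I.I_l_closed)
    define J where "J = {a \<in> carrier A. unit_mat 0 0 a \<in> I}"
    have uadd: "unit_mat 0 0 (a \<oplus> b) = unit_mat 0 0 a \<oplus>\<^bsub>M\<^esub> unit_mat 0 0 b" if "a \<in> carrier A" "b \<in> carrier A" for a b
      using that by (intro M_eq) (auto simp: E_unit_mat EM iota_add)
    have umult: "unit_mat 0 0 (a \<otimes> b \<otimes> c) = unit_mat 0 0 a \<otimes>\<^bsub>M\<^esub> unit_mat 0 0 b \<otimes>\<^bsub>M\<^esub> unit_mat 0 0 c"
      if "a \<in> carrier A" "b \<in> carrier A" "c \<in> carrier A" for a b c
      using unit_mat_sandwich[of "unit_mat 0 0 b" 0 0 0 0 a c] that 0 by (simp add: unit_mat_entry)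
    have "ideal J A"
    proof (rule idealI)
      show "ring A" by (rule ring_axioms)
      show "subgroup J (add_monoid A)"
      proof (rule add.subgroupI)
        have "unit_mat 0 0 \<zero> = \<zero>\<^bsub>M\<^esub>"
          by (intro M_eq) (auto simp: E_unit_mat EM)
        then show "J \<noteq> {}" using I.zero_closed by (auto simp: J_def intro!: exI[of _ \<zero>])
        fix a assume a: "a \<in> J"
        have "unit_mat 0 0 (\<ominus> a) = unit_mat 0 0 (\<ominus> \<one> \<otimes> a \<otimes> \<one>)"
          using a by (simp add: J_def l_minus)
        also have "\<dots> \<in> I"
          using a by (subst umult) (auto simp: J_def intro: Isand)
        finally show "\<ominus> a \<in> J" using a by (simp add: J_def)
      qed (auto simp: J_def uadd)
    next
      fix a x assume a: "a \<in> J" and x: "x \<in> carrier A"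
      have "unit_mat 0 0 (x \<otimes> a \<otimes> \<one>) \<in> I" "unit_mat 0 0 (\<one> \<otimes> a \<otimes> x) \<in> I"
        using a x by (subst umult; auto simp: J_def intro: Isand)+
      then show "x \<otimes> a \<in> J" "a \<otimes> x \<in> J"
        using a x by (simp_all add: J_def)
    qed
    moreover have "closedin (norm_topology A) J"
      unfolding closedin_iota
    proof (intro conjI allI impI)
      fix f l assume fl: "(\<forall>m. f m \<in> J) \<and> l \<in> carrier A \<and> (\<lambda>m. iota A (f m)) \<longlonglongrightarrow> iota A l"
      then have fA: "f m \<in> carrier A" "unit_mat 0 0 (f m) \<in> I" for m by (auto simp: J_def)
      have "(\<lambda>m. E (unit_mat 0 0 (f m)) i j) \<longlonglongrightarrow> E (unit_mat 0 0 l) i j" if "i < n" "j < n" for i j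
        using that fA fl by (simp add: E_unit_mat)
      then have "(\<lambda>m. iota M (unit_mat 0 0 (f m))) \<longlonglongrightarrow> iota M (unit_mat 0 0 l)"
        by (subst iota_M_tendsto_iff) auto
      then have "unit_mat 0 0 l \<in> I"
        using cl[unfolded M.closedin_iota, THEN conjunct2, rule_format, of "\<lambda>m. unit_mat 0 0 (f m)" "unit_mat 0 0 l"] fA by simp
      then show "l \<in> J" using fl by (simp add: J_def)
    qed (auto simp: J_def)
    moreover have "J \<noteq> {\<zero>}"
    proof -
      obtain X where X: "X \<in> I" "X \<noteq> \<zero>\<^bsub>M\<^esub>"
        using nz I.zero_closed by blast
      then obtain i j where ij: "i < n" "j < n" "E X i j \<noteq> E \<zero>\<^bsub>M\<^esub> i j"
        using M_eq[OF IM[OF X(1)] M.zero_closed] by blast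
      have c: "X $$ (i, j) \<in> carrier A" using IM[OF X(1)] ij by (auto simp: cM mats_over_iff)
      have "unit_mat 0 0 (\<one> \<otimes> X $$ (i, j) \<otimes> \<one>) \<in> I"
        using unit_mat_sandwich[OF IM[OF X(1)] ij(1,2) 0 0 one_closed one_closed] Isand[OF X(1)] by (metis unit_mat_closed)
      then have "X $$ (i, j) \<in> J" using c by (simp add: J_def)
      moreover have "E \<zero>\<^bsub>M\<^esub> i j = 0" using ij by (simp add: EM)
      then have "X $$ (i, j) \<noteq> \<zero>"
        using ij(3) by (auto simp: E_def[of X])
      ultimately show ?thesis by blast
    qed
    ultimately have "J = carrier A"
      using simple by (auto simp: simple_cstar_def)
    then have u0: "unit_mat 0 0 \<one> \<in> I" by (auto simp: J_def)
    have uii: "unit_mat i i \<one> \<in> I" if "i < n" for i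
      using unit_mat_sandwich[OF unit_mat_closed 0 0 that that one_closed one_closed, of 0 0 \<one>]
        Isand[OF u0 unit_mat_closed unit_mat_closed, of i 0 \<one> 0 i \<one>] 0 by (simp add: unit_mat_entry)
    have "\<exists>X\<in>I. \<forall>k<n. \<forall>l<n. E X k l = (if k = l \<and> k < m then iota A \<one> else 0)" if "m \<le> n" for m
      using that
    proof (induction m)
      case 0
      show ?case using I.zero_closed by (intro bexI[of _ "\<zero>\<^bsub>M\<^esub>"]) (auto simp: EM)
    next
      case (Suc m)
      then obtain X where X: "X \<in> I" "\<forall>k<n. \<forall>l<n. E X k l = (if k = l \<and> k < m then iota A \<one> else 0)" by auto
      have "X \<oplus>\<^bsub>M\<^esub> unit_mat m m \<one> \<in> I"
        using X uii[of m] Suc.prems by (intro I.a_closed) auto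
      moreover have "E (X \<oplus>\<^bsub>M\<^esub> unit_mat m m \<one>) k l = (if k = l \<and> k < Suc m then iota A \<one> else 0)" if "k < n" "l < n" for k l
        using X that IM by (auto simp: EM E_unit_mat)
      ultimately show ?case by blast
    qed
    then obtain X where X: "X \<in> I" "\<forall>k<n. \<forall>l<n. E X k l = (if k = l \<and> k < n then iota A \<one> else 0)"
      by blast
    have "X = \<one>\<^bsub>M\<^esub>"
      using X IM by (intro M_eq) (auto simp: EM)
    then show ?thesis using X I.one_imp_carrier by simp
  qed
  ultimately show ?thesis
    unfolding simple_cstar_def by blast
qed

lemma E_finsum_M:
  "finite S \<Longrightarrow> (\<And>s. s \<in> S \<Longrightarrow> f s \<in> carrier M) \<Longrightarrow> i < n \<Longrightarrow> j < n \<Longrightarrow>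
    E (\<Oplus>\<^bsub>M\<^esub>s\<in>S. f s) i j = (\<Sum>s\<in>S. E (f s) i j)"
proof (induction S rule: finite_induct)
  case (insert x S)
  then show ?case
    by (subst M.finsum_insert) (auto simp: EM)
qed (simp add: EM)

text \<open>The \<open>(0, 0)\<close> entries of a finite spanning set of \<open>M\<close> would
  span \<open>A\<close>, as one sees by expanding \<open>unit_mat 0 0 x\<close>.\<close>

lemma matrix_algebra_infinite_dimensional:
  assumes n: "n \<ge> 1" and inf: "infinite_dimensional A"
  shows "infinite_dimensional M"
  unfolding infinite_dimensional_def
proof (intro notI, elim exE conjE)
  have 0: "0 < n" using n by simp
  fix S assume S: "finite S" "S \<subseteq> carrier M" and span: "\<forall>x\<in>carrier M. \<exists>c. x = (\<Oplus>\<^bsub>M\<^esub>s\<in>S. c s \<odot>\<^bsub>M\<^esub> s)"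
  let ?z = "\<lambda>X. X $$ (0, 0)"
  have z: "?z X \<in> carrier A" if "X \<in> S" for X
    using that S(2) 0 by (auto simp: cM mats_over_iff subset_eq)
  have "\<exists>c. x = (\<Oplus>s\<in>?z ` S. c s \<odot> s)" if x: "x \<in> carrier A" for x
  proof -
    obtain c where c: "unit_mat 0 0 x = (\<Oplus>\<^bsub>M\<^esub>s\<in>S. c s \<odot>\<^bsub>M\<^esub> s)"
      using span unit_mat_closed by blast
    have "iota A x = E (unit_mat 0 0 x) 0 0"
      using x 0 by (simp add: E_unit_mat)
    also have "\<dots> = (\<Sum>s\<in>S. ofc (c s) * iota A (?z s))"
      unfolding c using S 0 by (subst E_finsum_M) (auto simp: EM E_def[symmetric] intro!: sum.cong)
    finally show ?thesis
      using z S by (intro finsum_regroup[OF x]) auto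
  qed
  moreover have "finite (?z ` S)" "?z ` S \<subseteq> carrier A"
    using z S by auto
  ultimately show False
    using inf unfolding infinite_dimensional_def by blast
qed

lemma matrix_algebra_subalgebra:
  assumes B: "unital_cstar_subalgebra B A"
  shows "unital_cstar_subalgebra (mats_over n n B) M"
proof -
  have sub: "subring B A" and cl: "closedin (norm_topology A) B"
    and sm: "\<And>c x. x \<in> B \<Longrightarrow> c \<odot> x \<in> B" and st: "\<And>x. x \<in> B \<Longrightarrow> x\<^sup>\<star> \<in> B"
    using B by (auto simp: unital_cstar_subalgebra_def)
  have BA: "x \<in> carrier A" if "x \<in> B" for x using subringE(1)[OF sub] that by blast
  have MB: "X \<in> carrier M" if "X \<in> mats_over n n B" for X
    using that BA by (auto simp: cM mats_over_iff)
  have neg: "\<ominus>\<^bsub>M\<^esub> X \<in> mats_over n n B" if X: "X \<in> mats_over n n B" for X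
  proof -
    have "\<ominus>\<^bsub>M\<^esub> X = (- 1) \<odot>\<^bsub>M\<^esub> X" using MB[OF X] by (rule M.a_inv_eq_smult)
    then show ?thesis
      using X sm by (auto simp: M_def matrix_algebra_simps mats_over_iff)
  qed
  have mult: "X \<otimes>\<^bsub>M\<^esub> Y \<in> mats_over n n B" if "X \<in> mats_over n n B" "Y \<in> mats_over n n B" for X Y
    using that subringE(6)[OF sub]
    by (auto simp: M_def matrix_algebra_simps mats_over_iff mat_times_def intro!: subring_finsum_closed[OF sub])
  have "subring (mats_over n n B) M"
  proof (rule M.subringI)
    show "mats_over n n B \<subseteq> carrier M" using MB by blast
    show "\<one>\<^bsub>M\<^esub> \<in> mats_over n n B"
      using subringE(2,3)[OF sub] by (auto simp: M_def matrix_algebra_simps mats_over_iff)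
    show "X \<oplus>\<^bsub>M\<^esub> Y \<in> mats_over n n B" if "X \<in> mats_over n n B" "Y \<in> mats_over n n B" for X Y
      using that subringE(7)[OF sub] by (auto simp: M_def matrix_algebra_simps mats_over_iff)
  qed (fact neg mult)+
  moreover have "c \<odot>\<^bsub>M\<^esub> X \<in> mats_over n n B" "star M X \<in> mats_over n n B" if "X \<in> mats_over n n B" for c X
    using that sm st by (auto simp: M_def matrix_algebra_simps mats_over_iff mat_star_def)
  moreover have "closedin (norm_topology M) (mats_over n n B)"
    unfolding M.closedin_iota
  proof (intro conjI allI impI)
    show "mats_over n n B \<subseteq> carrier M" using MB by blast
    fix F L assume FL: "(\<forall>m. F m \<in> mats_over n n B) \<and> L \<in> carrier M \<and> (\<lambda>m. iota M (F m)) \<longlonglongrightarrow> iota M L"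
    then have F: "F m \<in> mats_over n n B" "F m \<in> carrier M" and L: "L \<in> carrier M" for m using MB by auto
    have lim: "(\<lambda>m. E (F m) i j) \<longlonglongrightarrow> E L i j" if "i < n" "j < n" for i j
      using iffD1[OF iota_M_tendsto_iff[of F L, OF F(2) L]] FL that by blast
    have "L $$ (i, j) \<in> B" if "i < n" "j < n" for i j
      using cl[unfolded closedin_iota, THEN conjunct2, rule_format, of "\<lambda>m. F m $$ (i, j)" "L $$ (i, j)"]
        lim[OF that] F(1) L that by (auto simp: E_def mats_over_iff cM)
    then show "L \<in> mats_over n n B"
      using L by (auto simp: cM mats_over_iff)
  qed
  ultimately show ?thesis
    by (simp add: unital_cstar_subalgebra_def)
qed

subsection \<open>Stable largeness\<close>

definition diag :: "'a \<Rightarrow> 'a mat" where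
  "diag a = mat_of n (\<lambda>i j. if i = j then iota A a else 0)"

lemma diag_closed [simp]: "diag a \<in> carrier M"
  by (simp add: diag_def cM)

lemma E_diag: "a \<in> carrier A \<Longrightarrow> i < n \<Longrightarrow> j < n \<Longrightarrow> E (diag a) i j = (if i = j then iota A a else 0)"
  by (simp add: diag_def E_mat_of)

lemma diag_entry: "a \<in> carrier A \<Longrightarrow> i < n \<Longrightarrow> j < n \<Longrightarrow> diag a $$ (i, j) = (if i = j then a else \<zero>)"
  by (simp add: diag_def mat_of_def ev_A)

lemma E_diag_mult:
  assumes "a \<in> carrier A" "X \<in> carrier M" "i < n" "j < n"
  shows "E (diag a \<otimes>\<^bsub>M\<^esub> X) i j = iota A a * E X i j"
proof -
  have "E (diag a \<otimes>\<^bsub>M\<^esub> X) i j = (\<Sum>k<n. (if i = k then iota A a else 0) * E X k j)"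
    using assms by (simp add: EM mmul_def E_diag)
  also have "\<dots> = (\<Sum>k<n. if i = k then iota A a * E X k j else 0)"
    by (intro sum.cong refl) auto
  also have "\<dots> = iota A a * E X i j"
    using assms by simp
  finally show ?thesis .
qed

lemma diag_mult_entry:
  assumes "a \<in> carrier A" "X \<in> carrier M" "i < n" "j < n"
  shows "(diag a \<otimes>\<^bsub>M\<^esub> X) $$ (i, j) = a \<otimes> X $$ (i, j)"
proof -
  have X: "X $$ (i, j) \<in> carrier A" "(diag a \<otimes>\<^bsub>M\<^esub> X) $$ (i, j) \<in> carrier A"
    using assms(2-4) M.m_closed[OF diag_closed[of a] assms(2)] unfolding cM mats_over_iff by blast+
  have "iota A ((diag a \<otimes>\<^bsub>M\<^esub> X) $$ (i, j)) = iota A (a \<otimes> X $$ (i, j))"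
    using E_diag_mult[OF assms] assms X by (simp add: E_def iota_mult)
  then show ?thesis using X assms by (subst (asm) iota_inj) auto
qed

lemma diag_mult: "a \<in> carrier A \<Longrightarrow> b \<in> carrier A \<Longrightarrow> diag (a \<otimes> b) = diag a \<otimes>\<^bsub>M\<^esub> diag b"
  by (intro M_eq) (auto simp: E_diag_mult E_diag iota_mult)

lemma diag_star: "a \<in> carrier A \<Longrightarrow> diag (a\<^sup>\<star>) = star M (diag a)"
  by (intro M_eq) (auto simp: E_diag EM madj_def iota_star star_closed M.star_closed)

lemma diag_one: "diag \<one> = \<one>\<^bsub>M\<^esub>"
  by (intro M_eq) (auto simp: E_diag EM)

lemma diag_zero: "diag \<zero> = \<zero>\<^bsub>M\<^esub>"
  by (intro M_eq) (auto simp: E_diag EM)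

lemma diag_minus: "a \<in> carrier A \<Longrightarrow> b \<in> carrier A \<Longrightarrow> diag (a \<ominus> b) = diag a \<ominus>\<^bsub>M\<^esub> diag b"
  by (intro M_eq) (auto simp: E_diag EM_minus iota_diff)

lemma diag_tendsto:
  assumes "\<And>m. f m \<in> carrier A" "l \<in> carrier A" "(\<lambda>m. iota A (f m)) \<longlonglongrightarrow> iota A l"
  shows "(\<lambda>m. iota M (diag (f m))) \<longlonglongrightarrow> iota M (diag l)"
  using assms by (subst iota_M_tendsto_iff) (auto simp: E_diag)

lemma diag_in_mats_over:
  assumes "subring B A" "a \<in> B"
  shows "diag a \<in> mats_over n n B"
proof -
  have "a \<in> carrier A" using subringE(1)[OF assms(1)] assms(2) by blast
  then show ?thesis
    using diag_entry subringE(2)[OF assms(1)] assms(2) by (auto simp: mats_over_iff diag_def mat_of_def ev_A)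
qed

lemma diag_positive:
  assumes B: "unital_cstar_subalgebra B A" and a: "a \<in> positives (A\<lparr>carrier := B\<rparr>)"
  shows "diag a \<in> positives (M\<lparr>carrier := mats_over n n B\<rparr>)"
proof -
  have sub: "subring B A" using B by (simp add: unital_cstar_subalgebra_def)
  interpret B: unital_cstar_algebra "A\<lparr>carrier := B\<rparr>" by (rule subalgebra_is_cstar[OF B])
  interpret MB: unital_cstar_algebra "M\<lparr>carrier := mats_over n n B\<rparr>"
    by (rule M.subalgebra_is_cstar) (rule matrix_algebra_subalgebra[OF B])
  obtain s where s: "s \<in> B" "a = s\<^sup>\<star> \<otimes> s"
    using a by (auto simp: B.positives_iff_square)
  have sA: "s \<in> carrier A" using s subringE(1)[OF sub] by blast
  have "diag a = star M (diag s) \<otimes>\<^bsub>M\<^esub> diag s"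
    unfolding s(2) using sA by (simp add: diag_mult diag_star star_closed)
  then show ?thesis
    unfolding MB.positives_iff_square using diag_in_mats_over[OF sub s(1)] by auto
qed

text \<open>Writing \<open>X\<close> as \<open>star s\<close> times \<open>s\<close>, each diagonal
  entry is the inner square of a column of \<open>s\<close>. It is positive, and if all of them
  vanished, all columns would.\<close>

lemma positive_diagonal_entry:
  assumes B: "unital_cstar_subalgebra B A" and X: "X \<in> positives (M\<lparr>carrier := mats_over n n B\<rparr>)" "X \<noteq> \<zero>\<^bsub>M\<^esub>"
  shows "\<exists>i<n. X $$ (i, i) \<in> positives (A\<lparr>carrier := B\<rparr>) \<and> X $$ (i, i) \<noteq> \<zero>"
proof -
  have sub: "subring B A" using B by (simp add: unital_cstar_subalgebra_def)
  interpret B: unital_cstar_algebra "A\<lparr>carrier := B\<rparr>" by (rule subalgebra_is_cstar[OF B])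
  interpret MB: unital_cstar_algebra "M\<lparr>carrier := mats_over n n B\<rparr>"
    by (rule M.subalgebra_is_cstar) (rule matrix_algebra_subalgebra[OF B])
  obtain s where s: "s \<in> mats_over n n B" "X = star M s \<otimes>\<^bsub>M\<^esub> s"
    using X(1) by (auto simp: MB.positives_iff_square)
  have sB: "s $$ (i, j) \<in> B" "s $$ (i, j) \<in> carrier A" if "i < n" "j < n" for i j
    using s(1) that subringE(1)[OF sub] by (auto simp: mats_over_iff)
  have sM: "s \<in> carrier M" using s(1) sB by (auto simp: cM mats_over_iff)
  have Xii: "X $$ (i, i) \<in> positives (A\<lparr>carrier := B\<rparr>)" if i: "i < n" for i
  proof -
    have "X $$ (i, i) = (\<Oplus>k\<in>{..<n}. (s $$ (k, i))\<^sup>\<star> \<otimes> s $$ (k, i))"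
      using s i sB by (auto simp: M_def matrix_algebra_simps mat_times_def mat_star_def mats_over_iff star_closed intro!: finsum_cong')
    also have "\<dots> \<in> positives (A\<lparr>carrier := B\<rparr>)"
      using sB i by (intro subalgebra_finsum_positives[OF B]) (auto simp: B.positives_iff_square)
    finally show ?thesis .
  qed
  have "\<exists>i<n. X $$ (i, i) \<noteq> \<zero>"
  proof (rule ccontr)
    assume "\<not> ?thesis"
    then have z: "E X i i = 0" if "i < n" for i using that by (simp add: E_def)
    have "E s k i = 0" if "k < n" "i < n" for k i
    proof -
      have "ip n (\<lambda>k. E s k i) (\<lambda>k. E s k i) = E X i i"
        using that sM s(2) by (simp add: EM M.star_closed mmul_def madj_def ip_def)
      then have "cn n (\<lambda>k. E s k i) = 0"
        using z that by (simp add: cn_def)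
      then show ?thesis using cn_zero[of n "\<lambda>k. E s k i" k] that by simp
    qed
    then have "s = \<zero>\<^bsub>M\<^esub>"
      using sM by (intro M_eq) (auto simp: EM)
    then show False using X(2) s(2) by simp
  qed
  then show ?thesis using Xii by blast
qed

text \<open>
  The rows \<open>V\<^sub>i\<close> placed in column \<open>l\<close> compress \<open>X\<close> to \<open>diag f\<close>, so that every \<open>g\<close> below \<open>f\<close>
  gives \<open>diag g\<close> below \<open>X\<close>.
\<close>

lemma cuntz_subeq_diag:
  assumes B: "unital_cstar_subalgebra B A" and X: "X \<in> mats_over n n B" and l: "l < n"
    and V: "\<And>i. i < n \<Longrightarrow> V i \<in> B"
    and VX: "\<And>i j. i < n \<Longrightarrow> j < n \<Longrightarrow> V i \<otimes> X $$ (l, l) \<otimes> (V j)\<^sup>\<star> = (if i = j then f else \<zero>)"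
    and f: "f \<in> B" and g: "g \<in> B" "cuntz_subeq (A\<lparr>carrier := B\<rparr>) g f"
  shows "cuntz_subeq (M\<lparr>carrier := mats_over n n B\<rparr>) (diag g) X"
proof -
  let ?BM = "mats_over n n B"
  have sub: "subring B A" using B by (simp add: unital_cstar_subalgebra_def)
  have BA: "x \<in> carrier A" if "x \<in> B" for x using subringE(1)[OF sub] that by blast
  have BM: "unital_cstar_subalgebra ?BM M" by (rule matrix_algebra_subalgebra[OF B])
  interpret B: unital_cstar_algebra "A\<lparr>carrier := B\<rparr>" by (rule subalgebra_is_cstar[OF B])
  interpret MB: unital_cstar_algebra "M\<lparr>carrier := ?BM\<rparr>" by (rule M.subalgebra_is_cstar[OF BM])
  have MA: "Y \<in> carrier M" if "Y \<in> ?BM" for Y using that BA by (auto simp: cM mats_over_iff)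
  obtain v where v: "\<And>m. v m \<in> B" and lim: "limitin (norm_topology (A\<lparr>carrier := B\<rparr>)) (\<lambda>m. v m \<otimes> f \<otimes> (v m)\<^sup>\<star>) g sequentially"
    using g(2) by (auto simp: cuntz_subeq_def)
  have vfv: "v m \<otimes> f \<otimes> (v m)\<^sup>\<star> \<in> B" for m
    using v[of m] f B.m_closed B.star_closed[of "v m"] by auto
  have "(\<lambda>m. iota (A\<lparr>carrier := B\<rparr>) (v m \<otimes> f \<otimes> (v m)\<^sup>\<star>)) \<longlonglongrightarrow> iota (A\<lparr>carrier := B\<rparr>) g"
    using lim vfv g(1) by (subst (asm) B.limitin_iota) auto
  then have lim': "(\<lambda>m. iota A (v m \<otimes> f \<otimes> (v m)\<^sup>\<star>)) \<longlonglongrightarrow> iota A g"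
    using tendsto_iota_subalgebra[OF B vfv g(1)] by (rule iffD1[rotated])
  define W where "W = mat n n (\<lambda>(r, c). if c = l then V r else \<zero>)"
  have W: "W \<in> ?BM"
    using V subringE(2)[OF sub] by (simp add: W_def mats_over_iff)
  have EW: "E W r c = (if c = l then iota A (V r) else 0)" if "r < n" "c < n" for r c
    using that by (simp add: W_def E_def)
  have XW: "X \<in> carrier M" "W \<in> carrier M" using X W MA by auto
  have Xll: "X $$ (l, l) \<in> carrier A" using XW(1) l by (auto simp: cM mats_over_iff)
  have WXW: "W \<otimes>\<^bsub>M\<^esub> X \<otimes>\<^bsub>M\<^esub> star M W = diag f"
  proof (rule M_eq)
    fix r s assume rs: "r < n" "s < n"
    have WX: "E (W \<otimes>\<^bsub>M\<^esub> X) r t = iota A (V r) * E X l t" if "t < n" for t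
    proof -
      have "E (W \<otimes>\<^bsub>M\<^esub> X) r t = (\<Sum>c<n. (if c = l then iota A (V r) else 0) * E X c t)"
        using XW rs that by (simp add: EM mmul_def EW)
      also have "\<dots> = (\<Sum>c<n. if c = l then iota A (V r) * E X c t else 0)"
        by (intro sum.cong refl) auto
      finally show ?thesis using l by simp
    qed
    have "E (W \<otimes>\<^bsub>M\<^esub> X \<otimes>\<^bsub>M\<^esub> star M W) r s = (\<Sum>t<n. iota A (V r) * E X l t * adj (if t = l then iota A (V s) else 0))"
      unfolding EM(2)[OF rs M.m_closed[OF XW(2,1)] M.star_closed[OF XW(2)]] mmul_def
      using XW rs by (intro sum.cong refl) (simp add: WX EM(6)[OF _ rs(2) XW(2)] madj_def EW)
    also have "\<dots> = (\<Sum>t<n. if t = l then iota A (V r) * E X l t * adj (iota A (V s)) else 0)"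
      by (intro sum.cong refl) auto
    also have "\<dots> = iota A (V r) * E X l l * adj (iota A (V s))"
      using l by simp
    also have "\<dots> = iota A (V r \<otimes> X $$ (l, l) \<otimes> (V s)\<^sup>\<star>)"
      using V rs BA Xll by (simp add: iota_mult iota_star star_closed E_def)
    also have "\<dots> = E (diag f) r s"
      using rs VX f BA by (simp add: E_diag)
    finally show "E (W \<otimes>\<^bsub>M\<^esub> X \<otimes>\<^bsub>M\<^esub> star M W) r s = E (diag f) r s" .
  qed (use XW in \<open>auto simp: M.star_closed\<close>)
  have vM: "diag (v m) \<in> ?BM" for m by (rule diag_in_mats_over[OF sub v])
  \<comment> \<open>Largeness supplies the \<open>v m\<close> that bring \<open>f\<close> to
    \<open>g\<close>; placed on the diagonal after \<open>W\<close> has compressed \<open>X\<close>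
    to \<open>diag f\<close>, they bring \<open>X\<close> to \<open>diag g\<close>.\<close>
  have eq: "(diag (v m) \<otimes>\<^bsub>M\<^esub> W) \<otimes>\<^bsub>M\<^esub> X \<otimes>\<^bsub>M\<^esub> star M (diag (v m) \<otimes>\<^bsub>M\<^esub> W) = diag (v m \<otimes> f \<otimes> (v m)\<^sup>\<star>)" for m
  proof -
    have "(diag (v m) \<otimes>\<^bsub>M\<^esub> W) \<otimes>\<^bsub>M\<^esub> X \<otimes>\<^bsub>M\<^esub> star M (diag (v m) \<otimes>\<^bsub>M\<^esub> W)
        = diag (v m) \<otimes>\<^bsub>M\<^esub> (W \<otimes>\<^bsub>M\<^esub> X \<otimes>\<^bsub>M\<^esub> star M W) \<otimes>\<^bsub>M\<^esub> star M (diag (v m))"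
      using XW by (simp add: M.star_mult M.star_closed M.m_assoc)
    also have "\<dots> = diag (v m \<otimes> f \<otimes> (v m)\<^sup>\<star>)"
      unfolding WXW using BA[OF v] BA[OF f] by (simp add: diag_mult diag_star star_closed)
    finally show ?thesis .
  qed
  have "(\<lambda>m. iota M (diag (v m \<otimes> f \<otimes> (v m)\<^sup>\<star>))) \<longlonglongrightarrow> iota M (diag g)"
    using BA[OF vfv] BA[OF g(1)] lim' by (rule diag_tendsto)
  then have "(\<lambda>m. iota (M\<lparr>carrier := ?BM\<rparr>) (diag (v m \<otimes> f \<otimes> (v m)\<^sup>\<star>))) \<longlonglongrightarrow> iota (M\<lparr>carrier := ?BM\<rparr>) (diag g)"
    by (rule iffD2[OF M.tendsto_iota_subalgebra[OF BM diag_in_mats_over[OF sub vfv] diag_in_mats_over[OF sub g(1)]]])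
  then have "limitin (norm_topology (M\<lparr>carrier := ?BM\<rparr>)) (\<lambda>m. diag (v m \<otimes> f \<otimes> (v m)\<^sup>\<star>)) (diag g) sequentially"
    using diag_in_mats_over[OF sub vfv] diag_in_mats_over[OF sub g(1)] by (subst MB.limitin_iota) auto
  moreover have "diag (v m) \<otimes>\<^bsub>M\<^esub> W \<in> ?BM" for m
    using MB.m_closed[of "diag (v m)" W] vM W by simp
  ultimately show ?thesis
    unfolding cuntz_subeq_def by (intro exI[of _ "\<lambda>m. diag (v m) \<otimes>\<^bsub>M\<^esub> W"]) (simp add: eq)
qed

text \<open>The order of choices matters: \<open>k\<close> from \<open>x\<close> and the tolerance,
  then the copies \<open>e\<close> under an entry of \<open>x\<close> and \<open>f\<close> under an
  entry of \<open>y\<close>, and only then \<open>g\<close> below both by largeness of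
  \<open>B\<close>.\<close>

lemma matrix_algebra_large:
  assumes n: "n \<ge> 1" and large: "large_subalgebra B A" and fin: "finite_cstar M"
  shows "large_subalgebra (mats_over n n B) M"
proof -
  note LA = large_subalgebraD[OF large]
  have sub: "subring B A" using LA(4) by (simp add: unital_cstar_subalgebra_def)
  have BM: "unital_cstar_subalgebra (mats_over n n B) M"
    by (rule matrix_algebra_subalgebra[OF LA(4)])
  have simple_M: "simple_cstar M" by (rule matrix_algebra_simple[OF n LA(3)])
  have inf_M: "infinite_dimensional M" by (rule matrix_algebra_infinite_dimensional[OF n LA(2)])
  interpret B: unital_cstar_algebra "A\<lparr>carrier := B\<rparr>" by (rule subalgebra_is_cstar[OF LA(4)])
  have no_min: "\<nexists>q. min_proj q"
    using min_proj_finite_dimensional[OF simple_full[OF LA(3)]] LA(2) by blast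
  then have no_min_B: "\<nexists>q. B.min_proj q"
    using large_subalgebra_min_proj[OF large] by blast
  note upd = update_carrier M.update_carrier[unfolded cM]
  show ?thesis
    unfolding large_subalgebra_def
  proof (intro conjI allI impI; (elim conjE)?)
    show "unital_cstar_algebra M" by (rule M.unital_cstar_algebra_axioms)
    show "infinite_dimensional M" "simple_cstar M" "unital_cstar_subalgebra (mats_over n n B) M" by fact+
    fix m :: nat and a and \<epsilon> :: real and x y
    assume a: "\<forall>j\<in>{1..m}. a j \<in> carrier M" and \<epsilon>: "0 < \<epsilon>" and x: "x \<in> positives M" "nrm M x = 1"
      and y: "y \<in> positives (M\<lparr>carrier := mats_over n n B\<rparr>) - {\<zero>\<^bsub>M\<^esub>}"
    \<comment> \<open>The norm bound argument works for tolerances below 1; proving it for a smaller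
      tolerance is enough.\<close>
    define \<delta> where "\<delta> = min \<epsilon> (1/2)"
    have \<delta>: "0 < \<delta>" "\<delta> < 1" "\<delta> \<le> \<epsilon>" using \<epsilon> by (auto simp: \<delta>_def)
    have xM: "x \<in> carrier M" "x \<noteq> \<zero>\<^bsub>M\<^esub>" using x by (auto simp: positives_def)
    have x': "cpos (iota M x)" "iota M \<one>\<^bsub>M\<^esub> * iota M x = iota M x" "norm (iota M x) = 1"
      using x xM by (simp_all add: M.positives_iff_cpos)
    obtain k :: nat where k: "\<And>x0 u g v. \<lbrakk>\<And>i. i \<le> k \<Longrightarrow> iota M \<one>\<^bsub>M\<^esub> * u i = u i;
        \<And>i j. i \<le> k \<Longrightarrow> j \<le> k \<Longrightarrow> adj (u i) * u j = (if i = j then x0 else 0); x0 \<noteq> 0;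
        cpos g; iota M \<one>\<^bsub>M\<^esub> * g = g; g \<preceq> iota M \<one>\<^bsub>M\<^esub>; (\<lambda>n. v n * x0 * adj (v n)) \<longlonglongrightarrow> g\<rbrakk>
      \<Longrightarrow> norm ((iota M \<one>\<^bsub>M\<^esub> - g) * iota M x * (iota M \<one>\<^bsub>M\<^esub> - g)) > 1 - \<delta>"
      by (rule M.C.norm_complement_sandwich[OF M.simple_full[OF simple_M] M.finite_cstar_finite_corner[OF fin] x' \<delta>(1,2)])
        (erule that)
    have "\<exists>i<n. x $$ (i, i) \<in> positives A \<and> x $$ (i, i) \<noteq> \<zero>"
      using positive_diagonal_entry[OF carrier_is_unital_cstar_subalgebra, of x] x(1) xM(2) unfolding upd by blast
    then obtain i where i: "i < n" and xi: "x $$ (i, i) \<in> positives A" "x $$ (i, i) \<noteq> \<zero>" by blast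
    obtain l where l: "l < n" and yl: "y $$ (l, l) \<in> positives (A\<lparr>carrier := B\<rparr>)" "y $$ (l, l) \<noteq> \<zero>"
      using positive_diagonal_entry[OF LA(4), of y] y by blast
    \<comment> \<open>\<open>n\<close> copies for the diagonal of \<open>diag g\<close> and
      \<open>k + 1\<close> for the norm bound.\<close>
    define N where "N = max n (Suc k)"
    obtain U e where U': "\<forall>i<N. U i \<in> carrier A" and e: "e \<in> positives A" "nrm A e = 1"
      and UU': "\<forall>r<N. \<forall>s<N. U r \<otimes> x $$ (i, i) \<otimes> (U s)\<^sup>\<star> = (if r = s then e else \<zero>)"
      using orthogonal_copies_normalized[OF simple_full[OF LA(3)] no_min xi, of N] by (elim exE conjE)
    note U = U'[rule_format] and UU = UU'[rule_format]
    have "\<exists>V e. (\<forall>i<n. V i \<in> carrier (A\<lparr>carrier := B\<rparr>)) \<and> e \<in> positives (A\<lparr>carrier := B\<rparr>) \<and>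
        e \<noteq> \<zero>\<^bsub>A\<lparr>carrier := B\<rparr>\<^esub> \<and> (\<forall>i<n. \<forall>j<n. V i \<otimes>\<^bsub>A\<lparr>carrier := B\<rparr>\<^esub> y $$ (l, l)
          \<otimes>\<^bsub>A\<lparr>carrier := B\<rparr>\<^esub> star (A\<lparr>carrier := B\<rparr>) (V j) = (if i = j then e else \<zero>\<^bsub>A\<lparr>carrier := B\<rparr>\<^esub>))"
      using yl by (intro B.orthogonal_copies_carrier B.simple_full large_subalgebra_simple[OF large] no_min_B) simp_all
    then obtain V f where V: "\<forall>i<n. V i \<in> B" and f: "f \<in> positives (A\<lparr>carrier := B\<rparr>)" "f \<noteq> \<zero>"
      and VV: "\<forall>r<n. \<forall>s<n. V r \<otimes> y $$ (l, l) \<otimes> (V s)\<^sup>\<star> = (if r = s then f else \<zero>)"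
      unfolding star_alg.simps partial_object.simps by auto
    define K where "K = {1..m} \<times> {..<n} \<times> {..<n}"
    have aK': "\<forall>t\<in>K. (\<lambda>(j, r, s). a j $$ (r, s)) t \<in> carrier A"
      using a by (auto simp: K_def cM mats_over_iff)
    have finK: "finite K" by (simp add: K_def)
    \<comment> \<open>The operator norm is at most the sum of the norms of the \<open>n * n\<close>
      entries, so errors of at most \<open>\<eta>\<close> add up to at most
      \<open>\<delta> / 2\<close>.\<close>
    define \<eta> where "\<eta> = \<delta> / (2 * real n * real n)"
    have \<eta>: "\<eta> > 0" using \<delta> n by (simp add: \<eta>_def)
    let ?a = "\<lambda>(j, r, s). a j $$ (r, s)"
    obtain g c where g: "g \<in> B" "g \<in> positives (A\<lparr>carrier := B\<rparr>)" "\<one> \<ominus> g \<in> positives (A\<lparr>carrier := B\<rparr>)"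
      and c': "\<forall>t\<in>K. c t \<in> carrier A" "\<forall>t\<in>K. nrm A (c t \<ominus> ?a t) < \<eta>"
        "\<forall>t\<in>K. (\<one> \<ominus> g) \<otimes> c t \<in> B"
      and cuntz: "cuntz_subeq (A\<lparr>carrier := B\<rparr>) g f" "cuntz_subeq A g e"
      using large_subalgebra_finite_index[where a = ?a, OF large finK aK' \<eta> e f] by (elim exE conjE)
    note c = c'[rule_format] and aK = aK'[rule_format]
    have gA: "g \<in> carrier A" using g(1) subringE(1)[OF sub] by blast
    have eA: "e \<in> carrier A" using e by (simp add: positives_def)
    define C where "C = (\<lambda>j. mat n n (\<lambda>(r, s). c (j, r, s)))"
    have C: "C j \<in> carrier M" if "j \<in> {1..m}" for j
      using that c(1) by (auto simp: C_def cM mats_over_iff K_def)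
    have g1: "\<one>\<^bsub>M\<^esub> \<ominus>\<^bsub>M\<^esub> diag g = diag (\<one> \<ominus> g)"
      using gA by (simp add: diag_minus diag_one)
    have yB: "y \<in> mats_over n n B" using y by (simp add: positives_def)
    have gpos: "diag g \<in> positives (M\<lparr>carrier := mats_over n n B\<rparr>)"
      "\<one>\<^bsub>M\<^esub> \<ominus>\<^bsub>M\<^esub> diag g \<in> positives (M\<lparr>carrier := mats_over n n B\<rparr>)"
      using diag_positive[OF LA(4)] g by (simp_all add: g1)
    have fB: "f \<in> B" using f by (simp add: positives_def)
    have close: "nrm M (C j \<ominus>\<^bsub>M\<^esub> a j) < \<epsilon>" if j: "j \<in> {1..m}" for j
    proof -
      have Ca: "C j \<in> carrier M" "a j \<in> carrier M" using C a j by auto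
      have entry: "norm (E (C j \<ominus>\<^bsub>M\<^esub> a j) r s) \<le> \<eta>" if rs: "r < n" "s < n" for r s
      proof -
        have t: "(j, r, s) \<in> K" using j rs by (simp add: K_def)
        have "E (C j \<ominus>\<^bsub>M\<^esub> a j) r s = iota A (c (j, r, s) \<ominus> a j $$ (r, s))"
          using Ca rs c(1)[OF t] aK[OF t] by (simp add: EM_minus iota_diff) (simp add: E_def C_def)
        also have "norm \<dots> = nrm A (c (j, r, s) \<ominus> a j $$ (r, s))"
          using c(1)[OF t] aK[OF t] by simp
        finally show ?thesis using c(2)[OF t] by simp
      qed
      have "nrm M (C j \<ominus>\<^bsub>M\<^esub> a j) \<le> (\<Sum>r<n. \<Sum>s<n. norm (E (C j \<ominus>\<^bsub>M\<^esub> a j) r s))"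
        using Ca by (subst nM) (auto intro: opn_le_sum)
      also have "\<dots> \<le> (\<Sum>r<n. \<Sum>s<n. \<eta>)"
        using entry by (intro sum_mono) simp
      also have "\<dots> = \<delta> / 2" using n by (simp add: \<eta>_def)
      also have "\<dots> < \<epsilon>" using \<delta> by simp
      finally show ?thesis .
    qed
    have inB: "(\<one>\<^bsub>M\<^esub> \<ominus>\<^bsub>M\<^esub> diag g) \<otimes>\<^bsub>M\<^esub> C j \<in> mats_over n n B" if j: "j \<in> {1..m}" for j
    proof -
      have "diag (\<one> \<ominus> g) \<otimes>\<^bsub>M\<^esub> C j \<in> mats_over n n (carrier A)"
        using M.m_closed[OF diag_closed C[OF j]] unfolding cM .
      moreover have "(diag (\<one> \<ominus> g) \<otimes>\<^bsub>M\<^esub> C j) $$ (r, s) \<in> B" if rs: "r < n" "s < n" for r s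
      proof -
        have "(diag (\<one> \<ominus> g) \<otimes>\<^bsub>M\<^esub> C j) $$ (r, s) = (\<one> \<ominus> g) \<otimes> C j $$ (r, s)"
          using gA by (intro diag_mult_entry C[OF j] rs) simp
        then show ?thesis using c(3)[of "(j, r, s)"] j rs by (simp add: C_def K_def)
      qed
      ultimately show ?thesis unfolding g1 by (simp add: mats_over_iff)
    qed
    have cuntz_B: "cuntz_subeq (M\<lparr>carrier := mats_over n n B\<rparr>) (diag g) y"
      using V VV by (intro cuntz_subeq_diag[OF LA(4) yB l _ _ fB g(1) cuntz(1)]) auto
    have "cuntz_subeq (M\<lparr>carrier := mats_over n n (carrier A)\<rparr>) (diag g) x"
      using U UU xM(1) cuntz(2) i eA gA
      by (intro cuntz_subeq_diag[OF carrier_is_unital_cstar_subalgebra, of x i U e]) (simp_all add: N_def cM)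
    then have cuntz_M: "cuntz_subeq M (diag g) x" unfolding upd .
    have gM: "diag g \<in> positives M" "\<one>\<^bsub>M\<^esub> \<ominus>\<^bsub>M\<^esub> diag g \<in> positives M"
      using M.positives_subalgebra(1)[OF BM] gpos by blast+
    have big: "nrm M ((\<one>\<^bsub>M\<^esub> \<ominus>\<^bsub>M\<^esub> diag g) \<otimes>\<^bsub>M\<^esub> x \<otimes>\<^bsub>M\<^esub> (\<one>\<^bsub>M\<^esub> \<ominus>\<^bsub>M\<^esub> diag g)) > 1 - \<epsilon>"
    proof -
      obtain s where s: "s \<in> carrier A" "x $$ (i, i) = s\<^sup>\<star> \<otimes> s"
        using xi(1) by (auto simp: positives_iff_square)
      obtain v where v: "\<And>m. v m \<in> carrier A"
        and lim: "limitin (norm_topology A) (\<lambda>m. v m \<otimes> e \<otimes> (v m)\<^sup>\<star>) g sequentially"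
        using cuntz(2) by (auto simp: cuntz_subeq_def)
      have vev: "v m \<otimes> e \<otimes> (v m)\<^sup>\<star> \<in> carrier A" for m using v[of m] eA by (simp add: star_closed)
      have "(\<lambda>m. iota A (v m \<otimes> e \<otimes> (v m)\<^sup>\<star>)) \<longlonglongrightarrow> iota A g"
        using lim vev gA by (subst (asm) limitin_iota) auto
      then have "(\<lambda>m. iota M (diag (v m \<otimes> e \<otimes> (v m)\<^sup>\<star>))) \<longlonglongrightarrow> iota M (diag g)"
        using vev gA by (intro diag_tendsto)
      moreover have "iota M (diag (v m \<otimes> e \<otimes> (v m)\<^sup>\<star>)) = iota M (diag (v m)) * iota M (diag e) * adj (iota M (diag (v m)))" for m
        using v[of m] eA by (simp add: diag_mult diag_star star_closed M.iota_mult M.iota_star M.star_closed)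
      ultimately have lim': "(\<lambda>m. iota M (diag (v m)) * iota M (diag e) * adj (iota M (diag (v m)))) \<longlonglongrightarrow> iota M (diag g)"
        by simp
      \<comment> \<open>The orthogonal copies of \<open>diag e\<close> in \<open>M\<close>: since
        the entry of \<open>x\<close> is \<open>s\<^sup>\<star> \<otimes> s\<close>, the mixed
        products reduce to the relations between the \<open>U r\<close>.\<close>
      have adjU: "adj (iota M (diag (s \<otimes> (U r)\<^sup>\<star>))) * iota M (diag (s \<otimes> (U t)\<^sup>\<star>)) = (if r = t then iota M (diag e) else 0)"
        if rt: "r \<le> k" "t \<le> k" for r t
      proof -
        have N: "r < N" "t < N" using rt by (auto simp: N_def)
        note Urt = U[OF N(1)] U[OF N(2)]
        have "adj (iota M (diag (s \<otimes> (U r)\<^sup>\<star>))) * iota M (diag (s \<otimes> (U t)\<^sup>\<star>))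
            = iota M (diag ((s \<otimes> (U r)\<^sup>\<star>)\<^sup>\<star> \<otimes> (s \<otimes> (U t)\<^sup>\<star>)))"
          using s Urt by (subst diag_mult) (auto simp: diag_star star_closed M.iota_mult M.iota_star M.star_closed)
        also have "(s \<otimes> (U r)\<^sup>\<star>)\<^sup>\<star> \<otimes> (s \<otimes> (U t)\<^sup>\<star>) = U r \<otimes> x $$ (i, i) \<otimes> (U t)\<^sup>\<star>"
          using s Urt by (simp add: star_mult star_closed star_star m_assoc)
        finally show ?thesis using UU[OF N] by (simp add: diag_zero)
      qed
      have e0: "iota M (diag e) \<noteq> 0"
      proof
        assume "iota M (diag e) = 0"
        then have "E (diag e) i i = 0" using i by (simp add: M.iota_eq_0_iff EM)
        then show False using i eA e(2) by (simp add: E_diag iota_eq_0_iff)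
      qed
      have "norm ((iota M \<one>\<^bsub>M\<^esub> - iota M (diag g)) * iota M x * (iota M \<one>\<^bsub>M\<^esub> - iota M (diag g))) > 1 - \<delta>"
      proof (rule k[OF _ adjU e0 _ _ _ lim'])
        show "cpos (iota M (diag g))" "iota M (diag g) \<preceq> iota M \<one>\<^bsub>M\<^esub>"
          using M.iota_contraction[OF gM] by blast+
      qed simp_all
      also have "norm ((iota M \<one>\<^bsub>M\<^esub> - iota M (diag g)) * iota M x * (iota M \<one>\<^bsub>M\<^esub> - iota M (diag g)))
          = nrm M ((\<one>\<^bsub>M\<^esub> \<ominus>\<^bsub>M\<^esub> diag g) \<otimes>\<^bsub>M\<^esub> x \<otimes>\<^bsub>M\<^esub> (\<one>\<^bsub>M\<^esub> \<ominus>\<^bsub>M\<^esub> diag g))"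
        using xM by (simp flip: M.iota_diff M.iota_mult)
      finally show ?thesis using \<delta>(3) by simp
    qed
    show "\<exists>c. \<exists>g\<in>mats_over n n B.
        (\<forall>j\<in>{1..m}. c j \<in> carrier M) \<and>
        g \<in> positives (M\<lparr>carrier := mats_over n n B\<rparr>) \<and> \<one>\<^bsub>M\<^esub> \<ominus>\<^bsub>M\<^esub> g \<in> positives (M\<lparr>carrier := mats_over n n B\<rparr>) \<and>
        (\<forall>j\<in>{1..m}. nrm M (c j \<ominus>\<^bsub>M\<^esub> a j) < \<epsilon>) \<and>
        (\<forall>j\<in>{1..m}. (\<one>\<^bsub>M\<^esub> \<ominus>\<^bsub>M\<^esub> g) \<otimes>\<^bsub>M\<^esub> c j \<in> mats_over n n B) \<and>
        cuntz_subeq (M\<lparr>carrier := mats_over n n B\<rparr>) g y \<and> cuntz_subeq M g x \<and>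
        nrm M ((\<one>\<^bsub>M\<^esub> \<ominus>\<^bsub>M\<^esub> g) \<otimes>\<^bsub>M\<^esub> x \<otimes>\<^bsub>M\<^esub> (\<one>\<^bsub>M\<^esub> \<ominus>\<^bsub>M\<^esub> g)) > 1 - \<epsilon>"
      by (rule exI[of _ C], rule bexI[OF _ diag_in_mats_over[OF sub g(1)]])
        (intro conjI ballI C close inB gpos cuntz_B cuntz_M big)
  qed
qed

end

end

theorem corollary5p8:
  fixes A :: "'a star_alg" and B :: "'a set"
  assumes "unital_cstar_algebra A"
    and "simple_cstar A"
    and "infinite_dimensional A"
    and "stably_finite A"
    and "large_subalgebra B A"
  shows "stably_large B A"
  using assms(4) unital_cstar_algebra.matrix_algebra_large[OF assms(1) _ assms(5)]
  by (simp add: stably_large_def stably_finite_def)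

end
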